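(* Let $M$ be a locally compact, but not compact, Polish space with a positive, locally finite Borel measure $\mu$ of full topological support, and let $\{U_t:t\ge 0\}$ be a strongly continuous semigroup of bounded, positivity preserving linear operators on $L^2(M,\mu)$ with adjoint semigroup $\{U_t^*:t\ge 0\}$, both given for $t>0$ by a real-valued measurable kernel $u_t(x,y)$. Fix $t_0>0$ and assume: every $U_t$, $t>0$, is compact on $L^2(M,\mu)$; $U_{t_0}$ is positivity improving; both semigroups have the strong Feller property; $U_{t_0},U_{t_0}^*:L^2(M,\mu)\to L^\infty(M,\mu)$ are bounded; and for every $t\ge t_0$ and $\epsilon>0$ there is a compact set $K\subset M$ with $U_t\mathbf 1_M(x)\le\epsilon$ and $U_t^*\mathbf 1_M(x)\le\epsilon$ for every $x\in M\setminus K$. Let $\lambda_0,\phi_0,\psi_0,\mathcal N,\gamma$ be as defined in the context. Assume that both semigroups $\{U_t\}$ and $\{U_t^*\}$ are progressively ground state dominated (pGSD) for the exhausting family of compact sets $\{K_t:t\ge t_0\}$. Then $\phi_0,\psi_0\in L^1(M,\mu)$ and, for every $a,b\in(0,1)$ with $a+2b=1$ and every $p\in[1,\infty]$, there exists some $C>0$ such that for all $t>\frac{4}{a\wedge b}\,t_0$ $$\sup_{\sigma}\ \sup_{f\in L^p(M,\mu),\ \|f\|_p\le1}\left|\frac{\sigma(U_tf)}{\sigma(U_t\mathbf 1_M)}-m(f)\right|\le C\kappa_b(t) \quad\text{and}\quad \sup_{\sigma}\ \sup_{f\in L^p(M,\mu),\ \|f\|_p\le1}\left|\frac{\sigma(U_t^*f)}{\sigma(U_t^*\mathbf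 1_M)}-m^*(f)\right|\le C\kappa_b(t),$$ where in both cases $\sigma$ ranges over all probability measures on $M$ with $\operatorname{supp}\sigma\subset K_{at}$ and $\operatorname{supp}\sigma\cap(M\setminus\mathcal N)\ne\emptyset$, where $m(E)=\int_E\psi_0\,d\mu/\int_M\psi_0\,d\mu$, $m^*(E)=\int_E\phi_0\,d\mu/\int_M\phi_0\,d\mu$, and $$\kappa_b(t):=e^{-\gamma bt}+\sup_{x\in M\setminus K_{bt}}U_{t_0}\mathbf 1_M(x)+\sup_{x\in M\setminus K_{bt}}U_{t_0}^*\mathbf 1_M(x).$$
   Context: For a measure $\sigma$ write $\sigma(g)=\int g\,d\sigma$; $\mathbf 1_M$ is the constant function $1$; $\|\cdot\|_p$ is the $L^p(M,\mu)$ norm; $a\wedge b=\min(a,b)$. Kernels: $U_tf(x)=\int u_t(x,y)f(y)\,\mu(dy)$ and $U_t^*g(y)=\int u_t(x,y)g(x)\,\mu(dx)$, $t>0$; these formulas also define $U_t,U_t^*$ on other $L^p$ spaces. Positivity preserving: $f\ge0$ a.e. implies $U_tf\ge 0$ a.e. Positivity improving: $f\ge 0$, $f\not\equiv 0$ in $L^2$ implies $U_{t_0}f>0$ $\mu$-a.e. Strong Feller property: for every $t>0$ and $f\in L^\infty(M,\mu)$ one has $U_tf,U_t^*f\in C_b(M)$. Under the assumptions $U_t,U_t^*$ map $L^p(M,\mu)$ into $C_b(M)$ for all $t>2t_0$, $p\in[1,\infty]$; $U_tf$, $U_t^*f$ are always understood as these continuous functions. Ground states: with $A$ the generator of $\{U_t\}$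 and $A^*$ that of $\{U_t^*\}$, $\lambda_0:=\inf\mathrm{Re}(\mathrm{Spec}(-A))=\inf\mathrm{Re}(\mathrm{Spec}(-A^* ))$ is a joint isolated simple eigenvalue of $-A$ and $-A^*$, with $L^2$-normalized, $\mu$-a.e. strictly positive eigenfunctions $\phi_0$ (of $-A$) and $\psi_0$ (of $-A^*$), so $U_t\phi_0=e^{-\lambda_0t}\phi_0$, $U_t^*\psi_0=e^{-\lambda_0t}\psi_0$; they have continuous bounded versions, which are used. Set $\Lambda:=\int\phi_0\psi_0\,d\mu$ and $\mathcal N:=\{\phi_0=0\}\cup\{\psi_0=0\}$ (a closed $\mu$-null set). The constant $\gamma$: under the assumptions there are constants $C_0,\gamma>0$ (known result) such that $|e^{\lambda_0t}u_t(x,y)-\Lambda^{-1}\phi_0(x)\psi_0(y)|\le C_0e^{-\gamma t}$ for all $t>2t_0$ and $\mu\otimes\mu$-a.a. $(x,y)$; such a $\gamma$ is fixed. Exhausting family: a family $\{K_t:t\ge t_1\}$ of compact subsets of $M$ with $K_t\subset K_s$ for $t_1\le t<s$, $\bigcup_{t\ge t_1}K_t=M$, and such that every compact $K\subset M$ is contained in some $K_t$. pGSD: $\{U_t\}$ is pGSD for the exhausting family $\{K_t:t\ge t_1\}$ if there is $C'>0$ with $\mathbf 1_{K_t}(x)U_t\mathbf 1_M(x)\le C'e^{-\lambda_0t}\phi_0(x)$ for all $t\ge t_1$, $x\in M$; for $\{U_t^*\}$ replace $U_t,\phi_0$ by $U_t^*,\psi_0$. *)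

theory Defs
  imports "HOL-Probability.Probability"
begin

section \<open>Lebesgue spaces\<close>

text \<open>Elements of the Lebesgue spaces are represented by measurable functions, so operator
  identities below hold only almost everywhere. The exponent \<^term>\<open>\<top> :: ennreal\<close> plays the
  role of infinity.\<close>

definition Lp :: "'a measure \<Rightarrow> ennreal \<Rightarrow> ('a \<Rightarrow> 'b::{banach, second_countable_topology}) set" where
  "Lp \<mu> p = {f \<in> borel_measurable \<mu>.
     if p = \<top> then esssup \<mu> (\<lambda>x. ennreal (norm (f x))) < \<top>
     else integrable \<mu> (\<lambda>x. norm (f x) powr enn2real p)}"

definition Lp_norm :: "'a measure \<Rightarrow> ennreal \<Rightarrow> ('a \<Rightarrow> 'b::{banach, second_countable_topology}) \<Rightarrow> real" where
  "Lp_norm \<mu> p f =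
     (if p = \<top> then enn2real (esssup \<mu> (\<lambda>x. ennreal (norm (f x))))
      else (\<integral>x. norm (f x) powr enn2real p \<partial>\<mu>) powr (1 / enn2real p))"

definition bounded_Lp_operator ::
  "'a measure \<Rightarrow> ennreal \<Rightarrow> ennreal \<Rightarrow> (('a \<Rightarrow> complex) \<Rightarrow> 'a \<Rightarrow> complex) \<Rightarrow> bool" where
  "bounded_Lp_operator \<mu> p q T \<longleftrightarrow>
     (\<forall>f \<in> Lp \<mu> p. T f \<in> Lp \<mu> q) \<and>
     (\<forall>f \<in> Lp \<mu> p. \<forall>g \<in> Lp \<mu> p. \<forall>c d.
        AE x in \<mu>. T (\<lambda>y. c * f y + d * g y) x = c * T f x + d * T g x) \<and>
     (\<exists>C. \<forall>f \<in> Lp \<mu> p. Lp_norm \<mu> q (T f) \<le> C * Lp_norm \<mu> p f)"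

definition compact_L2_operator ::
  "'a measure \<Rightarrow> (('a \<Rightarrow> complex) \<Rightarrow> 'a \<Rightarrow> complex) \<Rightarrow> bool" where
  "compact_L2_operator \<mu> T \<longleftrightarrow>
     bounded_Lp_operator \<mu> 2 2 T \<and>
     (\<forall>F :: nat \<Rightarrow> 'a \<Rightarrow> complex. range F \<subseteq> Lp \<mu> 2 \<and> (\<exists>B. \<forall>n. Lp_norm \<mu> 2 (F n) \<le> B) \<longrightarrow>
        (\<exists>r g. strict_mono r \<and> g \<in> Lp \<mu> 2 \<and>
           (\<lambda>n. Lp_norm \<mu> 2 (\<lambda>x. T (F (r n)) x - g x)) \<longlonglongrightarrow> 0))"

section \<open>Semigroups on the complex Hilbert space of square integrable functions\<close>

definition strongly_continuous_semigroup ::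
  "'a measure \<Rightarrow> (real \<Rightarrow> ('a \<Rightarrow> complex) \<Rightarrow> 'a \<Rightarrow> complex) \<Rightarrow> bool" where
  "strongly_continuous_semigroup \<mu> T \<longleftrightarrow>
     (\<forall>t\<ge>0. bounded_Lp_operator \<mu> 2 2 (T t)) \<and>
     (\<forall>f \<in> Lp \<mu> 2. AE x in \<mu>. T 0 f x = f x) \<and>
     (\<forall>s\<ge>0. \<forall>t\<ge>0. \<forall>f \<in> Lp \<mu> 2. AE x in \<mu>. T (s + t) f x = T s (T t f) x) \<and>
     (\<forall>f \<in> Lp \<mu> 2. \<forall>s\<ge>0.
        ((\<lambda>t. Lp_norm \<mu> 2 (\<lambda>x. T t f x - T s f x)) \<longlongrightarrow> 0) (at s within {0..}))"

definition adjoint_operators_family ::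
  "'a measure \<Rightarrow> (real \<Rightarrow> ('a \<Rightarrow> complex) \<Rightarrow> 'a \<Rightarrow> complex) \<Rightarrow>
   (real \<Rightarrow> ('a \<Rightarrow> complex) \<Rightarrow> 'a \<Rightarrow> complex) \<Rightarrow> bool" where
  "adjoint_operators_family \<mu> T S \<longleftrightarrow>
     (\<forall>t\<ge>0. bounded_Lp_operator \<mu> 2 2 (S t) \<and>
        (\<forall>f \<in> Lp \<mu> 2. \<forall>g \<in> Lp \<mu> 2.
           (\<integral>x. T t f x * cnj (g x) \<partial>\<mu>) = (\<integral>x. f x * cnj (S t g x) \<partial>\<mu>)))"

definition positivity_preserving :: "'a measure \<Rightarrow> (('a \<Rightarrow> real) \<Rightarrow> 'a \<Rightarrow> real) \<Rightarrow> bool" where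
  "positivity_preserving \<mu> T \<longleftrightarrow>
     (\<forall>f \<in> Lp \<mu> 2. (AE x in \<mu>. 0 \<le> f x) \<longrightarrow> (AE x in \<mu>. 0 \<le> T f x))"

definition positivity_improving :: "'a measure \<Rightarrow> (('a \<Rightarrow> real) \<Rightarrow> 'a \<Rightarrow> real) \<Rightarrow> bool" where
  "positivity_improving \<mu> T \<longleftrightarrow>
     (\<forall>f \<in> Lp \<mu> 2. (AE x in \<mu>. 0 \<le> f x) \<and> \<not> (AE x in \<mu>. f x = 0) \<longrightarrow> (AE x in \<mu>. 0 < T f x))"

text \<open>Unbounded operators are represented by their graphs.\<close>

definition generator ::
  "'a measure \<Rightarrow> (real \<Rightarrow> ('a \<Rightarrow> complex) \<Rightarrow> 'a \<Rightarrow> complex) \<Rightarrow>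
   (('a \<Rightarrow> complex) \<times> ('a \<Rightarrow> complex)) set" where
  "generator \<mu> T = {(f, g). f \<in> Lp \<mu> 2 \<and> g \<in> Lp \<mu> 2 \<and>
     ((\<lambda>t. Lp_norm \<mu> 2 (\<lambda>x. (T t f x - f x) /\<^sub>R t - g x)) \<longlongrightarrow> 0) (at_right 0)}"

definition neg_operator ::
  "(('a \<Rightarrow> complex) \<times> ('a \<Rightarrow> complex)) set \<Rightarrow> (('a \<Rightarrow> complex) \<times> ('a \<Rightarrow> complex)) set" where
  "neg_operator G = {(f, \<lambda>x. - g x) | f g. (f, g) \<in> G}"

definition resolvent_set ::
  "'a measure \<Rightarrow> (('a \<Rightarrow> complex) \<times> ('a \<Rightarrow> complex)) set \<Rightarrow> complex set" where
  "resolvent_set \<mu> G = {z.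
     (\<forall>h \<in> Lp \<mu> 2. \<exists>(f, g) \<in> G. AE x in \<mu>. z * f x - g x = h x) \<and>
     (\<exists>C. \<forall>(f, g) \<in> G. Lp_norm \<mu> 2 f \<le> C * Lp_norm \<mu> 2 (\<lambda>x. z * f x - g x))}"

definition spectrum ::
  "'a measure \<Rightarrow> (('a \<Rightarrow> complex) \<times> ('a \<Rightarrow> complex)) set \<Rightarrow> complex set" where
  "spectrum \<mu> G = - resolvent_set \<mu> G"

definition eigenfunction ::
  "'a measure \<Rightarrow> (('a \<Rightarrow> complex) \<times> ('a \<Rightarrow> complex)) set \<Rightarrow> complex \<Rightarrow> ('a \<Rightarrow> complex) \<Rightarrow> bool" where
  "eigenfunction \<mu> G z f \<longleftrightarrow> (f, \<lambda>x. z * f x) \<in> G \<and> \<not> (AE x in \<mu>. f x = 0)"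

definition spectral_bottom ::
  "'a measure \<Rightarrow> (real \<Rightarrow> ('a \<Rightarrow> complex) \<Rightarrow> 'a \<Rightarrow> complex) \<Rightarrow> real" where
  "spectral_bottom \<mu> T = Inf (Re ` spectrum \<mu> (neg_operator (generator \<mu> T)))"

definition ground_state ::
  "'a::topological_space measure \<Rightarrow> (real \<Rightarrow> ('a \<Rightarrow> complex) \<Rightarrow> 'a \<Rightarrow> complex) \<Rightarrow>
   real \<Rightarrow> ('a \<Rightarrow> real) \<Rightarrow> bool" where
  "ground_state \<mu> T lam \<phi> \<longleftrightarrow>
     \<phi> \<in> bcontfun \<and>
     eigenfunction \<mu> (neg_operator (generator \<mu> T)) (complex_of_real lam) (\<lambda>x. complex_of_real (\<phi> x)) \<and>
     Lp_norm \<mu> 2 \<phi> = 1 \<and>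
     (AE x in \<mu>. 0 < \<phi> x)"

section \<open>Kernel operators and their continuous versions\<close>

text \<open>Values in an arbitrary Banach space cover real and complex functions at once.\<close>

definition kernel_operator ::
  "'a measure \<Rightarrow> ('a \<Rightarrow> 'a \<Rightarrow> real) \<Rightarrow>
   ('a \<Rightarrow> 'b::{banach, second_countable_topology}) \<Rightarrow> 'a \<Rightarrow> 'b" where
  "kernel_operator \<mu> k f = (\<lambda>x. \<integral>y. k x y *\<^sub>R f y \<partial>\<mu>)"

definition kernel_semigroup ::
  "'a measure \<Rightarrow> (real \<Rightarrow> 'a \<Rightarrow> 'a \<Rightarrow> real) \<Rightarrow>
   real \<Rightarrow> ('a \<Rightarrow> 'b::{banach, second_countable_topology}) \<Rightarrow> 'a \<Rightarrow> 'b" where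
  "kernel_semigroup \<mu> u t f = (if t = 0 then f else kernel_operator \<mu> (u t) f)"

definition transpose_kernel :: "(real \<Rightarrow> 'a \<Rightarrow> 'a \<Rightarrow> real) \<Rightarrow> real \<Rightarrow> 'a \<Rightarrow> 'a \<Rightarrow> real" where
  "transpose_kernel u = (\<lambda>t x y. u t y x)"

text \<open>The Bochner integral of a non-integrable function is 0, hence convergence of the integrals
  defining a kernel operator has to be required explicitly.\<close>

definition kernel_defined_on ::
  "'a measure \<Rightarrow> ('a \<Rightarrow> 'a \<Rightarrow> real) \<Rightarrow> ('a \<Rightarrow> complex) set \<Rightarrow> bool" where
  "kernel_defined_on \<mu> k S \<longleftrightarrow> (\<forall>f \<in> S. AE x in \<mu>. integrable \<mu> (\<lambda>y. k x y *\<^sub>R f y))"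

text \<open>If the measure has full topological support, a function has at most one continuous version
  (see \<open>cont_version_eq\<close> below).\<close>

definition cont_version ::
  "'a::topological_space measure \<Rightarrow> ('a \<Rightarrow> 'b::metric_space) \<Rightarrow> 'a \<Rightarrow> 'b" where
  "cont_version \<mu> f = (THE g. g \<in> bcontfun \<and> (AE x in \<mu>. g x = f x))"

definition cont_semigroup ::
  "'a::topological_space measure \<Rightarrow> (real \<Rightarrow> 'a \<Rightarrow> 'a \<Rightarrow> real) \<Rightarrow>
   real \<Rightarrow> ('a \<Rightarrow> 'b::{banach, second_countable_topology}) \<Rightarrow> 'a \<Rightarrow> 'b" where
  "cont_semigroup \<mu> u t f = cont_version \<mu> (kernel_semigroup \<mu> u t f)"

definition strong_feller ::
  "'a::topological_space measure \<Rightarrow> (real \<Rightarrow> 'a \<Rightarrow> 'a \<Rightarrow> real) \<Rightarrow> bool" where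
  "strong_feller \<mu> u \<longleftrightarrow>
     (\<forall>t>0. kernel_defined_on \<mu> (u t) (Lp \<mu> \<top>) \<and>
        (\<forall>f :: 'a \<Rightarrow> complex. f \<in> Lp \<mu> \<top> \<longrightarrow>
           (\<exists>g \<in> bcontfun. AE x in \<mu>. g x = kernel_semigroup \<mu> u t f x)))"

section \<open>Topological notions and the decay rate\<close>

definition measure_support :: "'a::topological_space measure \<Rightarrow> 'a set" where
  "measure_support \<sigma> = {x. \<forall>V. open V \<and> x \<in> V \<longrightarrow> 0 < emeasure \<sigma> V}"

definition locally_finite_measure :: "'a::topological_space measure \<Rightarrow> bool" where
  "locally_finite_measure \<mu> \<longleftrightarrow> (\<forall>x. \<exists>V. open V \<and> x \<in> V \<and> emeasure \<mu> V < \<infinity>)"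

definition exhausting_family :: "real \<Rightarrow> (real \<Rightarrow> 'a::topological_space set) \<Rightarrow> bool" where
  "exhausting_family t\<^sub>1 K \<longleftrightarrow>
     (\<forall>t\<ge>t\<^sub>1. compact (K t)) \<and>
     (\<forall>t s. t\<^sub>1 \<le> t \<and> t < s \<longrightarrow> K t \<subseteq> K s) \<and>
     (\<Union>t\<in>{t\<^sub>1..}. K t) = UNIV \<and>
     (\<forall>L. compact L \<longrightarrow> (\<exists>t\<ge>t\<^sub>1. L \<subseteq> K t))"

definition pGSD ::
  "'a::topological_space measure \<Rightarrow> (real \<Rightarrow> 'a \<Rightarrow> 'a \<Rightarrow> real) \<Rightarrow> real \<Rightarrow> ('a \<Rightarrow> real) \<Rightarrow>
   real \<Rightarrow> (real \<Rightarrow> 'a set) \<Rightarrow> bool" where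
  "pGSD \<mu> u lam \<phi> t\<^sub>1 K \<longleftrightarrow>
     (\<exists>C>0. \<forall>t\<ge>t\<^sub>1. \<forall>x.
        indicator (K t) x * cont_semigroup \<mu> u t (\<lambda>_. 1) x \<le> C * exp (- lam * t) * \<phi> x)"

definition normalized_density :: "'a measure \<Rightarrow> ('a \<Rightarrow> real) \<Rightarrow> 'a measure" where
  "normalized_density \<mu> \<psi> = density \<mu> (\<lambda>x. ennreal (\<psi> x / (\<integral>y. \<psi> y \<partial>\<mu>)))"

definition admissible_measures ::
  "'a::topological_space set \<Rightarrow> 'a set \<Rightarrow> 'a measure set" where
  "admissible_measures L N = {\<sigma>. sets \<sigma> = sets borel \<and> prob_space \<sigma> \<and>
     measure_support \<sigma> \<subseteq> L \<and> measure_support \<sigma> \<inter> - N \<noteq> {}}"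

text \<open>The suprema are taken in the extended nonnegative reals, so finiteness is part of an upper
  bound and the supremum over an empty family is 0.\<close>

definition quasi_ergodic_error ::
  "'a::topological_space measure \<Rightarrow> (real \<Rightarrow> 'a \<Rightarrow> 'a \<Rightarrow> real) \<Rightarrow> real \<Rightarrow> ennreal \<Rightarrow>
   'a measure set \<Rightarrow> 'a measure \<Rightarrow> ennreal" where
  "quasi_ergodic_error \<mu> u t p S m =
     (SUP \<sigma> \<in> S. SUP f \<in> {f :: 'a \<Rightarrow> complex. f \<in> Lp \<mu> p \<and> Lp_norm \<mu> p f \<le> 1}.
        ennreal (norm (
          (\<integral>x. cont_semigroup \<mu> u t f x \<partial>\<sigma>) / (\<integral>x. cont_semigroup \<mu> u t (\<lambda>_. 1) x \<partial>\<sigma>)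
          - (\<integral>x. f x \<partial>m))))"

definition kappa ::
  "'a::topological_space measure \<Rightarrow> (real \<Rightarrow> 'a \<Rightarrow> 'a \<Rightarrow> real) \<Rightarrow> real \<Rightarrow> real \<Rightarrow>
   (real \<Rightarrow> 'a set) \<Rightarrow> real \<Rightarrow> real \<Rightarrow> real" where
  "kappa \<mu> u t\<^sub>0 \<gamma> K b t =
     exp (- \<gamma> * b * t)
     + (SUP x \<in> - K (b * t). cont_semigroup \<mu> u t\<^sub>0 (\<lambda>_. 1) x)
     + (SUP x \<in> - K (b * t). cont_semigroup \<mu> (transpose_kernel u) t\<^sub>0 (\<lambda>_. 1) x)"

lemma cont_version_eq:
  fixes g :: "'a::topological_space \<Rightarrow> 'b::metric_space"
  assumes "sets \<mu> = sets borel" "measure_support \<mu> = UNIV"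
    and g: "g \<in> bcontfun" "AE x in \<mu>. g x = f x"
  shows "cont_version \<mu> f = g"
  unfolding cont_version_def
proof (rule the_equality)
  fix h assume h: "h \<in> bcontfun \<and> (AE x in \<mu>. h x = f x)"
  define V where "V = {x. h x \<noteq> g x}"
  have "open V"
    unfolding V_def using g(1) conjunct1[OF h]
    by (intro open_Collect_neq) (simp_all add: bcontfun_def)
  have "AE x in \<mu>. x \<notin> V"
    using g(2) conjunct2[OF h] by eventually_elim (simp add: V_def)
  moreover have "V \<in> sets \<mu>"
    using \<open>open V\<close> assms(1) by simp
  ultimately have "V \<in> null_sets \<mu>"
    by (simp add: AE_iff_null_sets)
  then have "emeasure \<mu> V = 0"
    by (rule null_setsD1)
  have "V = {}"
  proof (rule equals0I)
    fix x assume "x \<in> V"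
    moreover have "x \<in> measure_support \<mu>"
      using assms(2) by simp
    ultimately have "0 < emeasure \<mu> V"
      using \<open>open V\<close> unfolding measure_support_def by blast
    then show False
      using \<open>emeasure \<mu> V = 0\<close> by simp
  qed
  then show "h = g" by (simp add: V_def fun_eq_iff)
qed (use g in simp)

end

theory Submission
  imports Defs
begin

text \<open>
Let \<open>v\<^sub>t\<close> be the kernel \<open>u\<^sub>t\<close> multiplied by \<open>exp (lam\<^sub>0 t)\<close>, let \<open>P\<^sub>t\<close> be the operator with
kernel \<open>v\<^sub>t\<close>, and let \<open>d\<^sub>t(x, y) = v\<^sub>t(x, y) - \<phi>(x) \<psi>(y) / \<Lambda>\<close> be the deviation from the rank-one
limit. Both ground states are invariant, \<open>P\<^sub>t \<phi> = \<phi>\<close> and dually for \<open>\<psi>\<close>, so the rank-one kernel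
absorbs \<open>v\<^sub>t\<close> from either side. Hence composition of kernels gives \<open>d\<^sub>s\<^sub>+\<^sub>r = d\<^sub>s d\<^sub>r\<close> and
\<open>d\<^sub>r\<^sub>+\<^sub>s = v\<^sub>r d\<^sub>s\<close> (\<open>deviation_deviation\<close>, \<open>kernel_deviation\<close>).

Split the time as \<open>t = r + s + s\<close> with \<open>r = a t\<close> and \<open>s = b t\<close>; then \<open>\<bar>d\<^sub>t\<bar>\<close> is dominated by the
product \<open>v\<^sub>r \<bar>d\<^sub>s\<bar> \<bar>d\<^sub>s\<bar>\<close>. The two deviations yield the rate, and the factor \<open>v\<^sub>r\<close> yields \<open>\<phi>\<close>: by
progressive ground state domination \<open>P\<^sub>r 1\<close> is at most a multiple of \<open>\<phi>\<close> on \<open>K\<^sub>r\<close>, which carries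
the initial distribution \<open>\<sigma>\<close>. On the other side \<open>\<phi> = P\<^sub>t \<phi>\<close> is at most a multiple of \<open>P\<^sub>t 1\<close>,
so the denominator \<open>\<sigma>(P\<^sub>t 1)\<close> is at least a multiple of \<open>\<sigma>(\<phi>)\<close>. The number \<open>\<sigma>(\<phi>)\<close> cancels in the
quotient, which makes the estimate uniform in \<open>\<sigma>\<close> (\<open>integral_ratio_estimate\<close>,
\<open>quasi_ergodic_bound\<close>).

For the rate (\<open>deviation_L1_bound\<close>) the intermediate variable \<open>z\<close> in the row integrals of
\<open>\<bar>d\<^sub>s\<bar> \<bar>d\<^sub>s\<bar>\<close> is split at \<open>K\<^sub>s\<close>. For \<open>z\<close> in \<open>K\<^sub>s\<close> the first factor is of order \<open>exp (- \<gamma> s)\<close>, and the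
row integral of the second one is at most a multiple of \<open>\<phi>(z)\<close>, which is integrable. For \<open>z\<close>
outside \<open>K\<^sub>s\<close> that row integral is at most a multiple of \<open>P\<^sub>t\<^sub>0 1(z)\<close>, because
\<open>P\<^sub>s 1 = P\<^sub>t\<^sub>0 P\<^sub>s\<^sub>-\<^sub>t\<^sub>0 1\<close> and \<open>\<phi> = P\<^sub>t\<^sub>0 \<phi>\<close>. The exponent \<open>p\<close> enters only through the bound
\<open>\<bar>f\<bar> \<le> 1 + h\<close> with \<open>h\<close> of integral at most \<open>1\<close>, valid on the unit ball of every Lebesgue space with
exponent at least \<open>1\<close>; the part \<open>h\<close> is controlled by the uniform bound on the deviation.

Three further facts carry the proof.
  \<^item> Invariance (\<open>phi_invariant\<close>): for a set \<open>D\<close> of finite measure \<open>P\<^sub>n 1\<^sub>D\<close> converges uniformly to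
    a multiple of \<open>\<phi>\<close>, and the bounded operator \<open>P\<^sub>t\<close> only shifts \<open>n\<close> to \<open>n + t\<close>.
  \<^item> Integrability (\<open>phi_integral_finite\<close>): the dual domination bounds the integral of
    \<open>v\<^sub>t(x, y)\<close> over \<open>x\<close> in \<open>D\<close> by a multiple of \<open>\<psi>(y)\<close>, and for large \<open>t\<close> this integral is close to
    \<open>\<psi>(y) / \<Lambda>\<close> times the integral of \<open>\<phi>\<close> over \<open>D\<close>.
  \<^item> Uniform boundedness of \<open>P\<^sub>t 1\<close> (\<open>uniform_norm_bound\<close>): Baire's theorem on a time interval
    turns boundedness at each time into boundedness on compact time intervals; domination inside
    a compact set and tightness outside of it then propagate one bound to all later times.

The identities between kernels hold almost everywhere. They are obtained from the hypotheses on
operators in \<open>kernel_nonneg\<close> and \<open>kernel_law\<close>. The whole setting is symmetric under transposition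
of the kernel, so the dual statements are the same statements for the transposed kernel.
\<close>

section \<open>Kernels acting on nonnegative functions\<close>

text \<open>Nonnegative extended values make every integral meaningful, so that Tonelli's theorem and
monotone convergence apply without integrability conditions. The dual operator is the one of
the transposed kernel.\<close>

definition nn_kernel :: "'a measure \<Rightarrow> ('a \<Rightarrow> 'a \<Rightarrow> real) \<Rightarrow> ('a \<Rightarrow> ennreal) \<Rightarrow> 'a \<Rightarrow> ennreal" where
  "nn_kernel \<mu> k f x = (\<integral>\<^sup>+y. ennreal (k x y) * f y \<partial>\<mu>)"

lemma nn_kernel_mono:
  assumes "AE y in \<mu>. f y \<le> g y"
  shows "nn_kernel \<mu> k f x \<le> nn_kernel \<mu> k g x"
  unfolding nn_kernel_def using assms
  by (intro nn_integral_mono_AE) (auto elim!: eventually_mono intro: mult_left_mono)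

lemma (in sigma_finite_measure) nn_kernel_measurable [measurable]:
  assumes [measurable]: "case_prod k \<in> borel_measurable (M \<Otimes>\<^sub>M M)" "f \<in> borel_measurable M"
  shows "nn_kernel M k f \<in> borel_measurable M"
  unfolding nn_kernel_def[abs_def] by measurable

lemma transpose_kernel_transpose [simp]: "transpose_kernel (transpose_kernel u) = u"
  by (simp add: transpose_kernel_def)

lemma (in sigma_finite_measure) finite_exhaustion:
  "\<exists>D :: nat \<Rightarrow> 'a set. (\<forall>i. D i \<in> sets M \<and> emeasure M (D i) < \<infinity>) \<and> incseq D \<and> (\<Union>i. D i) = space M"
proof -
  obtain D :: "nat \<Rightarrow> 'a set" where "range D \<subseteq> sets M" "(\<Union>i. D i) = space M"
    "\<And>i. emeasure M (D i) \<noteq> \<infinity>" "incseq D"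
    by (rule sigma_finite_incseq) blast
  then show ?thesis
    by (intro exI[of _ D]) (auto simp: less_top)
qed

text \<open>Tested on the set where \<open>f\<close> exceeds \<open>c\<close>, the hypothesis says that the excess has integral
\<open>0\<close>; intersecting with an exhaustion keeps the measure of that set finite, as needed for the
subtraction.\<close>

lemma (in sigma_finite_measure) AE_le_of_nn_integral_le:
  fixes f :: "'a \<Rightarrow> ennreal" and c :: real
  assumes [measurable]: "f \<in> borel_measurable M"
    and le: "\<And>A. A \<in> sets M \<Longrightarrow> emeasure M A < \<infinity> \<Longrightarrow>
      (\<integral>\<^sup>+x. f x * indicator A x \<partial>M) \<le> ennreal c * emeasure M A"
  shows "AE x in M. f x \<le> ennreal c"
proof -
  obtain D :: "nat \<Rightarrow> 'a set" where D: "\<forall>i. D i \<in> sets M \<and> emeasure M (D i) < \<infinity>"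
      "incseq D" "(\<Union>i. D i) = space M"
    using finite_exhaustion by blast
  have "AE x in M. x \<in> D i \<longrightarrow> f x \<le> ennreal c" for i
  proof -
    have [measurable]: "D i \<in> sets M" using D(1) by blast
    define A where "A = {x \<in> space M. x \<in> D i \<and> ennreal c < f x}"
    have A [measurable]: "A \<in> sets M" unfolding A_def by measurable
    have "emeasure M A \<le> emeasure M (D i)"
      by (intro emeasure_mono) (auto simp: A_def)
    also have "\<dots> < \<infinity>" using D(1) by blast
    finally have fin: "emeasure M A < \<infinity>" .
    have "(\<integral>\<^sup>+x. (f x - ennreal c) * indicator A x \<partial>M) + ennreal c * emeasure M A
        = (\<integral>\<^sup>+x. (f x - ennreal c) * indicator A x + ennreal c * indicator A x \<partial>M)"
      by (subst nn_integral_add) (auto simp: nn_integral_cmult_indicator)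
    also have "\<dots> = (\<integral>\<^sup>+x. f x * indicator A x \<partial>M)"
      by (intro nn_integral_cong) (auto simp: A_def indicator_def less_imp_le diff_add_cancel_ennreal)
    also have "\<dots> \<le> ennreal c * emeasure M A" using le[OF A fin] .
    finally have "ennreal c * emeasure M A + (\<integral>\<^sup>+x. (f x - ennreal c) * indicator A x \<partial>M)
        \<le> ennreal c * emeasure M A + 0"
      by (simp add: add.commute)
    moreover have "ennreal c * emeasure M A \<noteq> \<infinity>"
      using fin by (simp add: ennreal_mult_eq_top_iff)
    ultimately have "(\<integral>\<^sup>+x. (f x - ennreal c) * indicator A x \<partial>M) = 0"
      by (simp only: ennreal_add_left_cancel_le) simp
    then have "AE x in M. (f x - ennreal c) * indicator A x = 0"
      by (subst (asm) nn_integral_0_iff_AE) auto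
    with AE_space show ?thesis
      by eventually_elim
        (auto simp: A_def indicator_def not_less split: if_splits dest: ennreal_minus_eq_0)
  qed
  then have "AE x in M. \<forall>i. x \<in> D i \<longrightarrow> f x \<le> ennreal c"
    unfolding AE_all_countable by blast
  with AE_space show ?thesis
    by eventually_elim (use D(3) in auto)
qed

lemma (in sigma_finite_measure) nn_integral_exhaustion:
  assumes D: "\<forall>i. D i \<in> sets M" "incseq D" "(\<Union>i. D i) = space M"
    and [measurable]: "f \<in> borel_measurable M"
  shows "(\<integral>\<^sup>+x. f x \<partial>M) = (SUP i. \<integral>\<^sup>+x. f x * indicator (D i) x \<partial>M)"
proof -
  have [measurable]: "D i \<in> sets M" for i using D(1) by blast
  have "(SUP i. f x * indicator (D i) x) = f x" if x: "x \<in> space M" for x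
  proof -
    obtain i where "x \<in> D i" using D(3) x by blast
    then show ?thesis
      by (intro antisym SUP_least SUP_upper2[of i]) (auto simp: indicator_def)
  qed
  then have "(\<integral>\<^sup>+x. f x \<partial>M) = (\<integral>\<^sup>+x. (SUP i. f x * indicator (D i) x) \<partial>M)"
    by (intro nn_integral_cong) simp
  also have "\<dots> = (SUP i. \<integral>\<^sup>+x. f x * indicator (D i) x \<partial>M)"
    using D(2) by (intro nn_integral_monotone_convergence_SUP)
      (auto simp: incseq_def le_fun_def indicator_def)
  finally show ?thesis .
qed

text \<open>Turns a uniform comparison of a kernel with its limit into a comparison of integrals over a
set \<open>D\<close>, with the error \<open>c\<close> times the measure of \<open>D\<close>.\<close>

lemma nn_integral_kernel_diff_le:
  assumes [measurable]: "k \<in> borel_measurable M" "l \<in> borel_measurable M" "D \<in> sets M"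
    and le: "AE y in M. k y \<le> l y + (c::real)" and c: "0 \<le> c" and l: "AE y in M. 0 \<le> l y"
  shows "(\<integral>\<^sup>+y. ennreal (k y) * indicator D y \<partial>M)
    \<le> (\<integral>\<^sup>+y. ennreal (l y) * indicator D y \<partial>M) + ennreal c * emeasure M D"
proof -
  have "(\<integral>\<^sup>+y. ennreal (k y) * indicator D y \<partial>M)
      \<le> (\<integral>\<^sup>+y. ennreal (l y) * indicator D y + ennreal c * indicator D y \<partial>M)"
    using le l
    by (intro nn_integral_mono_AE, eventually_elim)
      (auto simp: indicator_def ennreal_plus[symmetric] c simp del: ennreal_plus intro!: ennreal_leI)
  also have "\<dots> = (\<integral>\<^sup>+y. ennreal (l y) * indicator D y \<partial>M) + ennreal c * emeasure M D"
    by (subst nn_integral_add) (auto simp: nn_integral_cmult_indicator)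
  finally show ?thesis .
qed

section \<open>Kernel semigroups converging to a rank-one kernel\<close>

text \<open>The part of the setting that is invariant under transposition of the kernel when \<open>\<phi>\<close> and \<open>\<psi>\<close>
are interchanged. Time dependence is only required to be continuous on rectangles, in a form in
which the kernel and its transpose are treated alike.\<close>

locale kernel_semigroup_limit = sigma_finite_measure \<mu> for \<mu> :: "'a measure" +
  fixes v :: "real \<Rightarrow> 'a \<Rightarrow> 'a \<Rightarrow> real" and \<phi> \<psi> :: "'a \<Rightarrow> real"
    and \<Lambda> \<gamma> t\<^sub>0 :: real and K :: "real \<Rightarrow> 'a set"
  assumes t0_pos: "0 < t\<^sub>0" and gamma_pos: "0 < \<gamma>" and Lambda_pos: "0 < \<Lambda>"
    and kernel_measurable: "\<And>t. 0 < t \<Longrightarrow> case_prod (v t) \<in> borel_measurable (\<mu> \<Otimes>\<^sub>M \<mu>)"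
    and kernel_nonneg: "\<And>t. 0 < t \<Longrightarrow> AE (x, y) in \<mu> \<Otimes>\<^sub>M \<mu>. 0 \<le> v t x y"
    and kernel_law: "\<And>s t. 0 < s \<Longrightarrow> 0 < t \<Longrightarrow> AE (x, y) in \<mu> \<Otimes>\<^sub>M \<mu>.
          ennreal (v (s + t) x y) = (\<integral>\<^sup>+z. ennreal (v s x z) * ennreal (v t z y) \<partial>\<mu>)"
    and phi_measurable [measurable]: "\<phi> \<in> borel_measurable \<mu>"
    and psi_measurable [measurable]: "\<psi> \<in> borel_measurable \<mu>"
    and phi_bounds: "\<exists>B. AE x in \<mu>. 0 < \<phi> x \<and> \<phi> x \<le> B"
    and psi_bounds: "\<exists>B. AE x in \<mu>. 0 < \<psi> x \<and> \<psi> x \<le> B"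
    and pairing: "(\<integral>\<^sup>+x. ennreal (\<phi> x * \<psi> x) \<partial>\<mu>) = ennreal \<Lambda>"
    and kernel_limit: "\<exists>C>0. \<forall>t>2 * t\<^sub>0. AE (x, y) in \<mu> \<Otimes>\<^sub>M \<mu>.
          \<bar>v t x y - \<phi> x * \<psi> y / \<Lambda>\<bar> \<le> C * exp (- \<gamma> * t)"
    and rectangle_continuous: "\<And>A B. A \<in> sets \<mu> \<Longrightarrow> B \<in> sets \<mu> \<Longrightarrow> emeasure \<mu> A < \<infinity> \<Longrightarrow>
          emeasure \<mu> B < \<infinity> \<Longrightarrow> continuous_on {0<..}
            (\<lambda>t. \<integral>\<^sup>+x. \<integral>\<^sup>+y. ennreal (v t x y) * indicator A x * indicator B y \<partial>\<mu> \<partial>\<mu>)"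
    and K_measurable: "\<And>t. t\<^sub>0 \<le> t \<Longrightarrow> K t \<in> sets \<mu>"
    and K_mono: "\<And>s t. t\<^sub>0 \<le> s \<Longrightarrow> s \<le> t \<Longrightarrow> K s \<subseteq> K t"
    and K_cover: "space \<mu> \<subseteq> (\<Union>t\<in>{t\<^sub>0..}. K t)"
begin

sublocale pair: pair_sigma_finite \<mu> \<mu> ..

lemma transposed: "kernel_semigroup_limit \<mu> (transpose_kernel v) \<psi> \<phi> \<Lambda> \<gamma> t\<^sub>0 K"
proof unfold_locales
  have swap: "AE (x, y) in \<mu> \<Otimes>\<^sub>M \<mu>. Q y x"
    if "AE (x, y) in \<mu> \<Otimes>\<^sub>M \<mu>. Q x y" for Q
  proof -
    have "AE (x, y) in distr (\<mu> \<Otimes>\<^sub>M \<mu>) (\<mu> \<Otimes>\<^sub>M \<mu>) (\<lambda>(x, y). (y, x)). Q x y"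
      by (subst pair.distr_pair_swap[symmetric]) (fact that)
    from AE_distrD[OF _ this] show ?thesis
      by (simp add: case_prod_beta')
  qed
  show "0 < t\<^sub>0" "0 < \<gamma>" "0 < \<Lambda>" by (fact t0_pos gamma_pos Lambda_pos)+
  show "\<phi> \<in> borel_measurable \<mu>" "\<psi> \<in> borel_measurable \<mu>" by measurable
  show "\<exists>B. AE x in \<mu>. 0 < \<phi> x \<and> \<phi> x \<le> B" "\<exists>B. AE x in \<mu>. 0 < \<psi> x \<and> \<psi> x \<le> B"
    by (fact phi_bounds psi_bounds)+
  show "(\<integral>\<^sup>+x. ennreal (\<psi> x * \<phi> x) \<partial>\<mu>) = ennreal \<Lambda>"
    using pairing by (simp add: mult.commute)
  show "K t \<in> sets \<mu>" if "t\<^sub>0 \<le> t" for t using K_measurable that .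
  show "K s \<subseteq> K t" if "t\<^sub>0 \<le> s" "s \<le> t" for s t using K_mono that .
  show "space \<mu> \<subseteq> (\<Union>t\<in>{t\<^sub>0..}. K t)" by (fact K_cover)
  show "case_prod (transpose_kernel v t) \<in> borel_measurable (\<mu> \<Otimes>\<^sub>M \<mu>)" if "0 < t" for t
  proof -
    have [measurable]: "case_prod (v t) \<in> borel_measurable (\<mu> \<Otimes>\<^sub>M \<mu>)"
      using kernel_measurable that .
    show ?thesis unfolding transpose_kernel_def by measurable
  qed
  show "AE (x, y) in \<mu> \<Otimes>\<^sub>M \<mu>. 0 \<le> transpose_kernel v t x y" if "0 < t" for t
    using swap[OF kernel_nonneg[OF that]] by (simp add: transpose_kernel_def)
  show "AE (x, y) in \<mu> \<Otimes>\<^sub>M \<mu>. ennreal (transpose_kernel v (s + t) x y)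
      = (\<integral>\<^sup>+z. ennreal (transpose_kernel v s x z) * ennreal (transpose_kernel v t z y) \<partial>\<mu>)"
    if "0 < s" "0 < t" for s t
    using swap[OF kernel_law[OF that(2,1)]]
    by (simp add: transpose_kernel_def add.commute mult.commute)
  show "\<exists>C>0. \<forall>t>2 * t\<^sub>0. AE (x, y) in \<mu> \<Otimes>\<^sub>M \<mu>.
          \<bar>transpose_kernel v t x y - \<psi> x * \<phi> y / \<Lambda>\<bar> \<le> C * exp (- \<gamma> * t)"
  proof -
    obtain C where "C > 0" "\<forall>t>2 * t\<^sub>0. AE (x, y) in \<mu> \<Otimes>\<^sub>M \<mu>.
          \<bar>v t x y - \<phi> x * \<psi> y / \<Lambda>\<bar> \<le> C * exp (- \<gamma> * t)"
      using kernel_limit by blast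
    then show ?thesis
      by (intro exI[of _ C]) (use swap in \<open>fastforce simp: transpose_kernel_def mult.commute\<close>)
  qed
  show "continuous_on {0<..} (\<lambda>t. \<integral>\<^sup>+x. \<integral>\<^sup>+y.
      ennreal (transpose_kernel v t x y) * indicator A x * indicator B y \<partial>\<mu> \<partial>\<mu>)"
    if [measurable]: "A \<in> sets \<mu>" "B \<in> sets \<mu>" and "emeasure \<mu> A < \<infinity>" "emeasure \<mu> B < \<infinity>" for A B
  proof (rule continuous_on_cong[THEN iffD1, OF refl _ rectangle_continuous[of B A]])
    fix t :: real assume "t \<in> {0<..}"
    then have [measurable]: "case_prod (v t) \<in> borel_measurable (\<mu> \<Otimes>\<^sub>M \<mu>)"
      using kernel_measurable by simp
    show "(\<integral>\<^sup>+x. \<integral>\<^sup>+y. ennreal (v t x y) * indicator B x * indicator A y \<partial>\<mu> \<partial>\<mu>)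
        = (\<integral>\<^sup>+x. \<integral>\<^sup>+y. ennreal (transpose_kernel v t x y) * indicator A x * indicator B y \<partial>\<mu> \<partial>\<mu>)"
      by (subst pair.Fubini'[symmetric]) (auto simp: transpose_kernel_def ac_simps)
  qed (use that in auto)
qed

lemma kernel_AE:
  assumes "0 < t"
  shows "AE x in \<mu>. AE y in \<mu>. 0 \<le> v t x y" 
  using pair.AE_pair[OF kernel_nonneg[OF assms]] by simp

lemma nn_kernel_law:
  assumes "0 < s" "0 < t" and [measurable]: "f \<in> borel_measurable \<mu>"
  shows "AE x in \<mu>. nn_kernel \<mu> (v (s + t)) f x = nn_kernel \<mu> (v s) (nn_kernel \<mu> (v t) f) x"
proof -
  have [measurable]: "case_prod (v s) \<in> borel_measurable (\<mu> \<Otimes>\<^sub>M \<mu>)"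
     "case_prod (v t) \<in> borel_measurable (\<mu> \<Otimes>\<^sub>M \<mu>)"
    using kernel_measurable assms by simp_all
  have "AE x in \<mu>. AE y in \<mu>.
      ennreal (v (s + t) x y) = (\<integral>\<^sup>+z. ennreal (v s x z) * ennreal (v t z y) \<partial>\<mu>)"
    using pair.AE_pair[OF kernel_law[OF assms(1,2)]] by simp
  with AE_space show ?thesis
  proof eventually_elim
    case (elim x)
    have [measurable]: "x \<in> space \<mu>" by fact
    have "nn_kernel \<mu> (v (s + t)) f x
        = (\<integral>\<^sup>+y. (\<integral>\<^sup>+z. ennreal (v s x z) * ennreal (v t z y) \<partial>\<mu>) * f y \<partial>\<mu>)"
      unfolding nn_kernel_def using elim(2) by (intro nn_integral_cong_AE) auto
    also have "\<dots> = (\<integral>\<^sup>+y. (\<integral>\<^sup>+z. ennreal (v s x z) * ennreal (v t z y) * f y \<partial>\<mu>) \<partial>\<mu>)"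
      by (intro nn_integral_cong nn_integral_multc[symmetric]) measurable
    also have "\<dots> = (\<integral>\<^sup>+z. (\<integral>\<^sup>+y. ennreal (v s x z) * ennreal (v t z y) * f y \<partial>\<mu>) \<partial>\<mu>)"
      by (rule pair.Fubini') measurable
    also have "\<dots> = nn_kernel \<mu> (v s) (nn_kernel \<mu> (v t) f) x"
      unfolding nn_kernel_def
      by (intro nn_integral_cong) (simp add: nn_integral_cmult[symmetric] mult.assoc)
    finally show ?case .
  qed
qed

end

context kernel_semigroup_limit
begin

lemma kernel_limit_AE:
  "\<exists>C>0. \<forall>t>2 * t\<^sub>0. AE x in \<mu>. AE y in \<mu>. \<bar>v t x y - \<phi> x * \<psi> y / \<Lambda>\<bar> \<le> C * exp (- \<gamma> * t)"
proof -
  obtain C where C: "C > 0" "\<And>t. t>2 * t\<^sub>0 \<Longrightarrow> AE (x, y) in \<mu> \<Otimes>\<^sub>M \<mu>.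
        \<bar>v t x y - \<phi> x * \<psi> y / \<Lambda>\<bar> \<le> C * exp (- \<gamma> * t)"
    using kernel_limit by blast
  then show ?thesis
    using pair.AE_pair[OF C(2)] by (intro exI[of _ C]) auto
qed

lemma nn_kernel_const:
  assumes "0 < t"
  shows "AE x in \<mu>. nn_kernel \<mu> (v t) (\<lambda>_. c) x = c * nn_kernel \<mu> (v t) (\<lambda>_. 1) x"
proof -
  have [measurable]: "case_prod (v t) \<in> borel_measurable (\<mu> \<Otimes>\<^sub>M \<mu>)"
    using kernel_measurable assms .
  from AE_space show ?thesis
    by eventually_elim (auto simp: nn_kernel_def nn_integral_cmult[symmetric] mult.commute)
qed

lemma nn_kernel_add:
  assumes "0 < t" and [measurable]: "f \<in> borel_measurable \<mu>" "g \<in> borel_measurable \<mu>"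
  shows "AE x in \<mu>. nn_kernel \<mu> (v t) (\<lambda>y. f y + g y) x
    = nn_kernel \<mu> (v t) f x + nn_kernel \<mu> (v t) g x"
proof -
  have [measurable]: "case_prod (v t) \<in> borel_measurable (\<mu> \<Otimes>\<^sub>M \<mu>)"
    using kernel_measurable assms(1) .
  from AE_space show ?thesis
    by eventually_elim (auto simp: nn_kernel_def nn_integral_add[symmetric] distrib_left)
qed

text \<open>The measure is not zero, since the pairing \<open>\<Lambda>\<close> is positive.\<close>

lemma AE_const_imp:
  assumes "AE x in \<mu>. Q"
  shows Q
proof (rule ccontr)
  assume "\<not> Q"
  with assms have "AE x in \<mu>. False" by simp
  then have "(\<integral>\<^sup>+x. ennreal (\<phi> x * \<psi> x) \<partial>\<mu>) = (\<integral>\<^sup>+x. 0 \<partial>\<mu>)"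
    by (intro nn_integral_cong_AE) (auto elim: eventually_mono)
  then show False using pairing Lambda_pos by (simp add: ennreal_eq_0_iff)
qed

text \<open>Provides the set \<open>D\<close> whose indicator is used to reach a positive multiple of \<open>\<phi>\<close> in the limit.\<close>

lemma finite_positive_set:
  obtains D where "D \<in> sets \<mu>" "emeasure \<mu> D \<noteq> \<infinity>" "0 < (\<integral>\<^sup>+y. ennreal (\<psi> y) * indicator D y \<partial>\<mu>)"
proof -
  obtain D :: "nat \<Rightarrow> 'a set" where D: "\<forall>i. D i \<in> sets \<mu> \<and> emeasure \<mu> (D i) < \<infinity>"
      "incseq D" "(\<Union>i. D i) = space \<mu>"
    using finite_exhaustion by blast
  have [measurable]: "D i \<in> sets \<mu>" for i using D(1) by blast
  have "\<exists>i. 0 < (\<integral>\<^sup>+y. ennreal (\<psi> y) * indicator (D i) y \<partial>\<mu>)"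
  proof (rule ccontr)
    assume "\<not> ?thesis"
    then have "AE y in \<mu>. ennreal (\<psi> y) * indicator (D i) y = 0" for i
      by (subst nn_integral_0_iff_AE[symmetric]) (auto simp: not_gr_zero)
    then have "AE y in \<mu>. \<forall>i. ennreal (\<psi> y) * indicator (D i) y = 0"
      unfolding AE_all_countable by blast
    moreover obtain B where "AE y in \<mu>. 0 < \<psi> y \<and> \<psi> y \<le> B"
      using psi_bounds by blast
    ultimately have "AE y in \<mu>. False"
      using AE_space
    proof eventually_elim
      case (elim y)
      then obtain i where "y \<in> D i" using D(3) by auto
      then show ?case using elim(2) elim(1)[rule_format, of i] by simp
    qed
    then show False by (rule AE_const_imp)
  qed
  then obtain i where "0 < (\<integral>\<^sup>+y. ennreal (\<psi> y) * indicator (D i) y \<partial>\<mu>)" by blast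
  moreover have "emeasure \<mu> (D i) \<noteq> \<infinity>" using D(1) by (metis less_irrefl)
  ultimately show ?thesis by (intro that[of "D i"]) auto
qed

end

section \<open>Invariance of the ground states\<close>

text \<open>The one-sided conditions: boundedness on bounded functions at each time, progressive domination
by \<open>\<phi>\<close>, and \<open>P\<^sub>t\<^sub>0 1 \<le> 1\<close> outside one of the sets \<open>K\<^sub>T\<close>. The bound \<open>1\<close> in the last condition
lets an upper bound of \<open>P\<^sub>t 1\<close> propagate from \<open>t\<close> to \<open>t\<^sub>0 + t\<close>.\<close>

locale dominated_kernel_semigroup = kernel_semigroup_limit +
  assumes bounded: "\<And>t. 0 < t \<Longrightarrow>
          \<exists>N::real. AE x in \<mu>. nn_kernel \<mu> (v t) (\<lambda>_. 1) x \<le> ennreal N"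
    and dominated: "\<exists>C>0. \<forall>t\<ge>t\<^sub>0. AE x in \<mu>. x \<in> K t \<longrightarrow>
          nn_kernel \<mu> (v t) (\<lambda>_. 1) x \<le> ennreal (C * \<phi> x)"
    and tight: "\<exists>T\<ge>t\<^sub>0. AE x in \<mu>. x \<notin> K T \<longrightarrow> nn_kernel \<mu> (v t\<^sub>0) (\<lambda>_. 1) x \<le> 1"
begin

lemma bounded_nonneg:
  assumes "0 < t"
  obtains N :: real where "0 \<le> N" "AE x in \<mu>. nn_kernel \<mu> (v t) (\<lambda>_. 1) x \<le> ennreal N"
proof -
  obtain N :: real where N: "AE x in \<mu>. nn_kernel \<mu> (v t) (\<lambda>_. 1) x \<le> ennreal N"
    using bounded[OF assms] by blast
  have "ennreal (max 0 N) = ennreal N" by (simp add: max_def ennreal_neg)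
  with N show thesis by (intro that[of "max 0 N"]) simp_all
qed

lemma nn_kernel_le_const:
  assumes t: "0 < t" and f: "AE y in \<mu>. f y \<le> c"
  shows "AE x in \<mu>. nn_kernel \<mu> (v t) f x \<le> c * nn_kernel \<mu> (v t) (\<lambda>_. 1) x"
  using nn_kernel_const[OF t, of c]
proof eventually_elim
  case (elim x)
  show ?case using nn_kernel_mono[OF f, of "v t" x] unfolding elim .
qed

text \<open>With \<open>q\<^sub>r = P\<^sub>r 1\<^sub>D\<close> and \<open>c\<close> the integral of \<open>\<psi>\<close> over \<open>D\<close> divided by \<open>\<Lambda>\<close>, the convergence of the kernel
gives \<open>q\<^sub>r = c \<phi> + O(e\<^sub>r)\<close> uniformly, with \<open>e\<^sub>r\<close> tending to \<open>0\<close>. Then \<open>P\<^sub>t (c \<phi>)\<close> differs from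
\<open>P\<^sub>t q\<^sub>r = q\<^sub>r\<^sub>+\<^sub>t\<close> by at most \<open>e\<^sub>r\<close> times a bound of \<open>P\<^sub>t 1\<close>, and \<open>q\<^sub>r\<^sub>+\<^sub>t\<close> differs from \<open>c \<phi>\<close> by at
most \<open>e\<^sub>r\<^sub>+\<^sub>t\<close>.\<close>

lemma phi_invariant:
  assumes t: "0 < t"
  shows "AE x in \<mu>. nn_kernel \<mu> (v t) (\<lambda>y. ennreal (\<phi> y)) x = ennreal (\<phi> x)"
proof -
  obtain D where D [measurable]: "D \<in> sets \<mu>" "emeasure \<mu> D \<noteq> \<infinity>"
    "0 < (\<integral>\<^sup>+y. ennreal (\<psi> y) * indicator D y \<partial>\<mu>)"
    by (rule finite_positive_set)
  obtain B\<phi> where phi: "AE x in \<mu>. 0 < \<phi> x \<and> \<phi> x \<le> B\<phi>" using phi_bounds by blast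
  obtain B where psi: "AE x in \<mu>. 0 < \<psi> x \<and> \<psi> x \<le> B" using psi_bounds by blast
  obtain C where C: "0 < C" "\<And>t. 2 * t\<^sub>0 < t \<Longrightarrow>
      AE x in \<mu>. AE y in \<mu>. \<bar>v t x y - \<phi> x * \<psi> y / \<Lambda>\<bar> \<le> C * exp (- \<gamma> * t)"
    using kernel_limit_AE by blast
  obtain N where N: "0 \<le> N" "AE x in \<mu>. nn_kernel \<mu> (v t) (\<lambda>_. 1) x \<le> ennreal N"
    using bounded_nonneg[OF t] by blast
  define I where "I = (\<integral>\<^sup>+y. ennreal (\<psi> y) * indicator D y \<partial>\<mu>)"
  have "I \<le> (\<integral>\<^sup>+y. ennreal B * indicator D y \<partial>\<mu>)"
    unfolding I_def using psi by (intro nn_integral_mono_AE, eventually_elim)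
      (auto simp: indicator_def intro!: ennreal_leI)
  also have "\<dots> = ennreal B * emeasure \<mu> D" by (simp add: nn_integral_cmult_indicator)
  also have "\<dots> < \<top>" using D(2) by (simp add: ennreal_mult_less_top less_top)
  finally have I: "I < \<top>" .
  define c where "c = enn2real I / \<Lambda>"
  have c: "0 < c" "ennreal c = I / ennreal \<Lambda>"
    using I D(3) Lambda_pos unfolding I_def[symmetric] c_def
    by (auto simp: enn2real_positive_iff divide_ennreal[symmetric])
  define m where "m = measure \<mu> D"
  have m: "emeasure \<mu> D = ennreal m" "0 \<le> m"
    using D(2) by (auto simp: m_def emeasure_eq_ennreal_measure top_unique)
  define q where "q r = nn_kernel \<mu> (v r) (indicator D)" for r
  define e where "e r = C * exp (- \<gamma> * r) * m" for r
  have e0: "0 \<le> e r" for r using C(1) m(2) by (simp add: e_def)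
  have int_phi_psi: "(\<integral>\<^sup>+y. ennreal (\<phi> x * \<psi> y / \<Lambda>) * indicator D y \<partial>\<mu>) = ennreal (c * \<phi> x)"
    if "0 < \<phi> x" for x
  proof -
    have "(\<integral>\<^sup>+y. ennreal (\<phi> x * \<psi> y / \<Lambda>) * indicator D y \<partial>\<mu>)
        = (\<integral>\<^sup>+y. ennreal (\<phi> x / \<Lambda>) * (ennreal (\<psi> y) * indicator D y) \<partial>\<mu>)"
      using psi by (intro nn_integral_cong_AE, eventually_elim)
        (use that Lambda_pos in \<open>auto simp: ennreal_mult[symmetric] mult.assoc[symmetric]\<close>)
    also have "\<dots> = ennreal (\<phi> x / \<Lambda>) * I"
      unfolding I_def by (rule nn_integral_cmult) measurable
    also have "\<dots> = ennreal (c * \<phi> x)"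
      using I that Lambda_pos unfolding c_def
      by (cases I) (auto simp: ennreal_mult[symmetric] ac_simps)
    finally show ?thesis .
  qed
  have approx: "AE x in \<mu>. q r x \<le> ennreal (c * \<phi> x) + ennreal (e r) \<and>
      ennreal (c * \<phi> x) \<le> q r x + ennreal (e r)" if r: "2 * t\<^sub>0 < r" for r
  proof -
    have r0: "0 < r" using r t0_pos by simp
    have [measurable]: "case_prod (v r) \<in> borel_measurable (\<mu> \<Otimes>\<^sub>M \<mu>)"
      using kernel_measurable r0 .
    from C(2)[OF r] kernel_AE[OF r0] phi AE_space show ?thesis
    proof eventually_elim
      case (elim x)
      have [measurable]: "x \<in> space \<mu>" by fact
      have pos: "AE y in \<mu>. 0 \<le> \<phi> x * \<psi> y / \<Lambda>"
        using psi by eventually_elim (use elim(3) Lambda_pos in auto)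
      have "AE y in \<mu>. v r x y \<le> \<phi> x * \<psi> y / \<Lambda> + C * exp (- \<gamma> * r)"
        using elim(1) by eventually_elim auto
      from nn_integral_kernel_diff_le[OF _ _ D(1) this _ pos]
      have 1: "q r x \<le> (\<integral>\<^sup>+y. ennreal (\<phi> x * \<psi> y / \<Lambda>) * indicator D y \<partial>\<mu>)
          + ennreal (C * exp (- \<gamma> * r)) * emeasure \<mu> D"
        using C(1) by (simp add: q_def nn_kernel_def)
      have "AE y in \<mu>. \<phi> x * \<psi> y / \<Lambda> \<le> v r x y + C * exp (- \<gamma> * r)"
        using elim(1) by eventually_elim auto
      from nn_integral_kernel_diff_le[OF _ _ D(1) this _ elim(2)]
      have 2: "(\<integral>\<^sup>+y. ennreal (\<phi> x * \<psi> y / \<Lambda>) * indicator D y \<partial>\<mu>)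
          \<le> q r x + ennreal (C * exp (- \<gamma> * r)) * emeasure \<mu> D"
        using C(1) by (simp add: q_def nn_kernel_def)
      show ?case
        using 1 2 int_phi_psi[of x] elim(3) C(1) m
        by (simp add: e_def ennreal_mult[symmetric])
    qed
  qed
  have [measurable]: "case_prod (v t) \<in> borel_measurable (\<mu> \<Otimes>\<^sub>M \<mu>)"
    using kernel_measurable t .
  let ?P = "nn_kernel \<mu> (v t) (\<lambda>y. ennreal (c * \<phi> y))"
  have step: "AE x in \<mu>. ?P x \<le> ennreal (c * \<phi> x) + ennreal (e (r + t) + e r * N) \<and>
      ennreal (c * \<phi> x) \<le> ?P x + ennreal (e (r + t) + e r * N)" if r: "2 * t\<^sub>0 < r" for r
  proof -
    have r0: "0 < r" using r t0_pos by simp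
    have [measurable]: "case_prod (v r) \<in> borel_measurable (\<mu> \<Otimes>\<^sub>M \<mu>)"
      using kernel_measurable r0 .
    have [measurable]: "q r \<in> borel_measurable \<mu>" unfolding q_def by measurable
    have law: "AE x in \<mu>. q (r + t) x = nn_kernel \<mu> (v t) (q r) x"
      unfolding q_def using nn_kernel_law[OF t r0, of "indicator D"] by (simp add: add.commute)
    have a1: "AE y in \<mu>. ennreal (c * \<phi> y) \<le> q r y + ennreal (e r)"
      and a2: "AE y in \<mu>. q r y \<le> ennreal (c * \<phi> y) + ennreal (e r)"
      using approx[OF r] by auto
    have "2 * t\<^sub>0 < r + t" using r t by simp
    have "AE x in \<mu>. nn_kernel \<mu> (v t) (\<lambda>y. q r y + ennreal (e r)) x
        = nn_kernel \<mu> (v t) (q r) x + nn_kernel \<mu> (v t) (\<lambda>_. ennreal (e r)) x"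
      "AE x in \<mu>. nn_kernel \<mu> (v t) (\<lambda>y. ennreal (c * \<phi> y) + ennreal (e r)) x
        = ?P x + nn_kernel \<mu> (v t) (\<lambda>_. ennreal (e r)) x"
      by (intro nn_kernel_add t; measurable)+
    with law approx[OF \<open>2 * t\<^sub>0 < r + t\<close>] nn_kernel_const[OF t, of "ennreal (e r)"] N(2)
    show ?thesis
    proof (eventually_elim)
      case (elim x)
      have K: "nn_kernel \<mu> (v t) (\<lambda>_. ennreal (e r)) x \<le> ennreal (e r * N)"
        using elim(3,4) e0 N(1) by (simp add: ennreal_mult mult_left_mono)
      have "?P x \<le> nn_kernel \<mu> (v t) (q r) x + ennreal (e r * N)"
        using order_trans[OF nn_kernel_mono[OF a1, of "v t" x, unfolded elim(5)] add_left_mono[OF K]] .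
      also have "\<dots> \<le> ennreal (c * \<phi> x) + ennreal (e (r + t)) + ennreal (e r * N)"
        using elim(1,2) r t by (intro add_right_mono) auto
      finally have 1: "?P x \<le> ennreal (c * \<phi> x) + ennreal (e (r + t) + e r * N)"
        using e0 N(1) by (simp add: add.assoc)
      have "ennreal (c * \<phi> x) \<le> nn_kernel \<mu> (v t) (q r) x + ennreal (e (r + t))"
        using elim(1,2) r t by auto
      also have "\<dots> \<le> ?P x + ennreal (e r * N) + ennreal (e (r + t))"
        using order_trans[OF nn_kernel_mono[OF a2, of "v t" x, unfolded elim(6)] add_left_mono[OF K]]
        by (rule add_right_mono)
      finally have 2: "ennreal (c * \<phi> x) \<le> ?P x + ennreal (e (r + t) + e r * N)"
        using e0 N(1) by (simp add: ac_simps)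
      show ?case using 1 2 by blast
    qed
  qed
  (* integer times, so that countably many exceptional null sets are discarded *)
  obtain n0 :: nat where n0: "2 * t\<^sub>0 < real n0" using reals_Archimedean2 by blast
  have lim: "(\<lambda>n. ennreal (e (real (n + n0) + t) + e (real (n + n0)) * N)) \<longlonglongrightarrow> 0"
  proof -
    have "filterlim (\<lambda>n. real n) at_top sequentially"
      by (rule filterlim_real_sequentially)
    then have "filterlim (\<lambda>n. real n0 + s + real n) at_top sequentially" for s
      by (rule filterlim_tendsto_add_at_top[OF tendsto_const])
    then have "filterlim (\<lambda>n. \<gamma> * (real n0 + s + real n)) at_top sequentially" for s
      using gamma_pos by (intro filterlim_tendsto_pos_mult_at_top[OF tendsto_const])
    then have "(\<lambda>n. exp (- (\<gamma> * (real n0 + s + real n)))) \<longlonglongrightarrow> 0" for s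
      by (intro filterlim_compose[OF exp_at_bot]) (simp add: filterlim_uminus_at_bot)
    then have "(\<lambda>n. C * exp (- (\<gamma> * (real n0 + s + real n))) * m) \<longlonglongrightarrow> 0" for s
      by (intro tendsto_mult_left_zero tendsto_mult_right_zero)
    from tendsto_add[OF this[of t] tendsto_mult[OF this[of 0] tendsto_const[of N]]]
    have "(\<lambda>n. e (real (n + n0) + t) + e (real (n + n0)) * N) \<longlonglongrightarrow> 0"
      by (simp add: e_def ac_simps)
    then show ?thesis using tendsto_ennrealI by fastforce
  qed
  have "AE x in \<mu>. \<forall>n. ?P x \<le> ennreal (c * \<phi> x)
        + ennreal (e (real (n + n0) + t) + e (real (n + n0)) * N) \<and>
      ennreal (c * \<phi> x) \<le> ?P x + ennreal (e (real (n + n0) + t) + e (real (n + n0)) * N)"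
    unfolding AE_all_countable by (intro allI step) (use n0 in auto)
  then have "AE x in \<mu>. ?P x = ennreal (c * \<phi> x)"
  proof (eventually_elim)
    case (elim x)
    have "?P x \<le> ennreal (c * \<phi> x) + 0"
      using elim(1) by (intro LIMSEQ_le_const[OF tendsto_add[OF tendsto_const lim]]) auto
    moreover have "ennreal (c * \<phi> x) \<le> ?P x + 0"
      using elim(1) by (intro LIMSEQ_le_const[OF tendsto_add[OF tendsto_const lim]]) auto
    ultimately show ?case by simp
  qed
  with phi AE_space show ?thesis
  proof eventually_elim
    case (elim x)
    have [measurable]: "x \<in> space \<mu>" by fact
    have "ennreal c * nn_kernel \<mu> (v t) (\<lambda>y. ennreal (\<phi> y)) x = ?P x"
      unfolding nn_kernel_def
      by (subst nn_integral_cmult[symmetric])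
        (use c in \<open>auto simp: ennreal_mult' ac_simps intro!: nn_integral_cong\<close>)
    also have "\<dots> = ennreal c * ennreal (\<phi> x)" using elim c by (simp add: ennreal_mult')
    finally show ?case
      using c(1) by (subst (asm) ennreal_mult_cancel_left) auto
  qed
qed

end

section \<open>Uniform bounds on the total mass\<close>

text \<open>Baire's theorem for an interval covered by countably many closed sets, in the form that one of
them contains a nondegenerate interval.\<close>

lemma nonempty_interior_of_closed_cover:
  fixes F :: "nat \<Rightarrow> real set"
  assumes ab: "a < b" and closed: "\<And>n. closed (F n)" and cover: "{a..b} \<subseteq> (\<Union>n. F n)"
  obtains n c d where "a \<le> c" "c < d" "d \<le> b" "{c..d} \<subseteq> F n"
proof -
  have "\<exists>n. \<not> {a..b} \<subseteq> closure ({a..b} - F n)"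
  proof (rule ccontr)
    assume "\<not> ?thesis"
    then have dense: "{a..b} \<subseteq> closure ({a..b} - F n)" for n by blast
    have "openin (top_of_set {a..b}) ({a..b} - F n)" for n
      using openin_open_Int[of "- F n" "{a..b}"] closed[of n] by (simp add: Diff_eq open_Compl)
    then have "{a..b} \<subseteq> closure (\<Inter>(range (\<lambda>n. {a..b} - F n)))"
      using dense by (intro Baire) auto
    moreover have empty: "(\<Inter>n. {a..b} - F n) = {}" using cover by auto
    ultimately have "{a..b} \<subseteq> {}" by (simp only: empty closure_empty)
    then show False using ab by simp
  qed
  then obtain n where "\<not> {a..b} \<subseteq> closure ({a..b} - F n)" by blast
  then obtain x where x: "x \<in> {a..b}" "x \<notin> closure ({a..b} - F n)" by blast
  then obtain e where e: "0 < e" "\<forall>y\<in>{a..b} - F n. \<not> dist y x < e"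
    unfolding closure_approachable by blast
  define c d where "c = max a (x - e / 2)" and "d = min b (x + e / 2)"
  show thesis
  proof (rule that)
    show "a \<le> c" "d \<le> b" by (simp_all add: c_def d_def)
    show "c < d" using ab x e(1) by (auto simp: c_def d_def)
    show "{c..d} \<subseteq> F n"
    proof
      fix y assume "y \<in> {c..d}"
      then have "dist y x < e" "y \<in> {a..b}" using e(1) by (auto simp: c_def d_def dist_real_def)
      then show "y \<in> F n" using e(2) by blast
    qed
  qed
qed

context dominated_kernel_semigroup
begin

text \<open>\<open>N\<close> bounds the operator norm of \<open>P\<^sub>t\<close> on essentially bounded functions.\<close>

definition norm_bound :: "real \<Rightarrow> real \<Rightarrow> bool" where
  "norm_bound t N \<longleftrightarrow> (AE x in \<mu>. nn_kernel \<mu> (v t) (\<lambda>_. 1) x \<le> ennreal N)"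

lemma norm_bound_mono: "norm_bound t N \<Longrightarrow> N \<le> N' \<Longrightarrow> norm_bound t N'"
  unfolding norm_bound_def by (elim eventually_mono) (erule order_trans, simp add: ennreal_leI)

lemma norm_bound_mult:
  assumes s: "0 < s" and t: "0 < t" and N: "norm_bound s N" "norm_bound t N'" and pos: "0 \<le> N'"
  shows "norm_bound (s + t) (N * N')"
proof -
  from nn_kernel_law[OF s t borel_measurable_const[of 1]] N(1)[unfolded norm_bound_def]
    nn_kernel_le_const[OF s N(2)[unfolded norm_bound_def]]
  show ?thesis
    unfolding norm_bound_def
  proof eventually_elim
    case (elim x)
    have "nn_kernel \<mu> (v s) (nn_kernel \<mu> (v t) (\<lambda>_. 1)) x \<le> ennreal N' * nn_kernel \<mu> (v s) (\<lambda>_. 1) x"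
      by (rule elim(3))
    also have "\<dots> \<le> ennreal N' * ennreal N" by (intro mult_left_mono elim(2)) simp
    also have "\<dots> = ennreal (N * N')" using pos by (simp add: ennreal_mult'' mult.commute)
    finally show ?case unfolding elim(1) .
  qed
qed

text \<open>Rectangles determine the bound, and for a fixed rectangle the mass is continuous in time. This
reduces a statement about essential suprema to closed conditions on \<open>t\<close>.\<close>

lemma norm_bound_iff_rectangles:
  assumes t: "0 < t"
  shows "norm_bound t N \<longleftrightarrow> (\<forall>A B. A \<in> sets \<mu> \<and> B \<in> sets \<mu> \<and> emeasure \<mu> A < \<infinity> \<and> emeasure \<mu> B < \<infinity> \<longrightarrow>
    (\<integral>\<^sup>+x. \<integral>\<^sup>+y. ennreal (v t x y) * indicator A x * indicator B y \<partial>\<mu> \<partial>\<mu>) \<le> ennreal N * emeasure \<mu> A)"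
    (is "?L \<longleftrightarrow> ?R")
proof -
  have [measurable]: "case_prod (v t) \<in> borel_measurable (\<mu> \<Otimes>\<^sub>M \<mu>)"
    using kernel_measurable t .
  have eq: "(\<integral>\<^sup>+x. \<integral>\<^sup>+y. ennreal (v t x y) * indicator A x * indicator B y \<partial>\<mu> \<partial>\<mu>)
      = (\<integral>\<^sup>+x. nn_kernel \<mu> (v t) (indicator B) x * indicator A x \<partial>\<mu>)"
    if [measurable]: "A \<in> sets \<mu>" "B \<in> sets \<mu>" for A B
    unfolding nn_kernel_def
    by (intro nn_integral_cong, subst nn_integral_multc[symmetric]) (auto simp: ac_simps)
  show ?thesis
  proof
    assume L: ?L
    show ?R
    proof (intro allI impI, elim conjE)
      fix A B assume [measurable]: "A \<in> sets \<mu>" "B \<in> sets \<mu>"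
      have "(\<integral>\<^sup>+x. nn_kernel \<mu> (v t) (indicator B) x * indicator A x \<partial>\<mu>)
          \<le> (\<integral>\<^sup>+x. ennreal N * indicator A x \<partial>\<mu>)"
        using L[unfolded norm_bound_def]
      proof (intro nn_integral_mono_AE, eventually_elim)
        case (elim x)
        have "nn_kernel \<mu> (v t) (indicator B) x \<le> nn_kernel \<mu> (v t) (\<lambda>_. 1) x"
          by (rule nn_kernel_mono) (simp add: indicator_def)
        then show ?case using elim by (intro mult_right_mono) auto
      qed
      then show "(\<integral>\<^sup>+x. \<integral>\<^sup>+y. ennreal (v t x y) * indicator A x * indicator B y \<partial>\<mu> \<partial>\<mu>)
          \<le> ennreal N * emeasure \<mu> A"
        by (simp add: eq nn_integral_cmult_indicator)
    qed
  next
    assume R: ?R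
    obtain D :: "nat \<Rightarrow> 'a set" where D: "\<forall>i. D i \<in> sets \<mu> \<and> emeasure \<mu> (D i) < \<infinity>"
        "incseq D" "(\<Union>i. D i) = space \<mu>"
      using finite_exhaustion by blast
    have [measurable]: "D i \<in> sets \<mu>" for i using D(1) by blast
    have mono_D: "indicator (D i) y \<le> (indicator (D j) y :: ennreal)" if "i \<le> j" for i j y
      using D(2) that by (auto simp: incseq_def indicator_def)
    have inc: "incseq (\<lambda>i. nn_kernel \<mu> (v t) (indicator (D i)))"
      using mono_D by (auto simp: incseq_def le_fun_def intro!: nn_kernel_mono)
    have sup: "nn_kernel \<mu> (v t) (\<lambda>_. 1) x = (SUP i. nn_kernel \<mu> (v t) (indicator (D i)) x)"
      if "x \<in> space \<mu>" for x
      using nn_integral_exhaustion[of D "\<lambda>y. ennreal (v t x y)"] D that by (simp add: nn_kernel_def)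
    show ?L
      unfolding norm_bound_def
    proof (rule AE_le_of_nn_integral_le)
      fix A assume A [measurable]: "A \<in> sets \<mu>" "emeasure \<mu> A < \<infinity>"
      have "(\<integral>\<^sup>+x. nn_kernel \<mu> (v t) (\<lambda>_. 1) x * indicator A x \<partial>\<mu>)
          = (\<integral>\<^sup>+x. (SUP i. nn_kernel \<mu> (v t) (indicator (D i)) x * indicator A x) \<partial>\<mu>)"
        by (intro nn_integral_cong) (simp add: sup SUP_mult_right_ennreal)
      also have "\<dots> = (SUP i. \<integral>\<^sup>+x. nn_kernel \<mu> (v t) (indicator (D i)) x * indicator A x \<partial>\<mu>)"
        using inc by (intro nn_integral_monotone_convergence_SUP)
          (auto simp: incseq_def le_fun_def intro!: mult_right_mono)
      also have "\<dots> \<le> ennreal N * emeasure \<mu> A"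
        using R A D(1) by (intro SUP_least) (simp add: eq[symmetric])
      finally show "(\<integral>\<^sup>+x. nn_kernel \<mu> (v t) (\<lambda>_. 1) x * indicator A x \<partial>\<mu>) \<le> ennreal N * emeasure \<mu> A" .
    qed measurable
  qed
qed

lemma closed_norm_bound:
  assumes "0 < a"
  shows "closed {t \<in> {a..b}. norm_bound t N}"
proof -
  let ?w = "\<lambda>A B t. \<integral>\<^sup>+x. \<integral>\<^sup>+y. ennreal (v t x y) * indicator A x * indicator B y \<partial>\<mu> \<partial>\<mu>"
  let ?F = "{(A, B). A \<in> sets \<mu> \<and> B \<in> sets \<mu> \<and> emeasure \<mu> A < \<infinity> \<and> emeasure \<mu> B < \<infinity>}"
  have "closed {t \<in> {a..b}. ?w A B t \<le> ennreal N * emeasure \<mu> A}" if "(A, B) \<in> ?F" for A B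
  proof -
    have "continuous_on {a..b} (?w A B)"
      using that assms by (intro continuous_on_subset[OF rectangle_continuous]) auto
    from continuous_closed_preimage[OF this, of "{..ennreal N * emeasure \<mu> A}"]
    show ?thesis by (simp add: vimage_def Int_def)
  qed
  then have "closed ({a..b} \<inter> (\<Inter>(A, B)\<in>?F. {t \<in> {a..b}. ?w A B t \<le> ennreal N * emeasure \<mu> A}))"
    by (intro closed_Int closed_INT) auto
  moreover have "{a..b} \<inter> (\<Inter>(A, B)\<in>?F. {t \<in> {a..b}. ?w A B t \<le> ennreal N * emeasure \<mu> A})
      = {t \<in> {a..b}. norm_bound t N}"
    using assms norm_bound_iff_rectangles by (auto 0 0)
  ultimately show ?thesis by simp
qed

text \<open>At each time some natural number is a bound, so Baire's theorem gives one bound on some interval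
of length \<open>h\<close>. Composing with \<open>P\<^sub>h\<close> extends it to the next interval of length \<open>h\<close>, and so on.\<close>

lemma norm_bound_compact_interval: "\<exists>N\<ge>0. \<forall>t\<in>{2 * t\<^sub>0..b}. norm_bound t N"
proof -
  (* starting at t0 rather than at 0 keeps the closed sets away from the open end of the time axis *)
  have "{t\<^sub>0..2 * t\<^sub>0} \<subseteq> (\<Union>n. {t \<in> {t\<^sub>0..2 * t\<^sub>0}. norm_bound t (real n)})"
  proof
    fix t assume t: "t \<in> {t\<^sub>0..2 * t\<^sub>0}"
    then obtain N where "norm_bound t N"
      using bounded[of t] t0_pos unfolding norm_bound_def by auto
    moreover obtain n where "N \<le> real n" using real_arch_simple by blast
    ultimately show "t \<in> (\<Union>n. {t \<in> {t\<^sub>0..2 * t\<^sub>0}. norm_bound t (real n)})"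
      using t norm_bound_mono by blast
  qed
  then obtain n c d where cd: "t\<^sub>0 \<le> c" "c < d" "d \<le> 2 * t\<^sub>0"
      "{c..d} \<subseteq> {t \<in> {t\<^sub>0..2 * t\<^sub>0}. norm_bound t (real n)}"
    by (rule nonempty_interior_of_closed_cover[rotated 2])
      (use t0_pos closed_norm_bound in auto)
  define h where "h = d - c"
  have h: "0 < h" using cd by (simp add: h_def)
  obtain M where M: "0 \<le> M" "norm_bound h M"
    using bounded_nonneg[OF h] unfolding norm_bound_def by blast
  have "\<exists>N\<ge>0. \<forall>t\<in>{c..c + real (Suc k) * h}. norm_bound t N" for k
  proof (induction k)
    case 0
    then show ?case using cd(4) by (intro exI[of _ "real n"]) (auto simp: h_def)
  next
    case (Suc k)
    then obtain N where N: "0 \<le> N" "\<forall>t\<in>{c..c + real (Suc k) * h}. norm_bound t N" by blast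
    have "norm_bound t (max N (N * M))" if t: "t \<in> {c..c + real (Suc (Suc k)) * h}" for t
    proof (cases "t \<le> c + real (Suc k) * h")
      case True
      then have "norm_bound t N" using N(2) t by simp
      then show ?thesis by (rule norm_bound_mono) simp
    next
      case False
      have "0 \<le> real k * h" "real (Suc k) * h = real k * h + h"
          "real (Suc (Suc k)) * h = real k * h + 2 * h"
        using h by (simp_all add: algebra_simps)
      then have "t - h \<in> {c..c + real (Suc k) * h}"
        using False t unfolding atLeastAtMost_iff by linarith
      then have "norm_bound (t - h) N" "0 < t - h" using N(2) cd(1) t0_pos by simp_all
      from norm_bound_mult[OF this(2) h this(1) M(2,1)] have "norm_bound t (N * M)" by simp
      then show ?thesis by (rule norm_bound_mono) simp
    qed
    then show ?case using N by (intro exI[of _ "max N (N * M)"]) auto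
  qed
  note grow = this
  obtain k where k: "b - c < real k * h" using h reals_Archimedean3 by blast
  obtain N where N: "0 \<le> N" "\<forall>t\<in>{c..c + real (Suc k) * h}. norm_bound t N"
    using grow[of k] by blast
  have "t \<in> {c..c + real (Suc k) * h}" if "t \<in> {2 * t\<^sub>0..b}" for t
    using that cd k h by (simp add: algebra_simps)
  then show ?thesis using N by blast
qed

text \<open>A number that bounds \<open>P\<^sub>t 1\<close> and the multiple of \<open>\<phi>\<close> from the domination also bounds
\<open>P\<^sub>t\<^sub>0\<^sub>+\<^sub>t 1\<close>: on \<open>K\<^sub>T\<close> by domination, and elsewhere because \<open>P\<^sub>t\<^sub>0\<^sub>+\<^sub>t 1 = P\<^sub>t\<^sub>0 P\<^sub>t 1\<close> and \<open>P\<^sub>t\<^sub>0 1 \<le> 1\<close> there.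
A bound at the times between \<open>t\<^sub>0 + T\<close> and \<open>2 t\<^sub>0 + T\<close> thus reaches all later times.\<close>

lemma uniform_norm_bound: "\<exists>N\<ge>0. \<forall>t\<ge>2 * t\<^sub>0. norm_bound t N"
proof -
  obtain C where C: "0 < C" "\<And>t. t\<^sub>0 \<le> t \<Longrightarrow> AE x in \<mu>. x \<in> K t \<longrightarrow>
      nn_kernel \<mu> (v t) (\<lambda>_. 1) x \<le> ennreal (C * \<phi> x)"
    using dominated by blast
  obtain T where T: "t\<^sub>0 \<le> T" "AE x in \<mu>. x \<notin> K T \<longrightarrow> nn_kernel \<mu> (v t\<^sub>0) (\<lambda>_. 1) x \<le> 1"
    using tight by blast
  obtain B where B: "AE x in \<mu>. 0 < \<phi> x \<and> \<phi> x \<le> B" using phi_bounds by blast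
  obtain N where N: "0 \<le> N" "\<forall>t\<in>{2 * t\<^sub>0..2 * t\<^sub>0 + T}. norm_bound t N"
    using norm_bound_compact_interval by blast
  define N' where "N' = max N (C * B)"
  (* one step of length t0 preserves the bound, because N' also exceeds the bound on K_T *)
  have step: "norm_bound (t\<^sub>0 + t) N'" if t: "T \<le> t" "norm_bound t N'" for t
  proof -
    have pos: "0 < t" "t\<^sub>0 \<le> t" using T t t0_pos by auto
    have "t\<^sub>0 \<le> t\<^sub>0 + t" using pos t0_pos by simp
    from C(2)[OF this] T(2) B nn_kernel_law[OF t0_pos pos(1) borel_measurable_const[of 1]]
      nn_kernel_le_const[OF t0_pos t(2)[unfolded norm_bound_def]]
    show ?thesis
      unfolding norm_bound_def
    proof eventually_elim
      case (elim x)
      show ?case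
      proof (cases "x \<in> K T")
        case True
        then have "x \<in> K (t\<^sub>0 + t)" using K_mono[of T "t\<^sub>0 + t"] T t t0_pos by auto
        then have "nn_kernel \<mu> (v (t\<^sub>0 + t)) (\<lambda>_. 1) x \<le> ennreal (C * \<phi> x)" using elim by blast
        also have "\<dots> \<le> ennreal N'"
          using elim C(1) by (intro ennreal_leI) (simp add: N'_def le_max_iff_disj)
        finally show ?thesis .
      next
        case False
        have "nn_kernel \<mu> (v (t\<^sub>0 + t)) (\<lambda>_. 1) x \<le> ennreal N' * nn_kernel \<mu> (v t\<^sub>0) (\<lambda>_. 1) x"
          using elim by simp
        also have "\<dots> \<le> ennreal N' * 1" using elim(2) False by (intro mult_left_mono) auto
        finally show ?thesis by simp
      qed
    qed
  qed
  have "norm_bound (t + real k * t\<^sub>0) N'" if "t \<in> {2 * t\<^sub>0..2 * t\<^sub>0 + T}" "T \<le> t" for k t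
  proof (induction k)
    case 0
    have "norm_bound t N" using N(2) that(1) by blast
    then have "norm_bound t N'" unfolding N'_def by (rule norm_bound_mono) (rule max.cobounded1)
    then show ?case by simp
  next
    case (Suc k)
    have "T \<le> t + real k * t\<^sub>0" using that t0_pos by (simp add: add_increasing2)
    from step[OF this Suc] show ?case by (simp add: algebra_simps)
  qed
  note iter = this
  have "norm_bound t N'" if t: "2 * t\<^sub>0 \<le> t" for t
  proof (cases "t \<le> 2 * t\<^sub>0 + T")
    case True
    then have "norm_bound t N" using N(2) t by simp
    then show ?thesis unfolding N'_def by (rule norm_bound_mono) (rule max.cobounded1)
  next
    case False
    (* subtracting k steps lands in the interval from t0 + T to 2 * t0 + T *)
    define k where "k = nat \<lfloor>(t - t\<^sub>0 - T) / t\<^sub>0\<rfloor>"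
    have "real k = of_int \<lfloor>(t - t\<^sub>0 - T) / t\<^sub>0\<rfloor>"
      using False t0_pos by (simp add: k_def)
    then have "real k \<le> (t - t\<^sub>0 - T) / t\<^sub>0" "(t - t\<^sub>0 - T) / t\<^sub>0 < real k + 1"
      by linarith+
    then have "real k * t\<^sub>0 \<le> t - t\<^sub>0 - T" "t - t\<^sub>0 - T < real k * t\<^sub>0 + t\<^sub>0"
      using t0_pos by (simp_all add: field_simps)
    then have "t - real k * t\<^sub>0 \<in> {2 * t\<^sub>0..2 * t\<^sub>0 + T}" "T \<le> t - real k * t\<^sub>0"
      using T t0_pos by auto
    from iter[OF this, of k] show ?thesis by simp
  qed
  then show ?thesis using N by (intro exI[of _ N']) (auto simp: N'_def)
qed

end

section \<open>Integrability of the ground states and products of deviations\<close>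

text \<open>Both one-sided conditions, for the kernel and for its transpose.\<close>

locale dominated_kernel_pair = dominated_kernel_semigroup \<mu> v \<phi> \<psi> \<Lambda> \<gamma> t\<^sub>0 K
    + tr: dominated_kernel_semigroup \<mu> "transpose_kernel v" \<psi> \<phi> \<Lambda> \<gamma> t\<^sub>0 K
  for \<mu> :: "'a measure" and v \<phi> \<psi> \<Lambda> \<gamma> t\<^sub>0 K
begin

lemma swapped: "dominated_kernel_pair \<mu> (transpose_kernel v) \<psi> \<phi> \<Lambda> \<gamma> t\<^sub>0 K"
  by (intro dominated_kernel_pair.intro)
    (simp_all add: dominated_kernel_semigroup_axioms tr.dominated_kernel_semigroup_axioms)

text \<open>For a set \<open>D\<close> of finite measure and almost every \<open>y\<close>, all large times \<open>t\<close> satisfy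
\<open>y \<in> K\<^sub>t\<close>. By the dual domination and the convergence of the kernel, \<open>\<psi>(y) / \<Lambda>\<close> times the
integral of \<open>\<phi>\<close> over \<open>D\<close> is at most \<open>C \<psi>(y)\<close> up to a vanishing error. Dividing by \<open>\<psi>(y)\<close> leaves the bound \<open>C \<Lambda>\<close>, which does not depend on \<open>D\<close>.\<close>

lemma phi_integral_finite: "(\<integral>\<^sup>+x. ennreal (\<phi> x) \<partial>\<mu>) < \<infinity>"
proof -
  obtain C where C: "0 < C" "\<And>t. t\<^sub>0 \<le> t \<Longrightarrow> AE y in \<mu>. y \<in> K t \<longrightarrow>
      nn_kernel \<mu> (transpose_kernel v t) (\<lambda>_. 1) y \<le> ennreal (C * \<psi> y)"
    using tr.dominated by blast
  obtain C\<^sub>0 where C0: "0 < C\<^sub>0" "\<And>t. 2 * t\<^sub>0 < t \<Longrightarrow>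
      AE y in \<mu>. AE x in \<mu>. \<bar>transpose_kernel v t y x - \<psi> y * \<phi> x / \<Lambda>\<bar> \<le> C\<^sub>0 * exp (- \<gamma> * t)"
    using tr.kernel_limit_AE by blast
  obtain B where phi: "AE x in \<mu>. 0 < \<phi> x \<and> \<phi> x \<le> B" using phi_bounds by blast
  obtain B' where psi: "AE x in \<mu>. 0 < \<psi> x \<and> \<psi> x \<le> B'" using psi_bounds by blast
  have *: "(\<integral>\<^sup>+x. ennreal (\<phi> x) * indicator D x \<partial>\<mu>) \<le> ennreal (C * \<Lambda>)"
    if D [measurable]: "D \<in> sets \<mu>" and finD: "emeasure \<mu> D < \<infinity>" for D
  proof -
    define I where "I = (\<integral>\<^sup>+x. ennreal (\<phi> x) * indicator D x \<partial>\<mu>)"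
    define m where "m = measure \<mu> D"
    have m: "emeasure \<mu> D = ennreal m" "0 \<le> m"
      using finD by (auto simp: m_def emeasure_eq_ennreal_measure top_unique)
    have bound: "AE y in \<mu>. y \<in> K t \<longrightarrow>
        ennreal (\<psi> y / \<Lambda>) * I \<le> ennreal (C * \<psi> y) + ennreal (C\<^sub>0 * exp (- \<gamma> * t) * m)"
      if t: "2 * t\<^sub>0 < t" for t
    proof -
      have t0: "0 < t" "t\<^sub>0 \<le> t" using t t0_pos by simp_all
      have [measurable]: "case_prod (transpose_kernel v t) \<in> borel_measurable (\<mu> \<Otimes>\<^sub>M \<mu>)"
        using tr.kernel_measurable t0(1) .
      from C(2)[OF t0(2)] C0(2)[OF t] psi tr.kernel_AE[OF t0(1)] AE_space show ?thesis
      proof eventually_elim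
        case (elim y)
        have [measurable]: "y \<in> space \<mu>" by fact
        have "AE x in \<mu>. \<psi> y * \<phi> x / \<Lambda> \<le> transpose_kernel v t y x + C\<^sub>0 * exp (- \<gamma> * t)"
          using elim(2) by eventually_elim auto
        from nn_integral_kernel_diff_le[OF _ _ D this _ elim(4)]
        have 1: "(\<integral>\<^sup>+x. ennreal (\<psi> y * \<phi> x / \<Lambda>) * indicator D x \<partial>\<mu>)
            \<le> (\<integral>\<^sup>+x. ennreal (transpose_kernel v t y x) * indicator D x \<partial>\<mu>)
              + ennreal (C\<^sub>0 * exp (- \<gamma> * t)) * emeasure \<mu> D"
          using C0(1) by simp
        have 2: "(\<integral>\<^sup>+x. ennreal (\<psi> y * \<phi> x / \<Lambda>) * indicator D x \<partial>\<mu>) = ennreal (\<psi> y / \<Lambda>) * I"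
          unfolding I_def using phi elim(3) Lambda_pos
          by (subst nn_integral_cmult[symmetric])
            (auto intro!: nn_integral_cong simp: ennreal_mult'[symmetric] mult.assoc[symmetric])
        have "(\<integral>\<^sup>+x. ennreal (transpose_kernel v t y x) * indicator D x \<partial>\<mu>)
            \<le> nn_kernel \<mu> (transpose_kernel v t) (\<lambda>_. 1) y"
          unfolding nn_kernel_def by (intro nn_integral_mono) (auto simp: indicator_def)
        note 3 = this
        show ?case
        proof
          assume y: "y \<in> K t"
          have "ennreal (\<psi> y / \<Lambda>) * I
              \<le> nn_kernel \<mu> (transpose_kernel v t) (\<lambda>_. 1) y
                + ennreal (C\<^sub>0 * exp (- \<gamma> * t)) * emeasure \<mu> D"
            unfolding 2[symmetric] by (rule order_trans[OF 1 add_right_mono[OF 3]])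
          also have "\<dots> \<le> ennreal (C * \<psi> y) + ennreal (C\<^sub>0 * exp (- \<gamma> * t)) * emeasure \<mu> D"
            using elim(1) y by (intro add_right_mono) blast
          finally show "ennreal (\<psi> y / \<Lambda>) * I
              \<le> ennreal (C * \<psi> y) + ennreal (C\<^sub>0 * exp (- \<gamma> * t) * m)"
            using C0(1) m by (simp add: ennreal_mult)
        qed
      qed
    qed
    obtain n0 :: nat where n0: "2 * t\<^sub>0 < real n0" using reals_Archimedean2 by blast
    have "AE y in \<mu>. \<forall>n. y \<in> K (real (n + n0)) \<longrightarrow> ennreal (\<psi> y / \<Lambda>) * I
        \<le> ennreal (C * \<psi> y) + ennreal (C\<^sub>0 * exp (- \<gamma> * real (n + n0)) * m)"
      unfolding AE_all_countable by (intro allI bound) (use n0 in auto)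
    with psi AE_space have "AE y in \<mu>. I \<le> ennreal (C * \<Lambda>)"
    proof eventually_elim
      case (elim y)
      obtain t where t: "t\<^sub>0 \<le> t" "y \<in> K t" using K_cover elim(2) by auto
      obtain n1 :: nat where n1: "t \<le> real n1" using real_arch_simple by blast
      have "filterlim (\<lambda>n. real n) at_top sequentially"
        by (rule filterlim_real_sequentially)
      then have "filterlim (\<lambda>n. real n0 + real n) at_top sequentially"
        by (rule filterlim_tendsto_add_at_top[OF tendsto_const])
      then have "filterlim (\<lambda>n. \<gamma> * (real n0 + real n)) at_top sequentially"
        using gamma_pos by (intro filterlim_tendsto_pos_mult_at_top[OF tendsto_const])
      then have "(\<lambda>n. exp (- (\<gamma> * (real n0 + real n)))) \<longlonglongrightarrow> 0"
        by (intro filterlim_compose[OF exp_at_bot]) (simp add: filterlim_uminus_at_bot)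
      then have "(\<lambda>n. C\<^sub>0 * exp (- (\<gamma> * (real n0 + real n))) * m) \<longlonglongrightarrow> 0"
        by (intro tendsto_mult_left_zero tendsto_mult_right_zero)
      from tendsto_ennrealI[OF this]
      have lim: "(\<lambda>n. ennreal (C\<^sub>0 * exp (- \<gamma> * real (n + n0)) * m)) \<longlonglongrightarrow> 0"
        by (simp add: add.commute)
      have "ennreal (\<psi> y / \<Lambda>) * I \<le> ennreal (C * \<psi> y) + 0"
      proof (rule LIMSEQ_le_const[OF tendsto_add[OF tendsto_const lim]], intro exI allI impI)
        fix n assume "n1 \<le> n"
        then have "t \<le> real (n + n0)" using n1 by simp
        then have "y \<in> K (real (n + n0))" using K_mono[of t "real (n + n0)"] t by blast
        then show "ennreal (\<psi> y / \<Lambda>) * I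
            \<le> ennreal (C * \<psi> y) + ennreal (C\<^sub>0 * exp (- \<gamma> * real (n + n0)) * m)"
          using elim(3) by blast
      qed
      (* here positivity of psi at y is used to cancel it *)
      then have "ennreal (\<Lambda> / \<psi> y) * (ennreal (\<psi> y / \<Lambda>) * I) \<le> ennreal (\<Lambda> / \<psi> y) * ennreal (C * \<psi> y)"
        by (intro mult_left_mono) auto
      moreover have "ennreal (\<Lambda> / \<psi> y) * (ennreal (\<psi> y / \<Lambda>) * I) = I"
        using elim(1) Lambda_pos by (simp flip: mult.assoc ennreal_mult)
      moreover have "ennreal (\<Lambda> / \<psi> y) * ennreal (C * \<psi> y) = ennreal (C * \<Lambda>)"
        using elim(1) Lambda_pos C(1) by (simp flip: ennreal_mult)
      ultimately show ?case by simp
    qed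
    then show ?thesis unfolding I_def by (rule AE_const_imp)
  qed
  obtain D :: "nat \<Rightarrow> 'a set" where D: "\<forall>i. D i \<in> sets \<mu> \<and> emeasure \<mu> (D i) < \<infinity>"
      "incseq D" "(\<Union>i. D i) = space \<mu>"
    using finite_exhaustion by blast
  have "(\<integral>\<^sup>+x. ennreal (\<phi> x) \<partial>\<mu>) = (SUP i. \<integral>\<^sup>+x. ennreal (\<phi> x) * indicator (D i) x \<partial>\<mu>)"
    using D by (intro nn_integral_exhaustion) auto
  also have "\<dots> \<le> ennreal (C * \<Lambda>)" using D(1) by (intro SUP_least *) auto
  finally show ?thesis by (rule order_le_less_trans) simp
qed

lemmas psi_integral_finite = dominated_kernel_pair.phi_integral_finite[OF swapped]

definition deviation :: "real \<Rightarrow> 'a \<Rightarrow> 'a \<Rightarrow> real" where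
  "deviation t x y = v t x y - \<phi> x * \<psi> y / \<Lambda>"

lemma deviation_measurable:
  assumes "0 < t"
  shows "case_prod (deviation t) \<in> borel_measurable (\<mu> \<Otimes>\<^sub>M \<mu>)"
proof -
  have [measurable]: "case_prod (v t) \<in> borel_measurable (\<mu> \<Otimes>\<^sub>M \<mu>)"
    using kernel_measurable assms .
  show ?thesis unfolding deviation_def by measurable
qed

text \<open>The semigroup law and the two invariance relations as convergent real integrals, the form in
which products of deviations can be expanded.\<close>

lemma kernel_products_AE:
  assumes s: "0 < s" and r: "0 < r"
  shows "AE x in \<mu>. AE y in \<mu>.
      has_bochner_integral \<mu> (\<lambda>z. v s x z * v r z y) (v (s + r) x y) \<and>
      has_bochner_integral \<mu> (\<lambda>z. v s x z * \<phi> z) (\<phi> x) \<and>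
      has_bochner_integral \<mu> (\<lambda>z. \<psi> z * v r z y) (\<psi> y)"
proof -
  have [measurable]: "case_prod (v s) \<in> borel_measurable (\<mu> \<Otimes>\<^sub>M \<mu>)"
      "case_prod (v r) \<in> borel_measurable (\<mu> \<Otimes>\<^sub>M \<mu>)"
    using kernel_measurable s r by simp_all
  obtain B where phi: "AE x in \<mu>. 0 < \<phi> x \<and> \<phi> x \<le> B" using phi_bounds by blast
  obtain B' where psi: "AE x in \<mu>. 0 < \<psi> x \<and> \<psi> x \<le> B'" using psi_bounds by blast
  have law: "AE x in \<mu>. AE y in \<mu>.
      ennreal (v (s + r) x y) = (\<integral>\<^sup>+z. ennreal (v s x z) * ennreal (v r z y) \<partial>\<mu>)"
    using pair.AE_pair[OF kernel_law[OF s r]] by simp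
  have "0 < s + r" using s r by simp
  from law kernel_AE[OF s] kernel_AE[OF this] phi phi_invariant[OF s] AE_space show ?thesis
  proof eventually_elim
    case (elim x)
    note x = elim
    have [measurable]: "x \<in> space \<mu>" by fact
    have "(\<integral>\<^sup>+z. ennreal (v s x z * \<phi> z) \<partial>\<mu>) = ennreal (\<phi> x)"
      using x(2) phi unfolding x(5)[symmetric] nn_kernel_def
      by (intro nn_integral_cong_AE, eventually_elim) (simp add: ennreal_mult)
    moreover have "AE z in \<mu>. 0 \<le> v s x z * \<phi> z"
      using x(2) phi by eventually_elim simp
    ultimately have 1: "has_bochner_integral \<mu> (\<lambda>z. v s x z * \<phi> z) (\<phi> x)"
      using x(4) by (intro has_bochner_integral_nn_integral) auto
    from x(1) x(3) tr.kernel_AE[OF r] tr.phi_invariant[OF r] psi AE_space show ?case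
    proof eventually_elim
      case (elim y)
      have [measurable]: "y \<in> space \<mu>" by fact
      have "(\<integral>\<^sup>+z. ennreal (v s x z * v r z y) \<partial>\<mu>) = ennreal (v (s + r) x y)"
        using x(2) elim(3) unfolding elim(1) transpose_kernel_def
        by (intro nn_integral_cong_AE, eventually_elim) (simp add: ennreal_mult)
      moreover have "AE z in \<mu>. 0 \<le> v s x z * v r z y"
        using x(2) elim(3) unfolding transpose_kernel_def by eventually_elim simp
      ultimately have 2: "has_bochner_integral \<mu> (\<lambda>z. v s x z * v r z y) (v (s + r) x y)"
        using elim(2) by (intro has_bochner_integral_nn_integral) auto
      have "(\<integral>\<^sup>+z. ennreal (\<psi> z * v r z y) \<partial>\<mu>) = ennreal (\<psi> y)"
        using psi elim(3) unfolding elim(4)[symmetric] nn_kernel_def transpose_kernel_def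
        by (intro nn_integral_cong_AE, eventually_elim) (simp add: ennreal_mult mult.commute)
      moreover have "AE z in \<mu>. 0 \<le> \<psi> z * v r z y"
        using psi elim(3) unfolding transpose_kernel_def by eventually_elim simp
      ultimately have "has_bochner_integral \<mu> (\<lambda>z. \<psi> z * v r z y) (\<psi> y)"
        using elim(5) by (intro has_bochner_integral_nn_integral) auto
      with 1 2 show ?case by blast
    qed
  qed
qed

text \<open>Expanding the product of the two deviations gives four integrals. By the invariance of \<open>\<phi>\<close> and
\<open>\<psi>\<close> each mixed term equals \<open>\<phi>(x) \<psi>(y) / \<Lambda>\<close>, and so does the last term by the definition of
\<open>\<Lambda>\<close>; what remains is the deviation at time \<open>s + r\<close>.\<close>

lemma deviation_deviation:
  assumes s: "0 < s" and r: "0 < r"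
  shows "AE x in \<mu>. AE y in \<mu>. ennreal \<bar>deviation (s + r) x y\<bar>
      \<le> (\<integral>\<^sup>+z. ennreal \<bar>deviation s x z\<bar> * ennreal \<bar>deviation r z y\<bar> \<partial>\<mu>)"
proof -
  obtain B where phi: "AE x in \<mu>. 0 < \<phi> x \<and> \<phi> x \<le> B" using phi_bounds by blast
  obtain B' where psi: "AE x in \<mu>. 0 < \<psi> x \<and> \<psi> x \<le> B'" using psi_bounds by blast
  have "AE z in \<mu>. 0 \<le> \<phi> z * \<psi> z"
    using phi psi by eventually_elim simp
  then have 4: "has_bochner_integral \<mu> (\<lambda>z. \<phi> z * \<psi> z) \<Lambda>"
    using pairing Lambda_pos by (intro has_bochner_integral_nn_integral) auto
  from kernel_products_AE[OF s r] show ?thesis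
  proof eventually_elim
    case (elim x)
    then show ?case
    proof eventually_elim
      case (elim y)
      then have 1: "has_bochner_integral \<mu> (\<lambda>z. v s x z * v r z y) (v (s + r) x y)"
        and 2: "has_bochner_integral \<mu> (\<lambda>z. v s x z * \<phi> z) (\<phi> x)"
        and 3: "has_bochner_integral \<mu> (\<lambda>z. \<psi> z * v r z y) (\<psi> y)"
        by blast+
      have "has_bochner_integral \<mu> (\<lambda>z. v s x z * v r z y - v s x z * \<phi> z * (\<psi> y / \<Lambda>)
          - (\<phi> x / \<Lambda>) * (\<psi> z * v r z y) + (\<phi> x * \<psi> y / \<Lambda>\<^sup>2) * (\<phi> z * \<psi> z))
          (v (s + r) x y - \<phi> x * (\<psi> y / \<Lambda>) - (\<phi> x / \<Lambda>) * \<psi> y + (\<phi> x * \<psi> y / \<Lambda>\<^sup>2) * \<Lambda>)"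
        by (intro has_bochner_integral_add has_bochner_integral_diff
            has_bochner_integral_mult_right has_bochner_integral_mult_left 1 2 3 4)
      also have "v (s + r) x y - \<phi> x * (\<psi> y / \<Lambda>) - (\<phi> x / \<Lambda>) * \<psi> y + (\<phi> x * \<psi> y / \<Lambda>\<^sup>2) * \<Lambda>
          = deviation (s + r) x y"
        using Lambda_pos by (simp add: deviation_def field_simps power2_eq_square)
      also have "(\<lambda>z. v s x z * v r z y - v s x z * \<phi> z * (\<psi> y / \<Lambda>)
          - (\<phi> x / \<Lambda>) * (\<psi> z * v r z y) + (\<phi> x * \<psi> y / \<Lambda>\<^sup>2) * (\<phi> z * \<psi> z))
          = (\<lambda>z. deviation s x z * deviation r z y)"
        using Lambda_pos by (simp add: deviation_def field_simps power2_eq_square fun_eq_iff)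
      finally have I: "has_bochner_integral \<mu> (\<lambda>z. deviation s x z * deviation r z y)
          (deviation (s + r) x y)" .
      have "ennreal (norm (\<integral>z. deviation s x z * deviation r z y \<partial>\<mu>))
          \<le> (\<integral>\<^sup>+z. ennreal (norm (deviation s x z * deviation r z y)) \<partial>\<mu>)"
        using I by (intro integral_norm_bound_ennreal) (simp add: has_bochner_integral_iff)
      then show ?case
        using I by (simp add: has_bochner_integral_iff abs_mult ennreal_mult)
    qed
  qed
qed

text \<open>Only one factor is a deviation here, so invariance of \<open>\<phi>\<close> alone collapses the product.\<close>

lemma kernel_deviation:
  assumes r: "0 < r" and s: "0 < s"
  shows "AE x in \<mu>. AE y in \<mu>. ennreal \<bar>deviation (r + s) x y\<bar>
      \<le> (\<integral>\<^sup>+z. ennreal (v r x z) * ennreal \<bar>deviation s z y\<bar> \<partial>\<mu>)"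
  using kernel_products_AE[OF r s] kernel_AE[OF r]
proof eventually_elim
  case (elim x)
  note x = elim
  from elim(1) show ?case
  proof eventually_elim
    case (elim y)
    then have 1: "has_bochner_integral \<mu> (\<lambda>z. v r x z * v s z y) (v (r + s) x y)"
      and 2: "has_bochner_integral \<mu> (\<lambda>z. v r x z * \<phi> z) (\<phi> x)"
      by blast+
    have "has_bochner_integral \<mu> (\<lambda>z. v r x z * v s z y - v r x z * \<phi> z * (\<psi> y / \<Lambda>))
        (v (r + s) x y - \<phi> x * (\<psi> y / \<Lambda>))"
      by (intro has_bochner_integral_diff has_bochner_integral_mult_left 1 2)
    then have I: "has_bochner_integral \<mu> (\<lambda>z. v r x z * deviation s z y) (deviation (r + s) x y)"
      by (simp add: deviation_def algebra_simps)
    have "ennreal (norm (\<integral>z. v r x z * deviation s z y \<partial>\<mu>))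
        \<le> (\<integral>\<^sup>+z. ennreal (norm (v r x z * deviation s z y)) \<partial>\<mu>)"
      using I by (intro integral_norm_bound_ennreal) (simp add: has_bochner_integral_iff)
    also have "\<dots> = (\<integral>\<^sup>+z. ennreal (v r x z) * ennreal \<bar>deviation s z y\<bar> \<partial>\<mu>)"
      using x(2) by (intro nn_integral_cong_AE, eventually_elim) (simp add: abs_mult ennreal_mult)
    finally show ?case
      using I by (simp add: has_bochner_integral_iff)
  qed
qed

end

section \<open>Decay of the deviation\<close>

context dominated_kernel_pair
begin

lemma deviation_bound_AE:
  "\<exists>C>0. \<forall>t>2 * t\<^sub>0. AE x in \<mu>. AE y in \<mu>. \<bar>deviation t x y\<bar> \<le> C * exp (- \<gamma> * t)"
  using kernel_limit_AE unfolding deviation_def .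

text \<open>The number \<open>\<epsilon>\<close> bounds \<open>P\<^sub>t\<^sub>0 1\<close> outside \<open>K\<^sub>s\<close>. With \<open>Q(z)\<close> the row
integral of the deviation, \<open>Q\<close> is at most \<open>P\<^sub>s 1\<close> plus a multiple of \<open>\<phi>\<close>. This is bounded by
\<open>c\<^sub>1 \<phi>\<close> on \<open>K\<^sub>s\<close>, by \<open>c\<^sub>2 \<epsilon>\<close> outside \<open>K\<^sub>s\<close>, and by \<open>c\<^sub>2\<close> everywhere. In the product of two
deviations the first estimate is paired with the uniform bound \<open>C\<^sub>0 exp (- \<gamma> s)\<close>, the second with
the third.\<close>

lemma deviation_L1_bound:
  "\<exists>C>0. \<forall>s>3 * t\<^sub>0. \<forall>\<epsilon>\<ge>0.
    (AE z in \<mu>. z \<notin> K s \<longrightarrow> nn_kernel \<mu> (v t\<^sub>0) (\<lambda>_. 1) z \<le> ennreal \<epsilon>) \<longrightarrow>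
    (AE x in \<mu>. (\<integral>\<^sup>+y. ennreal \<bar>deviation (s + s) x y\<bar> \<partial>\<mu>) \<le> ennreal (C * (exp (- \<gamma> * s) + \<epsilon>)))"
proof -
  obtain C\<^sub>0 where C0: "0 < C\<^sub>0" "\<And>t. 2 * t\<^sub>0 < t \<Longrightarrow>
      AE x in \<mu>. AE y in \<mu>. \<bar>deviation t x y\<bar> \<le> C\<^sub>0 * exp (- \<gamma> * t)"
    using deviation_bound_AE by blast
  obtain Cd where Cd: "0 < Cd" "\<And>t. t\<^sub>0 \<le> t \<Longrightarrow> AE x in \<mu>. x \<in> K t \<longrightarrow>
      nn_kernel \<mu> (v t) (\<lambda>_. 1) x \<le> ennreal (Cd * \<phi> x)"
    using dominated by blast
  obtain N where N: "0 \<le> N" "\<And>t. 2 * t\<^sub>0 \<le> t \<Longrightarrow> norm_bound t N"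
    using uniform_norm_bound by blast
  obtain B where phi: "AE x in \<mu>. 0 < \<phi> x \<and> \<phi> x \<le> B" using phi_bounds by blast
  then have "AE x in \<mu>. 0 \<le> B" by eventually_elim simp
  then have B: "0 \<le> B" by (rule AE_const_imp)
  obtain B' where psi: "AE x in \<mu>. 0 < \<psi> x \<and> \<psi> x \<le> B'" using psi_bounds by blast
  obtain p where p: "(\<integral>\<^sup>+x. ennreal (\<phi> x) \<partial>\<mu>) = ennreal p" "0 \<le> p"
    using phi_integral_finite by (cases "\<integral>\<^sup>+x. ennreal (\<phi> x) \<partial>\<mu>") auto
  obtain q where q: "(\<integral>\<^sup>+x. ennreal (\<psi> x) \<partial>\<mu>) = ennreal q" "0 \<le> q"
    using psi_integral_finite by (cases "\<integral>\<^sup>+x. ennreal (\<psi> x) \<partial>\<mu>") auto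
  (* c1 is the domination constant plus the rank-one part; c2 replaces domination by the uniform
     bound N of the mass, and phi by its upper bound B *)
  define c\<^sub>1 where "c\<^sub>1 = Cd + q / \<Lambda>"
  define c\<^sub>2 where "c\<^sub>2 = N + B * q / \<Lambda>"
  have c0: "0 < c\<^sub>1" "0 \<le> c\<^sub>2" using Cd(1) q N(1) B Lambda_pos by (auto simp: c\<^sub>1_def c\<^sub>2_def add_pos_nonneg)
  define C where "C = C\<^sub>0 * c\<^sub>1 * p + c\<^sub>2 * c\<^sub>2 + 1"
  have "0 < C" unfolding C_def using C0(1) c0 p by (intro add_nonneg_pos add_nonneg_nonneg) auto
  moreover have "AE x in \<mu>. (\<integral>\<^sup>+y. ennreal \<bar>deviation (s + s) x y\<bar> \<partial>\<mu>)
      \<le> ennreal (C * (exp (- \<gamma> * s) + \<epsilon>))"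
    if s: "3 * t\<^sub>0 < s" and eps: "0 \<le> \<epsilon>"
      and tail: "AE z in \<mu>. z \<notin> K s \<longrightarrow> nn_kernel \<mu> (v t\<^sub>0) (\<lambda>_. 1) z \<le> ennreal \<epsilon>" for s \<epsilon>
  proof -
    have s0: "0 < s" "t\<^sub>0 \<le> s" "2 * t\<^sub>0 \<le> s - t\<^sub>0" "0 < s - t\<^sub>0" "2 * t\<^sub>0 < s" "2 * t\<^sub>0 \<le> s"
      using s t0_pos by simp_all
    have [measurable]: "case_prod (deviation s) \<in> borel_measurable (\<mu> \<Otimes>\<^sub>M \<mu>)"
      "case_prod (v s) \<in> borel_measurable (\<mu> \<Otimes>\<^sub>M \<mu>)"
      using deviation_measurable kernel_measurable s0(1) by auto
    define Q where "Q z = (\<integral>\<^sup>+y. ennreal \<bar>deviation s z y\<bar> \<partial>\<mu>)" for z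
    have [measurable]: "Q \<in> borel_measurable \<mu>" unfolding Q_def by measurable
    have Q: "AE z in \<mu>. Q z \<le> nn_kernel \<mu> (v s) (\<lambda>_. 1) z + ennreal (\<phi> z * (q / \<Lambda>))"
      using kernel_AE[OF s0(1)] phi AE_space
    proof eventually_elim
      case (elim z)
      have [measurable]: "z \<in> space \<mu>" by fact
      have "Q z \<le> (\<integral>\<^sup>+y. ennreal (v s z y) * 1 + ennreal (\<phi> z / \<Lambda>) * ennreal (\<psi> y) \<partial>\<mu>)"
        unfolding Q_def using elim(1) psi
      proof (intro nn_integral_mono_AE, eventually_elim)
        case (elim y)
        have "0 \<le> \<phi> z * \<psi> y / \<Lambda>" using elim \<open>0 < \<phi> z \<and> \<phi> z \<le> B\<close> Lambda_pos by simp
        then have "\<bar>deviation s z y\<bar> \<le> v s z y + \<phi> z / \<Lambda> * \<psi> y"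
          using elim(3) by (simp add: deviation_def)
        then have "ennreal \<bar>deviation s z y\<bar> \<le> ennreal (v s z y + \<phi> z / \<Lambda> * \<psi> y)"
          by (rule ennreal_leI)
        also have "\<dots> = ennreal (v s z y) * 1 + ennreal (\<phi> z / \<Lambda>) * ennreal (\<psi> y)"
          using elim(3,4) \<open>0 < \<phi> z \<and> \<phi> z \<le> B\<close> Lambda_pos
          by (simp flip: ennreal_mult ennreal_plus)
        finally show ?case .
      qed
      also have "\<dots> = nn_kernel \<mu> (v s) (\<lambda>_. 1) z + ennreal (\<phi> z / \<Lambda>) * ennreal q"
        unfolding nn_kernel_def q(1)[symmetric]
        by (subst nn_integral_add) (auto simp: nn_integral_cmult)
      also have "ennreal (\<phi> z / \<Lambda>) * ennreal q = ennreal (\<phi> z * (q / \<Lambda>))"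
        using elim(2) Lambda_pos q(2) by (simp flip: ennreal_mult)
      finally show ?case .
    qed
    have inside: "AE z in \<mu>. z \<in> K s \<longrightarrow> Q z \<le> ennreal (c\<^sub>1 * \<phi> z)"
      using Q Cd(2)[OF s0(2)] phi
    proof eventually_elim
      case (elim z)
      show ?case
      proof
        assume "z \<in> K s"
        then have "Q z \<le> ennreal (Cd * \<phi> z) + ennreal (\<phi> z * (q / \<Lambda>))"
          using elim by (blast intro: order_trans add_right_mono)
        also have "\<dots> = ennreal (c\<^sub>1 * \<phi> z)"
          using elim(3) Cd(1) q(2) Lambda_pos
          by (simp add: c\<^sub>1_def algebra_simps flip: ennreal_plus)
        finally show "Q z \<le> ennreal (c\<^sub>1 * \<phi> z)" .
      qed
    qed
    have global: "AE z in \<mu>. Q z \<le> ennreal c\<^sub>2"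
      using Q N(2)[OF s0(6), unfolded norm_bound_def] phi
    proof eventually_elim
      case (elim z)
      have "Q z \<le> ennreal N + ennreal (B * q / \<Lambda>)"
      proof (rule order_trans[OF elim(1) add_mono[OF elim(2) ennreal_leI]])
        show "\<phi> z * (q / \<Lambda>) \<le> B * q / \<Lambda>"
          using mult_right_mono[of "\<phi> z" B "q / \<Lambda>"] elim(3) q(2) Lambda_pos by simp
      qed
      then show ?case using N(1) B q(2) Lambda_pos by (simp add: c\<^sub>2_def)
    qed
    have phi_le: "AE y in \<mu>. ennreal (\<phi> y) \<le> ennreal B"
      using phi by eventually_elim (simp add: ennreal_leI)
    have "AE z in \<mu>. nn_kernel \<mu> (v s) (\<lambda>_. 1) z
        = nn_kernel \<mu> (v t\<^sub>0) (nn_kernel \<mu> (v (s - t\<^sub>0)) (\<lambda>_. 1)) z"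
      using nn_kernel_law[OF t0_pos s0(4) borel_measurable_const[of 1]] by simp
    with tail Q phi nn_kernel_le_const[OF t0_pos N(2)[OF s0(3), unfolded norm_bound_def]]
      nn_kernel_le_const[OF t0_pos phi_le] phi_invariant[OF t0_pos]
    have outside: "AE z in \<mu>. z \<notin> K s \<longrightarrow> Q z \<le> ennreal (c\<^sub>2 * \<epsilon>)"
    proof eventually_elim
      case (elim z)
      show ?case
      proof
        assume "z \<notin> K s"
        then have P: "nn_kernel \<mu> (v t\<^sub>0) (\<lambda>_. 1) z \<le> ennreal \<epsilon>" using elim(1) by blast
        have "nn_kernel \<mu> (v s) (\<lambda>_. 1) z \<le> ennreal N * nn_kernel \<mu> (v t\<^sub>0) (\<lambda>_. 1) z"
          unfolding elim(7) by (rule elim(4))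
        also have "\<dots> \<le> ennreal N * ennreal \<epsilon>" by (intro mult_left_mono P) simp
        finally have 1: "nn_kernel \<mu> (v s) (\<lambda>_. 1) z \<le> ennreal (N * \<epsilon>)"
          using N(1) eps by (simp add: ennreal_mult)
        have "ennreal (\<phi> z) \<le> ennreal B * nn_kernel \<mu> (v t\<^sub>0) (\<lambda>_. 1) z"
          unfolding elim(6)[symmetric] by (rule elim(5))
        also have "\<dots> \<le> ennreal B * ennreal \<epsilon>" by (intro mult_left_mono P) simp
        finally have "\<phi> z \<le> B * \<epsilon>"
          using B eps by (simp flip: ennreal_mult)
        then have 2: "\<phi> z * (q / \<Lambda>) \<le> B * \<epsilon> * (q / \<Lambda>)"
          using q(2) Lambda_pos by (intro mult_right_mono) auto
        have "Q z \<le> ennreal (N * \<epsilon>) + ennreal (B * \<epsilon> * (q / \<Lambda>))"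
          by (rule order_trans[OF elim(2) add_mono[OF 1 ennreal_leI[OF 2]]])
        then show "Q z \<le> ennreal (c\<^sub>2 * \<epsilon>)"
          using N(1) B eps q(2) Lambda_pos
          by (simp add: c\<^sub>2_def algebra_simps flip: ennreal_plus)
      qed
    qed
    define E where "E = C\<^sub>0 * exp (- \<gamma> * s)"
    have E: "0 \<le> E" using C0(1) by (simp add: E_def)
    from deviation_deviation[OF s0(1) s0(1)] C0(2)[OF s0(5)] global AE_space
    show ?thesis
    proof eventually_elim
      case (elim x)
      have [measurable]: "x \<in> space \<mu>" by fact
      have "(\<integral>\<^sup>+y. ennreal \<bar>deviation (s + s) x y\<bar> \<partial>\<mu>)
          \<le> (\<integral>\<^sup>+y. (\<integral>\<^sup>+z. ennreal \<bar>deviation s x z\<bar> * ennreal \<bar>deviation s z y\<bar> \<partial>\<mu>) \<partial>\<mu>)"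
        using elim(1) by (rule nn_integral_mono_AE)
      also have "\<dots> = (\<integral>\<^sup>+z. (\<integral>\<^sup>+y. ennreal \<bar>deviation s x z\<bar> * ennreal \<bar>deviation s z y\<bar> \<partial>\<mu>) \<partial>\<mu>)"
        by (rule pair.Fubini') measurable
      also have "\<dots> = (\<integral>\<^sup>+z. ennreal \<bar>deviation s x z\<bar> * Q z \<partial>\<mu>)"
        unfolding Q_def by (intro nn_integral_cong nn_integral_cmult) measurable
      also have "\<dots> \<le> (\<integral>\<^sup>+z. ennreal (E * c\<^sub>1) * ennreal (\<phi> z)
          + ennreal (c\<^sub>2 * \<epsilon>) * ennreal \<bar>deviation s x z\<bar> \<partial>\<mu>)"
        using elim(2)[folded E_def] inside outside phi
      proof (intro nn_integral_mono_AE, eventually_elim)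
        case (elim z)
        show ?case
        proof (cases "z \<in> K s")
          case True
          then have "ennreal \<bar>deviation s x z\<bar> * Q z \<le> ennreal E * ennreal (c\<^sub>1 * \<phi> z)"
            using elim by (intro mult_mono ennreal_leI) auto
          also have "\<dots> = ennreal (E * c\<^sub>1) * ennreal (\<phi> z)"
            using elim(8) E c0 by (simp add: mult.assoc flip: ennreal_mult)
          finally show ?thesis by (rule order_trans) simp
        next
          case False
          then have "ennreal \<bar>deviation s x z\<bar> * Q z \<le> ennreal \<bar>deviation s x z\<bar> * ennreal (c\<^sub>2 * \<epsilon>)"
            using elim by (intro mult_left_mono) auto
          then show ?thesis by (simp add: mult.commute add_increasing)
        qed
      qed
      also have "\<dots> = ennreal (E * c\<^sub>1) * ennreal p + ennreal (c\<^sub>2 * \<epsilon>) * Q x"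
        unfolding Q_def p(1)[symmetric] by (subst nn_integral_add) (auto simp: nn_integral_cmult)
      also have "\<dots> \<le> ennreal (E * c\<^sub>1) * ennreal p + ennreal (c\<^sub>2 * \<epsilon>) * ennreal c\<^sub>2"
        using elim(3) by (intro add_left_mono mult_left_mono) auto
      also have "\<dots> = ennreal (E * c\<^sub>1 * p + c\<^sub>2 * \<epsilon> * c\<^sub>2)"
        using E c0 p(2) eps by (simp add: ennreal_mult)
      also have "\<dots> \<le> ennreal (C * (exp (- \<gamma> * s) + \<epsilon>))"
      proof (rule ennreal_leI)
        have "E * c\<^sub>1 * p + c\<^sub>2 * \<epsilon> * c\<^sub>2
            = C\<^sub>0 * c\<^sub>1 * p * exp (- \<gamma> * s) + c\<^sub>2 * c\<^sub>2 * \<epsilon>"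
          by (simp add: E_def algebra_simps)
        also have "\<dots> \<le> C * exp (- \<gamma> * s) + C * \<epsilon>"
          using C0(1) c0 p(2) eps by (intro add_mono mult_right_mono) (auto simp: C_def)
        finally show "E * c\<^sub>1 * p + c\<^sub>2 * \<epsilon> * c\<^sub>2 \<le> C * (exp (- \<gamma> * s) + \<epsilon>)"
          by (simp add: algebra_simps)
      qed
      finally show ?case .
    qed
  qed
  ultimately show ?thesis by blast
qed

text \<open>Adds the remaining time \<open>r\<close> and passes from \<open>1\<close> to functions \<open>g \<le> 1 + h\<close>: the row integral
against \<open>g\<close> is estimated at time \<open>s + s\<close>, where \<open>h\<close> costs only the uniform bound of the deviation,
and the result is then transported by \<open>P\<^sub>r\<close>.\<close>

lemma deviation_estimate:
  "\<exists>C>0. \<forall>s>3 * t\<^sub>0. \<forall>r>0. \<forall>\<epsilon>\<ge>0. \<forall>g\<in>borel_measurable \<mu>. \<forall>h\<in>borel_measurable \<mu>.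
    (AE z in \<mu>. z \<notin> K s \<longrightarrow> nn_kernel \<mu> (v t\<^sub>0) (\<lambda>_. 1) z \<le> ennreal \<epsilon>) \<longrightarrow>
    (AE y in \<mu>. g y \<le> 1 + h y) \<longrightarrow> (\<integral>\<^sup>+y. h y \<partial>\<mu>) \<le> 1 \<longrightarrow>
    (AE x in \<mu>. (\<integral>\<^sup>+y. ennreal \<bar>deviation (r + (s + s)) x y\<bar> * g y \<partial>\<mu>)
       \<le> ennreal (C * (exp (- \<gamma> * s) + \<epsilon>)) * nn_kernel \<mu> (v r) (\<lambda>_. 1) x)"
proof -
  obtain C\<^sub>0 where C0: "0 < C\<^sub>0" "\<And>t. 2 * t\<^sub>0 < t \<Longrightarrow>
      AE x in \<mu>. AE y in \<mu>. \<bar>deviation t x y\<bar> \<le> C\<^sub>0 * exp (- \<gamma> * t)"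
    using deviation_bound_AE by blast
  obtain C\<^sub>1 where C1: "0 < C\<^sub>1" "\<And>s \<epsilon>. 3 * t\<^sub>0 < s \<Longrightarrow> 0 \<le> \<epsilon> \<Longrightarrow>
      (AE z in \<mu>. z \<notin> K s \<longrightarrow> nn_kernel \<mu> (v t\<^sub>0) (\<lambda>_. 1) z \<le> ennreal \<epsilon>) \<Longrightarrow>
      (AE x in \<mu>. (\<integral>\<^sup>+y. ennreal \<bar>deviation (s + s) x y\<bar> \<partial>\<mu>) \<le> ennreal (C\<^sub>1 * (exp (- \<gamma> * s) + \<epsilon>)))"
    using deviation_L1_bound by blast
  define C where "C = C\<^sub>0 + C\<^sub>1"
  have "0 < C" using C0(1) C1(1) by (simp add: C_def)
  moreover have "AE x in \<mu>. (\<integral>\<^sup>+y. ennreal \<bar>deviation (r + (s + s)) x y\<bar> * g y \<partial>\<mu>)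
       \<le> ennreal (C * (exp (- \<gamma> * s) + \<epsilon>)) * nn_kernel \<mu> (v r) (\<lambda>_. 1) x"
    if s: "3 * t\<^sub>0 < s" and r: "0 < r" and eps: "0 \<le> \<epsilon>"
      and [measurable]: "g \<in> borel_measurable \<mu>" "h \<in> borel_measurable \<mu>"
      and tail: "AE z in \<mu>. z \<notin> K s \<longrightarrow> nn_kernel \<mu> (v t\<^sub>0) (\<lambda>_. 1) z \<le> ennreal \<epsilon>"
      and g: "AE y in \<mu>. g y \<le> 1 + h y" and h: "(\<integral>\<^sup>+y. h y \<partial>\<mu>) \<le> 1" for s r \<epsilon> g h
  proof -
    define w where "w = s + s"
    have s0: "0 < w" "2 * t\<^sub>0 < w" "0 < s" using s t0_pos by (simp_all add: w_def)
    have [measurable]: "case_prod (deviation w) \<in> borel_measurable (\<mu> \<Otimes>\<^sub>M \<mu>)"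
      "case_prod (v r) \<in> borel_measurable (\<mu> \<Otimes>\<^sub>M \<mu>)"
      using deviation_measurable[OF s0(1)] kernel_measurable[OF r] by auto
    define G where "G z = (\<integral>\<^sup>+y. ennreal \<bar>deviation w z y\<bar> * g y \<partial>\<mu>)" for z
    have [measurable]: "G \<in> borel_measurable \<mu>" unfolding G_def by measurable
    have "AE z in \<mu>. G z \<le> ennreal (C * (exp (- \<gamma> * s) + \<epsilon>))"
      using C0(2)[OF s0(2)] C1(2)[OF s eps tail, folded w_def] AE_space
    proof eventually_elim
      case (elim z)
      have [measurable]: "z \<in> space \<mu>" by fact
      define e where "e = C\<^sub>0 * exp (- \<gamma> * w)"
      have e: "0 \<le> e" using C0(1) by (simp add: e_def)
      have "G z \<le> (\<integral>\<^sup>+y. ennreal \<bar>deviation w z y\<bar> + ennreal e * h y \<partial>\<mu>)"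
        unfolding G_def using elim(1)[folded e_def] g
      proof (intro nn_integral_mono_AE, eventually_elim)
        case (elim y)
        have "ennreal \<bar>deviation w z y\<bar> * g y \<le> ennreal \<bar>deviation w z y\<bar> * (1 + h y)"
          by (intro mult_left_mono elim(4)) simp
        also have "\<dots> = ennreal \<bar>deviation w z y\<bar> + ennreal \<bar>deviation w z y\<bar> * h y"
          by (simp add: distrib_left)
        also have "\<dots> \<le> ennreal \<bar>deviation w z y\<bar> + ennreal e * h y"
          using elim(3) by (intro add_left_mono mult_right_mono ennreal_leI) auto
        finally show ?case .
      qed
      also have "\<dots> = (\<integral>\<^sup>+y. ennreal \<bar>deviation w z y\<bar> \<partial>\<mu>) + ennreal e * (\<integral>\<^sup>+y. h y \<partial>\<mu>)"
        by (subst nn_integral_add) (auto simp: nn_integral_cmult)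
      also have "\<dots> \<le> ennreal (C\<^sub>1 * (exp (- \<gamma> * s) + \<epsilon>)) + ennreal e * 1"
        by (intro add_mono elim(2) mult_left_mono h) simp
      also have "\<dots> = ennreal (C\<^sub>1 * (exp (- \<gamma> * s) + \<epsilon>) + e)"
        using C1(1) eps e by simp
      also have "\<dots> \<le> ennreal (C * (exp (- \<gamma> * s) + \<epsilon>))"
      proof (rule ennreal_leI)
        have "exp (- \<gamma> * w) \<le> exp (- \<gamma> * s)" using gamma_pos s0(3) by (simp add: w_def)
        then have "exp (- \<gamma> * w) \<le> exp (- \<gamma> * s) + \<epsilon>" using eps by linarith
        then have "e \<le> C\<^sub>0 * (exp (- \<gamma> * s) + \<epsilon>)"
          unfolding e_def using C0(1) by (intro mult_left_mono) simp_all
        then show "C\<^sub>1 * (exp (- \<gamma> * s) + \<epsilon>) + e \<le> C * (exp (- \<gamma> * s) + \<epsilon>)"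
          by (simp add: C_def distrib_right)
      qed
      finally show ?case .
    qed
    from kernel_deviation[OF r s0(1)] nn_kernel_le_const[OF r this] AE_space
    show ?thesis
      unfolding w_def[symmetric]
    proof eventually_elim
      case (elim x)
      have [measurable]: "x \<in> space \<mu>" by fact
      have "(\<integral>\<^sup>+y. ennreal \<bar>deviation (r + w) x y\<bar> * g y \<partial>\<mu>)
          \<le> (\<integral>\<^sup>+y. (\<integral>\<^sup>+z. ennreal (v r x z) * ennreal \<bar>deviation w z y\<bar> \<partial>\<mu>) * g y \<partial>\<mu>)"
        using elim(1) by (intro nn_integral_mono_AE, eventually_elim) (intro mult_right_mono, auto)
      also have "\<dots> = (\<integral>\<^sup>+y. (\<integral>\<^sup>+z. ennreal (v r x z) * ennreal \<bar>deviation w z y\<bar> * g y \<partial>\<mu>) \<partial>\<mu>)"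
        by (intro nn_integral_cong nn_integral_multc[symmetric]) measurable
      also have "\<dots> = (\<integral>\<^sup>+z. (\<integral>\<^sup>+y. ennreal (v r x z) * ennreal \<bar>deviation w z y\<bar> * g y \<partial>\<mu>) \<partial>\<mu>)"
        by (rule pair.Fubini') measurable
      also have "\<dots> = nn_kernel \<mu> (v r) G x"
        unfolding nn_kernel_def G_def
        by (intro nn_integral_cong) (simp add: nn_integral_cmult[symmetric] mult.assoc)
      also have "\<dots> \<le> ennreal (C * (exp (- \<gamma> * s) + \<epsilon>)) * nn_kernel \<mu> (v r) (\<lambda>_. 1) x"
        by (rule elim(2))
      finally show ?case .
    qed
  qed
  ultimately show ?thesis by blast
qed

end

section \<open>Action on Lebesgue spaces\<close>

text \<open>For finite exponent take \<open>h = \<bar>f\<bar>\<^sup>p\<close>, since \<open>\<bar>f\<bar> \<le> \<bar>f\<bar>\<^sup>p\<close> where \<open>\<bar>f\<bar>\<close> is at least \<open>1\<close>; for infinite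
exponent take \<open>h = 0\<close>. This decouples all later estimates from the exponent.\<close>

lemma Lp_unit_ball_split:
  fixes f :: "'a \<Rightarrow> complex"
  assumes f: "f \<in> Lp \<mu> p" "Lp_norm \<mu> p f \<le> 1" and p: "1 \<le> p"
  obtains h where "h \<in> borel_measurable \<mu>" "AE y in \<mu>. ennreal (norm (f y)) \<le> 1 + h y"
    "(\<integral>\<^sup>+y. h y \<partial>\<mu>) \<le> 1"
proof (cases "p = \<top>")
  case True
  then have fin: "esssup \<mu> (\<lambda>x. ennreal (norm (f x))) < \<top>"
    and le: "enn2real (esssup \<mu> (\<lambda>x. ennreal (norm (f x)))) \<le> 1"
    using f by (simp_all add: Lp_def Lp_norm_def)
  have le1: "esssup \<mu> (\<lambda>x. ennreal (norm (f x))) \<le> 1"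
    using fin le by (cases "esssup \<mu> (\<lambda>x. ennreal (norm (f x)))") auto
  have "AE y in \<mu>. ennreal (norm (f y)) \<le> 1 + 0"
    using esssup_AE[of "\<lambda>x. ennreal (norm (f x))" \<mu>]
  proof eventually_elim
    case (elim y)
    show ?case using order_trans[OF elim le1] by simp
  qed
  then show ?thesis by (intro that[of "\<lambda>_. 0"]) auto
next
  case False
  define q where "q = enn2real p"
  have q: "1 \<le> q" using p False unfolding q_def by (cases p) auto
  have [measurable]: "f \<in> borel_measurable \<mu>" using f by (simp add: Lp_def)
  have int: "integrable \<mu> (\<lambda>x. norm (f x) powr q)" using f False by (simp add: Lp_def q_def)
  have "(\<integral>x. norm (f x) powr q \<partial>\<mu>) powr (1 / q) \<le> 1"
    using f False by (simp add: Lp_norm_def q_def)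
  then have "((\<integral>x. norm (f x) powr q \<partial>\<mu>) powr (1 / q)) powr q \<le> 1 powr q"
    using q by (intro powr_mono2) auto
  then have "(\<integral>x. norm (f x) powr q \<partial>\<mu>) \<le> 1"
    using q by (simp add: powr_powr)
  then have "(\<integral>\<^sup>+x. ennreal (norm (f x) powr q) \<partial>\<mu>) \<le> 1"
    using int by (simp add: nn_integral_eq_integral)
  moreover have "ennreal (norm (f y)) \<le> 1 + ennreal (norm (f y) powr q)" for y
  proof -
    have "norm (f y) \<le> 1 + norm (f y) powr q"
    proof (cases "norm (f y) \<le> 1")
      case True
      then show ?thesis by (simp add: add_increasing2)
    next
      case False
      then have "norm (f y) powr 1 \<le> norm (f y) powr q" using q by (intro powr_mono) auto
      then show ?thesis using False by simp
    qed
    then have "ennreal (norm (f y)) \<le> ennreal (1 + norm (f y) powr q)" by (rule ennreal_leI)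
    then show ?thesis by simp
  qed
  ultimately show ?thesis by (intro that[of "\<lambda>y. ennreal (norm (f y) powr q)"]) auto
qed

lemma one_in_unit_ball:
  "(\<lambda>_. 1 :: complex) \<in> Lp \<mu> \<top>" "Lp_norm \<mu> \<top> (\<lambda>_. 1 :: complex) \<le> 1"
proof -
  have le: "esssup \<mu> (\<lambda>_. 1 :: ennreal) \<le> 1" by (rule esssup_I) simp_all
  then have "esssup \<mu> (\<lambda>_. 1 :: ennreal) < \<top>" by (rule le_less_trans) simp
  then show "(\<lambda>_. 1 :: complex) \<in> Lp \<mu> \<top>" by (simp add: Lp_def)
  show "Lp_norm \<mu> \<top> (\<lambda>_. 1 :: complex) \<le> 1"
    using enn2real_mono[OF le] by (simp add: Lp_norm_def)
qed

context dominated_kernel_pair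
begin

text \<open>Beyond time \<open>2 t\<^sub>0\<close> the kernel is essentially bounded, so the integrable part \<open>h\<close> is mapped to a
bounded function as well.\<close>

lemma kernel_Lp_bounded:
  assumes s: "2 * t\<^sub>0 < s" and [measurable]: "g \<in> borel_measurable \<mu>" "h \<in> borel_measurable \<mu>"
    and g: "AE y in \<mu>. g y \<le> 1 + h y" and h: "(\<integral>\<^sup>+y. h y \<partial>\<mu>) \<le> 1"
  shows "\<exists>N\<ge>0. AE z in \<mu>. nn_kernel \<mu> (v s) g z \<le> ennreal N"
proof -
  have s0: "0 < s" using s t0_pos by simp
  have [measurable]: "case_prod (v s) \<in> borel_measurable (\<mu> \<Otimes>\<^sub>M \<mu>)"
    using kernel_measurable s0 .
  obtain C\<^sub>0 where C0: "0 < C\<^sub>0" "\<And>t. 2 * t\<^sub>0 < t \<Longrightarrow>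
      AE x in \<mu>. AE y in \<mu>. \<bar>v t x y - \<phi> x * \<psi> y / \<Lambda>\<bar> \<le> C\<^sub>0 * exp (- \<gamma> * t)"
    using kernel_limit_AE by blast
  obtain B where phi: "AE x in \<mu>. 0 < \<phi> x \<and> \<phi> x \<le> B" using phi_bounds by blast
  then have "AE x in \<mu>. 0 \<le> B" by eventually_elim simp
  then have B: "0 \<le> B" by (rule AE_const_imp)
  obtain B' where psi: "AE x in \<mu>. 0 < \<psi> x \<and> \<psi> x \<le> B'" using psi_bounds by blast
  then have "AE x in \<mu>. 0 \<le> B'" by eventually_elim simp
  then have B': "0 \<le> B'" by (rule AE_const_imp)
  define c where "c = B * B' / \<Lambda> + C\<^sub>0 * exp (- \<gamma> * s)"
  have c: "0 \<le> c" using B B' C0(1) Lambda_pos by (simp add: c_def)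
  obtain N where N: "0 \<le> N" "AE x in \<mu>. nn_kernel \<mu> (v s) (\<lambda>_. 1) x \<le> ennreal N"
    using bounded_nonneg[OF s0] by blast
  have "AE z in \<mu>. nn_kernel \<mu> (v s) g z \<le> ennreal (N + c)"
    using C0(2)[OF s] phi N(2) AE_space
  proof eventually_elim
    case (elim z)
    have [measurable]: "z \<in> space \<mu>" by fact
    have "AE y in \<mu>. ennreal (v s z y) * g y \<le> ennreal (v s z y) * 1 + ennreal c * h y"
      using elim(1) psi g
    proof eventually_elim
      case (elim y)
      have "\<phi> z * \<psi> y \<le> B * B'"
        using elim \<open>0 < \<phi> z \<and> \<phi> z \<le> B\<close> by (intro mult_mono) auto
      then have "\<phi> z * \<psi> y / \<Lambda> \<le> B * B' / \<Lambda>"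
        using Lambda_pos by (intro divide_right_mono) auto
      then have "v s z y \<le> c" using elim(1) unfolding c_def by linarith
      then have "ennreal (v s z y) * h y \<le> ennreal c * h y"
        by (intro mult_right_mono ennreal_leI) auto
      moreover have "ennreal (v s z y) * g y \<le> ennreal (v s z y) * (1 + h y)"
        by (intro mult_left_mono elim(3)) simp
      ultimately show ?case
        unfolding distrib_left by (metis add_left_mono order_trans)
    qed
    then have "nn_kernel \<mu> (v s) g z \<le> (\<integral>\<^sup>+y. ennreal (v s z y) * 1 + ennreal c * h y \<partial>\<mu>)"
      unfolding nn_kernel_def by (rule nn_integral_mono_AE)
    also have "\<dots> = nn_kernel \<mu> (v s) (\<lambda>_. 1) z + ennreal c * (\<integral>\<^sup>+y. h y \<partial>\<mu>)"
      unfolding nn_kernel_def by (subst nn_integral_add) (auto simp: nn_integral_cmult)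
    also have "\<dots> \<le> ennreal N + ennreal c * 1"
      by (intro add_mono mult_left_mono h elim(3)) simp
    also have "\<dots> = ennreal (N + c)" using N(1) c by simp
    finally show ?case .
  qed
  then show ?thesis using N(1) c by (intro exI[of _ "N + c"]) auto
qed

text \<open>The semigroup law for complex functions, by Fubini's theorem for the kernels rather than by
approximation of \<open>f\<close>.\<close>

lemma kernel_compose:
  fixes f :: "'a \<Rightarrow> complex"
  assumes r: "0 < r" and s: "0 < s" and [measurable]: "f \<in> borel_measurable \<mu>"
    and N: "AE z in \<mu>. nn_kernel \<mu> (v s) (\<lambda>y. ennreal (norm (f y))) z \<le> ennreal N"
  shows "AE x in \<mu>. integrable \<mu> (\<lambda>y. v (r + s) x y *\<^sub>R f y) \<and>
    (\<integral>y. v (r + s) x y *\<^sub>R f y \<partial>\<mu>) = (\<integral>z. v r x z *\<^sub>R (\<integral>y. v s z y *\<^sub>R f y \<partial>\<mu>) \<partial>\<mu>)"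
proof -
  have rs: "0 < r + s" using r s by simp
  have [measurable]: "case_prod (v s) \<in> borel_measurable (\<mu> \<Otimes>\<^sub>M \<mu>)"
    "case_prod (v r) \<in> borel_measurable (\<mu> \<Otimes>\<^sub>M \<mu>)"
    "case_prod (v (r + s)) \<in> borel_measurable (\<mu> \<Otimes>\<^sub>M \<mu>)"
    using kernel_measurable r s rs by simp_all
  let ?g = "\<lambda>y. ennreal (norm (f y))"
  obtain M where M: "0 \<le> M" "AE x in \<mu>. nn_kernel \<mu> (v r) (\<lambda>_. 1) x \<le> ennreal M"
    using bounded_nonneg[OF r] by blast
  have [measurable]: "?g \<in> borel_measurable \<mu>" by measurable
  have nonneg_s: "AE z in \<mu>. AE y in \<mu>. 0 \<le> v s z y" by (rule kernel_AE[OF s])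
  from kernel_products_AE[OF r s] nn_kernel_law[OF r s, of ?g, simplified] nn_kernel_le_const[OF r N] M(2)
    kernel_AE[OF r] kernel_AE[OF rs] AE_space
  show ?thesis
  proof eventually_elim
    case (elim x)
    have [measurable]: "x \<in> space \<mu>" by fact
    have "nn_kernel \<mu> (v (r + s)) ?g x \<le> ennreal N * nn_kernel \<mu> (v r) (\<lambda>_. 1) x"
      unfolding elim(2) by (rule elim(3))
    also have "\<dots> \<le> ennreal N * ennreal M" by (intro mult_left_mono elim(4)) simp
    also have "\<dots> < \<infinity>" by (simp add: ennreal_mult_less_top)
    finally have fin: "nn_kernel \<mu> (v (r + s)) ?g x < \<infinity>" .
    have 1: "integrable \<mu> (\<lambda>y. v (r + s) x y *\<^sub>R f y)"
    proof (rule integrableI_bounded)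
      have "(\<integral>\<^sup>+y. ennreal (norm (v (r + s) x y *\<^sub>R f y)) \<partial>\<mu>) = nn_kernel \<mu> (v (r + s)) ?g x"
        unfolding nn_kernel_def using elim(6)
        by (intro nn_integral_cong_AE, eventually_elim) (simp add: ennreal_mult)
      with fin show "(\<integral>\<^sup>+y. ennreal (norm (v (r + s) x y *\<^sub>R f y)) \<partial>\<mu>) < \<infinity>" by simp
    qed measurable
    have int: "integrable (\<mu> \<Otimes>\<^sub>M \<mu>) (\<lambda>(z, y). (v r x z * v s z y) *\<^sub>R f y)"
    proof (rule integrableI_bounded)
      have "(\<integral>\<^sup>+w. ennreal (norm (case w of (z, y) \<Rightarrow> (v r x z * v s z y) *\<^sub>R f y)) \<partial>(\<mu> \<Otimes>\<^sub>M \<mu>))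
          = (\<integral>\<^sup>+z. \<integral>\<^sup>+y. ennreal (norm ((v r x z * v s z y) *\<^sub>R f y)) \<partial>\<mu> \<partial>\<mu>)"
        by (subst nn_integral_fst[symmetric]) (auto simp: case_prod_beta')
      also have "\<dots> = nn_kernel \<mu> (v r) (nn_kernel \<mu> (v s) ?g) x"
        unfolding nn_kernel_def
      proof (intro nn_integral_cong_AE)
        show "AE z in \<mu>. (\<integral>\<^sup>+y. ennreal (norm ((v r x z * v s z y) *\<^sub>R f y)) \<partial>\<mu>)
            = ennreal (v r x z) * (\<integral>\<^sup>+y. ennreal (v s z y) * ennreal (norm (f y)) \<partial>\<mu>)"
          using elim(5) nonneg_s AE_space
        proof eventually_elim
          case (elim z)
          have [measurable]: "z \<in> space \<mu>" by fact
          have "(\<integral>\<^sup>+y. ennreal (norm ((v r x z * v s z y) *\<^sub>R f y)) \<partial>\<mu>)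
              = (\<integral>\<^sup>+y. ennreal (v r x z) * (ennreal (v s z y) * ennreal (norm (f y))) \<partial>\<mu>)"
            using elim(2) by (intro nn_integral_cong_AE, eventually_elim)
              (use elim(1) in \<open>simp add: ennreal_mult abs_mult mult.assoc\<close>)
          also have "\<dots> = ennreal (v r x z) * (\<integral>\<^sup>+y. ennreal (v s z y) * ennreal (norm (f y)) \<partial>\<mu>)"
            by (rule nn_integral_cmult) measurable
          finally show ?case .
        qed
      qed
      also have "\<dots> < \<infinity>" using fin unfolding elim(2) .
      finally show "(\<integral>\<^sup>+w. ennreal (norm (case w of (z, y) \<Rightarrow> (v r x z * v s z y) *\<^sub>R f y)) \<partial>(\<mu> \<Otimes>\<^sub>M \<mu>)) < \<infinity>" .
    qed measurable
    have "(\<integral>y. v (r + s) x y *\<^sub>R f y \<partial>\<mu>) = (\<integral>y. (\<integral>z. (v r x z * v s z y) *\<^sub>R f y \<partial>\<mu>) \<partial>\<mu>)"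
      using elim(1)
    proof (intro integral_cong_AE)
      show "AE y in \<mu>. v (r + s) x y *\<^sub>R f y = (\<integral>z. (v r x z * v s z y) *\<^sub>R f y \<partial>\<mu>)"
        using elim(1)
      proof eventually_elim
        case (elim y)
        then have "has_bochner_integral \<mu> (\<lambda>z. v r x z * v s z y) (v (r + s) x y)" by blast
        then show ?case by (simp add: has_bochner_integral_iff)
      qed
    qed measurable
    also have "\<dots> = (\<integral>z. (\<integral>y. (v r x z * v s z y) *\<^sub>R f y \<partial>\<mu>) \<partial>\<mu>)"
      using pair.Fubini_integral[of "\<lambda>z y. (v r x z * v s z y) *\<^sub>R f y"] int by simp
    also have "\<dots> = (\<integral>z. v r x z *\<^sub>R (\<integral>y. v s z y *\<^sub>R f y \<partial>\<mu>) \<partial>\<mu>)"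
      by (simp flip: scaleR_scaleR)
    finally show ?case using 1 by blast
  qed
qed

lemma integrable_psi_mult:
  fixes f :: "'a \<Rightarrow> complex"
  assumes [measurable]: "f \<in> borel_measurable \<mu>" "h \<in> borel_measurable \<mu>"
    and f: "AE y in \<mu>. ennreal (norm (f y)) \<le> 1 + h y" and h: "(\<integral>\<^sup>+y. h y \<partial>\<mu>) \<le> 1"
    and B: "AE y in \<mu>. 0 < \<psi> y \<and> \<psi> y \<le> B"
  shows "integrable \<mu> (\<lambda>y. \<psi> y *\<^sub>R f y)"
    "norm (\<integral>y. \<psi> y *\<^sub>R f y \<partial>\<mu>) \<le> (\<integral>y. \<psi> y \<partial>\<mu>) + B"
proof -
  have "AE x in \<mu>. 0 \<le> B" using B by eventually_elim simp
  then have B0: "0 \<le> B" by (rule AE_const_imp)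
  have psi0: "AE y in \<mu>. 0 \<le> \<psi> y" using B by eventually_elim simp
  have int: "integrable \<mu> \<psi>"
    using psi_integral_finite psi0 by (intro integrableI_nonneg) auto
  have "(\<integral>\<^sup>+y. ennreal (norm (\<psi> y *\<^sub>R f y)) \<partial>\<mu>) \<le> (\<integral>\<^sup>+y. ennreal (\<psi> y) + ennreal B * h y \<partial>\<mu>)"
  proof (rule nn_integral_mono_AE)
    show "AE y in \<mu>. ennreal (norm (\<psi> y *\<^sub>R f y)) \<le> ennreal (\<psi> y) + ennreal B * h y"
      using B f
    proof eventually_elim
      case (elim y)
      have "ennreal (norm (\<psi> y *\<^sub>R f y)) = ennreal (\<psi> y) * ennreal (norm (f y))"
        using elim by (simp add: ennreal_mult)
      also have "\<dots> \<le> ennreal (\<psi> y) * (1 + h y)"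
        by (intro mult_left_mono elim(2)) simp
      also have "\<dots> = ennreal (\<psi> y) + ennreal (\<psi> y) * h y"
        by (simp add: distrib_left)
      also have "\<dots> \<le> ennreal (\<psi> y) + ennreal B * h y"
        using elim by (intro add_left_mono mult_right_mono ennreal_leI) auto
      finally show ?case .
    qed
  qed
  also have "\<dots> = (\<integral>\<^sup>+y. ennreal (\<psi> y) \<partial>\<mu>) + ennreal B * (\<integral>\<^sup>+y. h y \<partial>\<mu>)"
    by (subst nn_integral_add) (auto simp: nn_integral_cmult)
  also have "\<dots> \<le> ennreal (\<integral>y. \<psi> y \<partial>\<mu>) + ennreal B * 1"
    using int psi0 by (intro add_mono mult_left_mono h) (simp_all add: nn_integral_eq_integral)
  also have "\<dots> = ennreal ((\<integral>y. \<psi> y \<partial>\<mu>) + B)"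
    using B0 psi0 by (simp add: integral_nonneg_AE)
  finally have le: "(\<integral>\<^sup>+y. ennreal (norm (\<psi> y *\<^sub>R f y)) \<partial>\<mu>) \<le> ennreal ((\<integral>y. \<psi> y \<partial>\<mu>) + B)" .
  show I: "integrable \<mu> (\<lambda>y. \<psi> y *\<^sub>R f y)"
    using le by (intro integrableI_bounded) (auto intro: le_less_trans)
  have "ennreal (norm (\<integral>y. \<psi> y *\<^sub>R f y \<partial>\<mu>)) \<le> ennreal ((\<integral>y. \<psi> y \<partial>\<mu>) + B)"
    by (rule order_trans[OF integral_norm_bound_ennreal[OF I] le])
  then show "norm (\<integral>y. \<psi> y *\<^sub>R f y \<partial>\<mu>) \<le> (\<integral>y. \<psi> y \<partial>\<mu>) + B"
    using B0 psi0 by (subst (asm) ennreal_le_iff) (auto intro!: add_nonneg_nonneg integral_nonneg_AE)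
qed

lemma kernel_Lp_estimate:
  "\<exists>C>0. \<forall>s>3 * t\<^sub>0. \<forall>r>0. \<forall>\<epsilon>\<ge>0. \<forall>f::'a \<Rightarrow> complex. \<forall>h.
    f \<in> borel_measurable \<mu> \<longrightarrow> h \<in> borel_measurable \<mu> \<longrightarrow>
    (AE z in \<mu>. z \<notin> K s \<longrightarrow> nn_kernel \<mu> (v t\<^sub>0) (\<lambda>_. 1) z \<le> ennreal \<epsilon>) \<longrightarrow>
    (AE y in \<mu>. ennreal (norm (f y)) \<le> 1 + h y) \<longrightarrow> (\<integral>\<^sup>+y. h y \<partial>\<mu>) \<le> 1 \<longrightarrow>
    (AE x in \<mu>. ennreal (norm ((\<integral>y. v (r + (s + s)) x y *\<^sub>R f y \<partial>\<mu>)
          - (\<phi> x / \<Lambda>) *\<^sub>R (\<integral>y. \<psi> y *\<^sub>R f y \<partial>\<mu>)))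
       \<le> ennreal (C * (exp (- \<gamma> * s) + \<epsilon>)) * nn_kernel \<mu> (v r) (\<lambda>_. 1) x)"
proof -
  obtain C where C: "0 < C" "\<And>s r \<epsilon> g h. 3 * t\<^sub>0 < s \<Longrightarrow> 0 < r \<Longrightarrow> 0 \<le> \<epsilon> \<Longrightarrow>
      g \<in> borel_measurable \<mu> \<Longrightarrow> h \<in> borel_measurable \<mu> \<Longrightarrow>
      AE z in \<mu>. z \<notin> K s \<longrightarrow> nn_kernel \<mu> (v t\<^sub>0) (\<lambda>_. 1) z \<le> ennreal \<epsilon> \<Longrightarrow>
      AE y in \<mu>. g y \<le> 1 + h y \<Longrightarrow> (\<integral>\<^sup>+y. h y \<partial>\<mu>) \<le> 1 \<Longrightarrow>
      AE x in \<mu>. (\<integral>\<^sup>+y. ennreal \<bar>deviation (r + (s + s)) x y\<bar> * g y \<partial>\<mu>)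
         \<le> ennreal (C * (exp (- \<gamma> * s) + \<epsilon>)) * nn_kernel \<mu> (v r) (\<lambda>_. 1) x"
    using deviation_estimate by blast
  obtain B where B: "AE x in \<mu>. 0 < \<psi> x \<and> \<psi> x \<le> B" using psi_bounds by blast
  have "AE x in \<mu>. ennreal (norm ((\<integral>y. v (r + (s + s)) x y *\<^sub>R f y \<partial>\<mu>)
          - (\<phi> x / \<Lambda>) *\<^sub>R (\<integral>y. \<psi> y *\<^sub>R f y \<partial>\<mu>)))
       \<le> ennreal (C * (exp (- \<gamma> * s) + \<epsilon>)) * nn_kernel \<mu> (v r) (\<lambda>_. 1) x"
    if s: "3 * t\<^sub>0 < s" and r: "0 < r" and eps: "0 \<le> \<epsilon>"
      and fm [measurable]: "f \<in> borel_measurable \<mu>" and hm [measurable]: "h \<in> borel_measurable \<mu>"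
      and tail: "AE z in \<mu>. z \<notin> K s \<longrightarrow> nn_kernel \<mu> (v t\<^sub>0) (\<lambda>_. 1) z \<le> ennreal \<epsilon>"
      and f: "AE y in \<mu>. ennreal (norm (f y)) \<le> 1 + h y" and h: "(\<integral>\<^sup>+y. h y \<partial>\<mu>) \<le> 1"
    for s r \<epsilon> h and f :: "'a \<Rightarrow> complex"
  proof -
    define w where "w = s + s"
    have ss: "2 * t\<^sub>0 < w" "0 < w" using s t0_pos by (simp_all add: w_def)
    have meas: "(\<lambda>y. ennreal (norm (f y))) \<in> borel_measurable \<mu>" by measurable
    obtain N where N: "AE z in \<mu>. nn_kernel \<mu> (v w) (\<lambda>y. ennreal (norm (f y))) z \<le> ennreal N"
      using kernel_Lp_bounded[OF ss(1) meas hm f h] by auto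
    from kernel_compose[OF r ss(2) fm N] C(2)[OF s r eps meas hm tail f h, folded w_def]
    show ?thesis
      unfolding w_def[symmetric]
    proof eventually_elim
      case (elim x)
      have I: "integrable \<mu> (\<lambda>y. v (r + w) x y *\<^sub>R f y)" using elim by simp
      note J = integrable_psi_mult(1)[OF fm hm f h B]
      have "(\<integral>y. v (r + w) x y *\<^sub>R f y \<partial>\<mu>) - (\<phi> x / \<Lambda>) *\<^sub>R (\<integral>y. \<psi> y *\<^sub>R f y \<partial>\<mu>)
          = (\<integral>y. v (r + w) x y *\<^sub>R f y - (\<phi> x / \<Lambda>) *\<^sub>R (\<psi> y *\<^sub>R f y) \<partial>\<mu>)"
        using I J by (simp del: scaleR_scaleR)
      also have "\<dots> = (\<integral>y. deviation (r + w) x y *\<^sub>R f y \<partial>\<mu>)"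
        by (intro Bochner_Integration.integral_cong) (simp_all add: deviation_def algebra_simps)
      finally have eq: "(\<integral>y. v (r + w) x y *\<^sub>R f y \<partial>\<mu>) - (\<phi> x / \<Lambda>) *\<^sub>R (\<integral>y. \<psi> y *\<^sub>R f y \<partial>\<mu>)
          = (\<integral>y. deviation (r + w) x y *\<^sub>R f y \<partial>\<mu>)" .
      have "integrable \<mu> (\<lambda>y. v (r + w) x y *\<^sub>R f y - (\<phi> x / \<Lambda>) *\<^sub>R (\<psi> y *\<^sub>R f y))"
        using I J by (simp del: scaleR_scaleR)
      then have "integrable \<mu> (\<lambda>y. deviation (r + w) x y *\<^sub>R f y)"
        by (simp add: deviation_def algebra_simps)
      from integral_norm_bound_ennreal[OF this]
      have "ennreal (norm (\<integral>y. deviation (r + w) x y *\<^sub>R f y \<partial>\<mu>))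
          \<le> (\<integral>\<^sup>+y. ennreal \<bar>deviation (r + w) x y\<bar> * ennreal (norm (f y)) \<partial>\<mu>)"
        by (simp add: ennreal_mult)
      also have "\<dots> \<le> ennreal (C * (exp (- \<gamma> * s) + \<epsilon>)) * nn_kernel \<mu> (v r) (\<lambda>_. 1) x"
        using elim by simp
      finally show ?case using eq by simp
    qed
  qed
  then show ?thesis using C(1) by blast
qed

end

section \<open>Continuous versions, supports and quotients of integrals\<close>

text \<open>The exceptional set is open and null, hence empty when the measure charges every open set.\<close>

lemma continuous_le_of_AE_le:
  fixes f g :: "'a::topological_space \<Rightarrow> real"
  assumes "sets \<mu> = sets borel" "measure_support \<mu> = UNIV"
    and cont: "continuous_on UNIV f" "continuous_on UNIV g" and AE: "AE x in \<mu>. f x \<le> g x"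
  shows "f x \<le> g x"
proof -
  let ?V = "{x. g x < f x}"
  have V: "open ?V" using cont by (intro open_Collect_less)
  have "AE x in \<mu>. x \<notin> ?V" using AE by eventually_elim simp
  moreover have "?V \<in> sets \<mu>" using V assms(1) by simp
  ultimately have "emeasure \<mu> ?V = 0" by (simp add: AE_iff_null_sets null_setsD1)
  then have "\<not> 0 < emeasure \<mu> ?V" by simp
  moreover have "x \<in> measure_support \<mu>" using assms(2) by simp
  ultimately have "x \<notin> ?V" using V unfolding measure_support_def by blast
  then show ?thesis by simp
qed

text \<open>The complement of the support is covered by the null sets of a countable basis.\<close>

lemma AE_in_measure_support:
  fixes \<sigma> :: "'a::second_countable_topology measure"
  assumes "sets \<sigma> = sets borel"
  shows "AE x in \<sigma>. x \<in> measure_support \<sigma>"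
proof -
  obtain \<B> :: "'a set set" where B: "countable \<B>" "topological_basis \<B>"
    using ex_countable_basis by blast
  have "(\<Union>V\<in>{V \<in> \<B>. emeasure \<sigma> V = 0}. V) \<in> null_sets \<sigma>"
    using B assms by (intro null_sets_UN') (auto simp: null_sets_def topological_basis_open)
  then show ?thesis
  proof (rule AE_I')
    show "{x \<in> space \<sigma>. x \<notin> measure_support \<sigma>} \<subseteq> (\<Union>V\<in>{V \<in> \<B>. emeasure \<sigma> V = 0}. V)"
    proof
      fix x assume "x \<in> {x \<in> space \<sigma>. x \<notin> measure_support \<sigma>}"
      then obtain V where V: "open V" "x \<in> V" "emeasure \<sigma> V = 0"
        unfolding measure_support_def by (auto simp: not_gr_zero)
      obtain W where W: "W \<in> \<B>" "x \<in> W" "W \<subseteq> V"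
        using topological_basisE[OF B(2) V(1,2)] by blast
      have "V \<in> sets \<sigma>" using V(1) assms by simp
      then have "emeasure \<sigma> W \<le> emeasure \<sigma> V" using W(3) by (intro emeasure_mono)
      then show "x \<in> (\<Union>V\<in>{V \<in> \<B>. emeasure \<sigma> V = 0}. V)" using V(3) W by auto
    qed
  qed
qed

lemma bcontfun_compose_linear:
  assumes "f \<in> bcontfun" "bounded_linear L"
  shows "(\<lambda>x. L (f x)) \<in> bcontfun"
proof -
  have f: "continuous_on UNIV f" "bounded (range f)" using assms(1) by (simp_all add: bcontfun_def)
  have "continuous_on UNIV (\<lambda>x. L (f x))" by (rule bounded_linear.continuous_on[OF assms(2) f(1)])
  moreover have "bounded (L ` range f)" by (rule bounded_linear_image[OF f(2) assms(2)])
  ultimately show ?thesis by (simp add: bcontfun_def image_image)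
qed

text \<open>The real and the complex continuous version of the same function agree, because the inclusion
of the reals transports one into a continuous version of the other.\<close>

lemma strong_feller_one:
  fixes \<mu> :: "'a::topological_space measure"
  assumes "sets \<mu> = sets borel" "measure_support \<mu> = UNIV" and feller: "strong_feller \<mu> u" and t: "0 < t"
  shows "(cont_semigroup \<mu> u t (\<lambda>_. 1) :: 'a \<Rightarrow> real) \<in> bcontfun" (is ?bc)
    and "AE x in \<mu>. integrable \<mu> (u t x) \<and>
      (cont_semigroup \<mu> u t (\<lambda>_. 1) x :: real) = (\<integral>y. u t x y \<partial>\<mu>)" (is ?AE)
    and "cont_semigroup \<mu> u t (\<lambda>_. 1 :: complex) x = complex_of_real (cont_semigroup \<mu> u t (\<lambda>_. 1) x)"
proof -
  note one = one_in_unit_ball(1)[of \<mu>]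
  have "kernel_defined_on \<mu> (u t) (Lp \<mu> \<top>)" using feller t by (simp add: strong_feller_def)
  then have int: "AE x in \<mu>. integrable \<mu> (\<lambda>y. u t x y *\<^sub>R (1 :: complex))"
    unfolding kernel_defined_on_def by (rule bspec[OF _ one])
  have "\<exists>g\<in>bcontfun. AE x in \<mu>. g x = kernel_semigroup \<mu> u t (\<lambda>_. 1 :: complex) x"
    using feller t one unfolding strong_feller_def by simp
  then obtain g where g: "g \<in> bcontfun" "AE x in \<mu>. g x = kernel_semigroup \<mu> u t (\<lambda>_. 1 :: complex) x"
    by (elim bexE)
  have AE: "AE x in \<mu>. integrable \<mu> (u t x) \<and> g x = complex_of_real (\<integral>y. u t x y \<partial>\<mu>)"
    using g(2) int
  proof eventually_elim
    case (elim x)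
    have "integrable \<mu> (u t x)"
      using integrable_Re[OF elim(2)] by (simp add: scaleR_conv_of_real)
    then show ?case
      using elim(1) t by (simp add: kernel_semigroup_def kernel_operator_def scaleR_conv_of_real)
  qed
  define G where "G = (\<lambda>x. Re (g x))"
  have G: "G \<in> bcontfun" unfolding G_def by (rule bcontfun_compose_linear[OF g(1) bounded_linear_Re])
  have "AE x in \<mu>. G x = kernel_semigroup \<mu> u t (\<lambda>_. 1) x"
    using AE by eventually_elim
      (use t in \<open>simp add: G_def kernel_semigroup_def kernel_operator_def\<close>)
  from cont_version_eq[OF assms(1,2) G this]
  have eqG: "cont_semigroup \<mu> u t (\<lambda>_. 1) = G" by (simp add: cont_semigroup_def)
  show ?bc using G eqG by simp
  show ?AE using AE unfolding eqG by eventually_elim (simp add: G_def)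
  have cG: "(\<lambda>x. complex_of_real (G x)) \<in> bcontfun"
    by (rule bcontfun_compose_linear[OF G bounded_linear_of_real])
  have "AE x in \<mu>. complex_of_real (G x) = kernel_semigroup \<mu> u t (\<lambda>_. 1) x"
    using AE g(2)
  proof eventually_elim
    case (elim x)
    then show ?case unfolding elim(2)[symmetric] by (simp add: G_def)
  qed
  from cont_version_eq[OF assms(1,2) cG this]
  have "cont_semigroup \<mu> u t (\<lambda>_. 1 :: complex) = (\<lambda>x. complex_of_real (G x))"
    by (simp add: cont_semigroup_def)
  then show "cont_semigroup \<mu> u t (\<lambda>_. 1 :: complex) x = complex_of_real (cont_semigroup \<mu> u t (\<lambda>_. 1) x)"
    unfolding eqG by simp
qed
definition normalized_kernel :: "real \<Rightarrow> (real \<Rightarrow> 'a \<Rightarrow> 'a \<Rightarrow> real) \<Rightarrow> real \<Rightarrow> 'a \<Rightarrow> 'a \<Rightarrow> real" where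
  "normalized_kernel lam u = (\<lambda>t x y. exp (lam * t) * u t x y)"

lemma nn_kernel_one_version:
  fixes \<mu> :: "'a::topological_space measure"
  assumes "sets \<mu> = sets borel" "measure_support \<mu> = UNIV" "strong_feller \<mu> u" "0 < t"
    and nonneg: "AE x in \<mu>. AE y in \<mu>. 0 \<le> u t x y"
  shows "AE x in \<mu>. 0 \<le> cont_semigroup \<mu> u t (\<lambda>_. 1 :: real) x \<and>
    nn_kernel \<mu> (normalized_kernel lam u t) (\<lambda>_. 1) x = ennreal (exp (lam * t) * cont_semigroup \<mu> u t (\<lambda>_. 1) x)"
  using strong_feller_one(2)[OF assms(1-4)] nonneg
proof eventually_elim
  case (elim x)
  have "nn_kernel \<mu> (normalized_kernel lam u t) (\<lambda>_. 1) x = (\<integral>\<^sup>+y. ennreal (exp (lam * t) * u t x y) \<partial>\<mu>)"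
    by (simp add: nn_kernel_def normalized_kernel_def)
  also have "\<dots> = ennreal (\<integral>y. exp (lam * t) * u t x y \<partial>\<mu>)"
    using elim by (intro nn_integral_eq_integral) (auto elim!: eventually_mono)
  also have "(\<integral>y. exp (lam * t) * u t x y \<partial>\<mu>) = exp (lam * t) * cont_semigroup \<mu> u t (\<lambda>_. 1) x"
    using elim by simp
  finally show ?case using elim by (simp add: integral_nonneg_AE)
qed

text \<open>For \<open>lam = 0\<close> this is a bound for the kernel \<open>u\<close> itself.\<close>

lemma strong_feller_bounded:
  fixes \<mu> :: "'a::topological_space measure"
  assumes "sets \<mu> = sets borel" "measure_support \<mu> = UNIV" "strong_feller \<mu> u" "0 < t"
    and "AE x in \<mu>. AE y in \<mu>. 0 \<le> u t x y"
  shows "\<exists>N::real. AE x in \<mu>. nn_kernel \<mu> (normalized_kernel lam u t) (\<lambda>_. 1) x \<le> ennreal N"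
proof -
  let ?G = "cont_semigroup \<mu> u t (\<lambda>_. 1) :: 'a \<Rightarrow> real"
  obtain N where N: "\<And>x. norm (?G x) \<le> N"
    using strong_feller_one(1)[OF assms(1-4)] by (auto simp: bcontfun_def bounded_iff)
  have "AE x in \<mu>. nn_kernel \<mu> (normalized_kernel lam u t) (\<lambda>_. 1) x \<le> ennreal (exp (lam * t) * N)"
    using nn_kernel_one_version[OF assms, of lam]
  proof eventually_elim
    case (elim x)
    then show ?case using N[of x] by (simp add: ennreal_leI)
  qed
  then show ?thesis by blast
qed

lemma integrable_bcontfun:
  fixes f :: "'a::topological_space \<Rightarrow> 'b::{banach, second_countable_topology}"
  assumes "sets \<sigma> = sets borel" "finite_measure \<sigma>" "f \<in> bcontfun"
  shows "integrable \<sigma> f"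
proof -
  have f: "continuous_on UNIV f" "bounded (range f)" using assms(3) by (simp_all add: bcontfun_def)
  obtain B where "\<And>x. norm (f x) \<le> B" using f(2) by (auto simp: bounded_iff)
  moreover have "f \<in> borel_measurable \<sigma>"
    using borel_measurable_continuous_onI[OF f(1)] measurable_cong_sets[OF assms(1) refl] by blast
  ultimately show ?thesis using assms(2) by (intro finite_measure.integrable_const_bound[of _ _ B]) auto
qed

lemma positive_integral_of_support:
  fixes \<phi> :: "'a::topological_space \<Rightarrow> real"
  assumes \<sigma>: "sets \<sigma> = sets borel" and int: "integrable \<sigma> \<phi>" and cont: "continuous_on UNIV \<phi>"
    and nonneg: "\<And>x. 0 \<le> \<phi> x" and x: "x \<in> measure_support \<sigma>" "\<phi> x \<noteq> 0"
  shows "0 < (\<integral>x. \<phi> x \<partial>\<sigma>)"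
proof (rule ccontr)
  assume "\<not> ?thesis"
  moreover have "0 \<le> (\<integral>x. \<phi> x \<partial>\<sigma>)" by (intro integral_nonneg_AE) (simp add: nonneg)
  ultimately have "(\<integral>x. \<phi> x \<partial>\<sigma>) = 0" by simp
  then have AE: "AE x in \<sigma>. \<phi> x = 0"
    using int nonneg by (simp add: integral_nonneg_eq_0_iff_AE)
  let ?V = "{x. 0 < \<phi> x}"
  have V: "open ?V" by (intro open_Collect_less cont continuous_on_const)
  have "AE x in \<sigma>. x \<notin> ?V" using AE by eventually_elim simp
  moreover have "?V \<in> sets \<sigma>" using V \<sigma> by simp
  ultimately have "emeasure \<sigma> ?V = 0" by (simp add: AE_iff_null_sets null_setsD1)
  moreover have "x \<in> ?V" using nonneg[of x] x(2) by simp
  ultimately show False using x(1) V unfolding measure_support_def by force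
qed

text \<open>Write \<open>S\<close> for the integral of \<open>\<phi>\<close>. The numerator is \<open>S \<alpha>\<close> and the denominator \<open>S \<beta>\<close> up to errors
\<open>\<delta> S\<close>, and the denominator is at least \<open>S / B\<close>. The factor \<open>S\<close> therefore cancels, and the bound
does not depend on \<open>\<sigma>\<close>.\<close>

lemma integral_ratio_estimate:
  fixes V :: "'a \<Rightarrow> complex" and W \<phi> :: "'a \<Rightarrow> real" and \<alpha> :: complex
  assumes int: "integrable \<sigma> V" "integrable \<sigma> W" "integrable \<sigma> \<phi>"
    and V: "AE x in \<sigma>. norm (V x - \<phi> x *\<^sub>R \<alpha>) \<le> \<delta> * \<phi> x"
    and W: "AE x in \<sigma>. \<bar>W x - \<phi> x * \<beta>\<bar> \<le> \<delta> * \<phi> x"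
    and lower: "AE x in \<sigma>. \<phi> x \<le> B * W x"
    and pos: "0 < (\<integral>x. \<phi> x \<partial>\<sigma>)" "0 < B" "0 < \<beta>" "0 \<le> \<delta>"
  shows "norm ((\<integral>x. V x \<partial>\<sigma>) / complex_of_real (\<integral>x. W x \<partial>\<sigma>) - \<alpha> / complex_of_real \<beta>)
    \<le> B * \<delta> * (1 + norm (\<alpha> / complex_of_real \<beta>))"
proof -
  define S where "S = (\<integral>x. \<phi> x \<partial>\<sigma>)"
  define I where "I = (\<integral>x. V x \<partial>\<sigma>)"
  define J where "J = (\<integral>x. W x \<partial>\<sigma>)"
  define q where "q = \<alpha> / complex_of_real \<beta>"
  have S: "0 < S" using pos by (simp add: S_def)
  have "norm (I - S *\<^sub>R \<alpha>) = norm (\<integral>x. V x - \<phi> x *\<^sub>R \<alpha> \<partial>\<sigma>)"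
    using int by (simp add: I_def S_def)
  also have "\<dots> \<le> (\<integral>x. norm (V x - \<phi> x *\<^sub>R \<alpha>) \<partial>\<sigma>)" by (rule integral_norm_bound)
  also have "\<dots> \<le> (\<integral>x. \<delta> * \<phi> x \<partial>\<sigma>)"
    using int V by (intro integral_mono_AE integrable_norm Bochner_Integration.integrable_diff) auto
  finally have 1: "norm (I - S *\<^sub>R \<alpha>) \<le> \<delta> * S" by (simp add: S_def)
  have "\<bar>J - S * \<beta>\<bar> = \<bar>\<integral>x. W x - \<phi> x * \<beta> \<partial>\<sigma>\<bar>"
    using int by (simp add: J_def S_def)
  also have "\<dots> \<le> (\<integral>x. \<bar>W x - \<phi> x * \<beta>\<bar> \<partial>\<sigma>)" by (rule integral_abs_bound)
  also have "\<dots> \<le> (\<integral>x. \<delta> * \<phi> x \<partial>\<sigma>)"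
    using int W by (intro integral_mono_AE integrable_abs Bochner_Integration.integrable_diff) auto
  finally have 2: "\<bar>J - S * \<beta>\<bar> \<le> \<delta> * S" by (simp add: S_def)
  have "S \<le> (\<integral>x. B * W x \<partial>\<sigma>)"
    unfolding S_def using int lower by (intro integral_mono_AE) auto
  then have SJ: "S \<le> B * J" by (simp add: J_def)
  then have J: "0 < J" using S pos(2) by (metis less_le_trans zero_less_mult_pos)
  have "I - q * complex_of_real J = (I - S *\<^sub>R \<alpha>) - q * complex_of_real (J - S * \<beta>)"
    using pos(3) by (simp add: q_def scaleR_conv_of_real algebra_simps)
  then have "norm (I - q * complex_of_real J)
      \<le> norm (I - S *\<^sub>R \<alpha>) + norm (q * complex_of_real (J - S * \<beta>))"
    by (metis norm_triangle_ineq4)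
  also have "norm (q * complex_of_real (J - S * \<beta>)) = norm q * \<bar>J - S * \<beta>\<bar>"
    by (simp only: norm_mult norm_of_real)
  also have "norm (I - S *\<^sub>R \<alpha>) + norm q * \<bar>J - S * \<beta>\<bar> \<le> \<delta> * S + norm q * (\<delta> * S)"
    by (intro add_mono mult_left_mono 1 2) simp
  also have "\<dots> = \<delta> * (1 + norm q) * S" by (simp add: algebra_simps)
  also have "\<dots> \<le> \<delta> * (1 + norm q) * (B * J)"
    using SJ pos(4) by (intro mult_left_mono) auto
  finally have "norm (I - q * complex_of_real J) / J \<le> B * \<delta> * (1 + norm q)"
    using J by (simp add: field_simps)
  moreover have "I / complex_of_real J - q = (I - q * complex_of_real J) / complex_of_real J"
    using J by (simp add: field_simps)
  ultimately show ?thesis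
    using J by (simp add: norm_divide I_def J_def q_def)
qed

section \<open>The quasi-ergodic estimate\<close>

text \<open>The pair of dominated kernels together with continuous versions. Here \<open>u\<close> is the given kernel,
and its multiple by \<open>exp (lam t)\<close> is the normalized one. Since the sets \<open>K\<^sub>t\<close> are proper, suprema
over their complements are suprema of nonempty sets.\<close>

locale feller_ground_state_pair = dominated_kernel_pair \<mu> "normalized_kernel lam u" \<phi> \<psi> \<Lambda> \<gamma> t\<^sub>0 K
  for \<mu> :: "'a::polish_space measure" and lam u \<phi> \<psi> \<Lambda> \<gamma> t\<^sub>0 K +
  assumes borel_sets: "sets \<mu> = sets borel" and full_support: "measure_support \<mu> = UNIV"
    and feller: "strong_feller \<mu> u"
    and phi_bcontfun: "\<phi> \<in> bcontfun" and psi_bcontfun: "\<psi> \<in> bcontfun"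
    and pgsd: "pGSD \<mu> u lam \<phi> t\<^sub>0 K"
    and K_proper: "\<And>t. t\<^sub>0 \<le> t \<Longrightarrow> K t \<noteq> UNIV"
begin

abbreviation survival :: "real \<Rightarrow> 'a \<Rightarrow> real" where
  "survival t \<equiv> cont_semigroup \<mu> u t (\<lambda>_. 1)"

lemma u_measurable:
  assumes "0 < t"
  shows "case_prod (u t) \<in> borel_measurable (\<mu> \<Otimes>\<^sub>M \<mu>)"
proof -
  have [measurable]: "case_prod (normalized_kernel lam u t) \<in> borel_measurable (\<mu> \<Otimes>\<^sub>M \<mu>)"
    using kernel_measurable assms .
  have "case_prod (u t) = (\<lambda>(x, y). exp (- (lam * t)) * normalized_kernel lam u t x y)"
    by (auto simp: normalized_kernel_def mult.assoc[symmetric] exp_add[symmetric])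
  also have "\<dots> \<in> borel_measurable (\<mu> \<Otimes>\<^sub>M \<mu>)" by measurable
  finally show ?thesis .
qed

lemmas continuous_le = continuous_le_of_AE_le[OF borel_sets full_support]

lemma survival_bcontfun: "0 < t \<Longrightarrow> survival t \<in> bcontfun"
  using strong_feller_one(1)[OF borel_sets full_support feller] .

lemma survival_continuous: "0 < t \<Longrightarrow> continuous_on UNIV (survival t)"
  using survival_bcontfun by (simp add: bcontfun_def)

lemma phi_continuous: "continuous_on UNIV \<phi>"
  using phi_bcontfun by (simp add: bcontfun_def)

lemma nn_kernel_one:
  assumes t: "0 < t"
  shows "AE x in \<mu>. 0 \<le> survival t x \<and>
    nn_kernel \<mu> (normalized_kernel lam u t) (\<lambda>_. 1) x = ennreal (exp (lam * t) * survival t x)"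
proof (rule nn_kernel_one_version[OF borel_sets full_support feller t])
  show "AE x in \<mu>. AE y in \<mu>. 0 \<le> u t x y"
    using kernel_AE[OF t] by (simp add: normalized_kernel_def zero_le_mult_iff)
qed

lemma survival_nonneg: "0 < t \<Longrightarrow> 0 \<le> survival t x"
  by (rule continuous_le[of "\<lambda>_. 0"])
    (auto simp: survival_continuous intro: eventually_mono[OF nn_kernel_one])

lemma phi_nonneg: "0 \<le> \<phi> x"
proof -
  obtain B where "AE x in \<mu>. 0 < \<phi> x \<and> \<phi> x \<le> B" using phi_bounds by blast
  then have "AE x in \<mu>. 0 \<le> \<phi> x" by eventually_elim simp
  then show ?thesis using phi_continuous by (intro continuous_le[of "\<lambda>_. 0"]) auto
qed

text \<open>Monotonicity of \<open>P\<^sub>t\<close> applied to \<open>\<phi> \<le> B\<close>, with invariance on the left-hand side.\<close>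

lemma phi_le_survival: "\<exists>B>0. \<forall>t>0. \<forall>x. \<phi> x \<le> B * (exp (lam * t) * survival t x)"
proof -
  obtain B where phi: "AE x in \<mu>. 0 < \<phi> x \<and> \<phi> x \<le> B" using phi_bounds by blast
  then have "AE x in \<mu>. 0 < B" by eventually_elim simp
  then have B: "0 < B" by (rule AE_const_imp)
  have "\<phi> x \<le> B * (exp (lam * t) * survival t x)" if t: "0 < t" for t x
  proof (rule continuous_le[of \<phi>])
    have le: "AE y in \<mu>. ennreal (\<phi> y) \<le> ennreal B"
      using phi by eventually_elim (simp add: ennreal_leI)
    show "AE x in \<mu>. \<phi> x \<le> B * (exp (lam * t) * survival t x)"
      using nn_kernel_le_const[OF t le] phi_invariant[OF t] nn_kernel_one[OF t]
    proof eventually_elim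
      case (elim x)
      have "ennreal (\<phi> x) \<le> ennreal B * ennreal (exp (lam * t) * survival t x)"
        using elim by simp
      also have "\<dots> = ennreal (B * (exp (lam * t) * survival t x))"
        using B elim by (simp add: ennreal_mult)
      finally show ?case using B elim by (simp add: ennreal_le_iff)
    qed
  qed (auto intro!: continuous_intros phi_continuous survival_continuous t)
  then show ?thesis using B by blast
qed

text \<open>Split \<open>t = r + s\<close> with \<open>s\<close> still beyond \<open>2 t\<^sub>0\<close>. The first step maps \<open>f\<close> to a bounded function, to
which the strong Feller property at time \<open>r\<close> applies.\<close>

lemma continuous_version_Lp:
  fixes f :: "'a \<Rightarrow> complex"
  assumes t: "2 * t\<^sub>0 < t" and f: "f \<in> Lp \<mu> p" "Lp_norm \<mu> p f \<le> 1" and p: "1 \<le> p"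
  shows "cont_semigroup \<mu> u t f \<in> bcontfun"
    and "AE x in \<mu>. cont_semigroup \<mu> u t f x = (\<integral>y. u t x y *\<^sub>R f y \<partial>\<mu>)"
proof -
  define s where "s = (t + 2 * t\<^sub>0) / 2"
  define r where "r = t - s"
  have rs: "2 * t\<^sub>0 < s" "0 < s" "0 < r" "r + s = t" "0 < t"
    using t t0_pos by (simp_all add: s_def r_def field_simps)
  have fm [measurable]: "f \<in> borel_measurable \<mu>" using f(1) by (simp add: Lp_def)
  have [measurable]: "case_prod (u s) \<in> borel_measurable (\<mu> \<Otimes>\<^sub>M \<mu>)" using u_measurable rs(2) .
  obtain h where h: "h \<in> borel_measurable \<mu>" "AE y in \<mu>. ennreal (norm (f y)) \<le> 1 + h y"
    "(\<integral>\<^sup>+y. h y \<partial>\<mu>) \<le> 1"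
    using Lp_unit_ball_split[OF f p] .
  have "(\<lambda>y. ennreal (norm (f y))) \<in> borel_measurable \<mu>" by measurable
  from kernel_Lp_bounded[OF rs(1) this h]
  obtain N where N: "0 \<le> N"
    "AE z in \<mu>. nn_kernel \<mu> (normalized_kernel lam u s) (\<lambda>y. ennreal (norm (f y))) z \<le> ennreal N"
    by blast
  define g where "g = (\<lambda>z. \<integral>y. u s z y *\<^sub>R f y \<partial>\<mu>)"
  have gm: "g \<in> borel_measurable \<mu>" unfolding g_def by measurable
  have "AE z in \<mu>. ennreal (norm (g z)) \<le> ennreal (exp (- (lam * s)) * N)"
    using N(2) kernel_AE[OF rs(2)]
  proof eventually_elim
    case (elim z)
    show ?case
    proof (cases "integrable \<mu> (\<lambda>y. u s z y *\<^sub>R f y)")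
      case True
      have "ennreal (exp (lam * s) * norm (g z)) = ennreal (norm (\<integral>y. normalized_kernel lam u s z y *\<^sub>R f y \<partial>\<mu>))"
        by (simp add: g_def normalized_kernel_def flip: scaleR_scaleR)
      also have "\<dots> \<le> (\<integral>\<^sup>+y. ennreal (norm (normalized_kernel lam u s z y *\<^sub>R f y)) \<partial>\<mu>)"
        using True by (intro integral_norm_bound_ennreal) (simp add: normalized_kernel_def flip: scaleR_scaleR)
      also have "\<dots> = nn_kernel \<mu> (normalized_kernel lam u s) (\<lambda>y. ennreal (norm (f y))) z"
        unfolding nn_kernel_def
      proof (rule nn_integral_cong_AE)
        show "AE y in \<mu>. ennreal (norm (normalized_kernel lam u s z y *\<^sub>R f y))
            = ennreal (normalized_kernel lam u s z y) * ennreal (norm (f y))"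
          using elim(2) by eventually_elim (simp add: ennreal_mult)
      qed
      also have "\<dots> \<le> ennreal N" by (rule elim(1))
      finally have "exp (lam * s) * norm (g z) \<le> N" using N(1) by (simp add: ennreal_le_iff)
      then show ?thesis by (intro ennreal_leI) (simp add: exp_minus field_simps)
    qed (use N(1) in \<open>simp add: g_def not_integrable_integral_eq\<close>)
  qed
  then have "esssup \<mu> (\<lambda>z. ennreal (norm (g z))) \<le> ennreal (exp (- (lam * s)) * N)"
    using gm by (intro esssup_I) auto
  then have "esssup \<mu> (\<lambda>z. ennreal (norm (g z))) < \<top>"
    by (rule le_less_trans) simp
  then have gL: "g \<in> Lp \<mu> \<top>" using gm by (simp add: Lp_def)
  have "\<exists>F\<in>bcontfun. AE x in \<mu>. F x = kernel_semigroup \<mu> u r g x"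
    using feller rs(3) gL unfolding strong_feller_def by simp
  then obtain F where F: "F \<in> bcontfun" "AE x in \<mu>. F x = kernel_semigroup \<mu> u r g x"
    by (elim bexE)
  have F_eq: "AE x in \<mu>. F x = (\<integral>y. u t x y *\<^sub>R f y \<partial>\<mu>)"
    using F(2) kernel_compose[OF rs(3,2) fm N(2)]
  proof eventually_elim
    case (elim x)
    have "exp (lam * t) *\<^sub>R (\<integral>y. u t x y *\<^sub>R f y \<partial>\<mu>)
        = (\<integral>y. normalized_kernel lam u (r + s) x y *\<^sub>R f y \<partial>\<mu>)"
      unfolding rs(4) by (simp add: normalized_kernel_def flip: scaleR_scaleR)
    also have "\<dots> = (\<integral>z. normalized_kernel lam u r x z *\<^sub>R (\<integral>y. normalized_kernel lam u s z y *\<^sub>R f y \<partial>\<mu>) \<partial>\<mu>)"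
      using elim(2) by blast
    also have "\<dots> = (\<integral>z. exp (lam * t) *\<^sub>R (u r x z *\<^sub>R g z) \<partial>\<mu>)"
    proof (rule Bochner_Integration.integral_cong)
      fix z
      have "(\<integral>y. normalized_kernel lam u s z y *\<^sub>R f y \<partial>\<mu>) = exp (lam * s) *\<^sub>R g z"
        by (simp add: g_def normalized_kernel_def flip: scaleR_scaleR)
      then show "normalized_kernel lam u r x z *\<^sub>R (\<integral>y. normalized_kernel lam u s z y *\<^sub>R f y \<partial>\<mu>)
          = exp (lam * t) *\<^sub>R (u r x z *\<^sub>R g z)"
        unfolding rs(4)[symmetric]
        by (simp add: normalized_kernel_def exp_add[symmetric] algebra_simps)
    qed simp
    also have "\<dots> = exp (lam * t) *\<^sub>R F x"
      using elim(1) rs(3) by (simp add: kernel_semigroup_def kernel_operator_def del: scaleR_scaleR)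
    finally show ?case by simp
  qed
  then have "AE x in \<mu>. F x = kernel_semigroup \<mu> u t f x"
    by eventually_elim (use rs(5) in \<open>simp add: kernel_semigroup_def kernel_operator_def\<close>)
  from cont_version_eq[OF borel_sets full_support F(1) this]
  have eq: "cont_semigroup \<mu> u t f = F" by (simp add: cont_semigroup_def)
  show "cont_semigroup \<mu> u t f \<in> bcontfun" using F(1) eq by simp
  show "AE x in \<mu>. cont_semigroup \<mu> u t f x = (\<integral>y. u t x y *\<^sub>R f y \<partial>\<mu>)" using F_eq eq by simp
qed

text \<open>The almost everywhere estimate compares continuous functions, so it holds at every point; this
is what allows integration against an arbitrary \<open>\<sigma>\<close>.\<close>

lemma pointwise_estimate:
  "\<exists>C>0. \<forall>s>3 * t\<^sub>0. \<forall>r>0. \<forall>\<epsilon>\<ge>0. \<forall>p\<ge>1. \<forall>f::'a \<Rightarrow> complex. \<forall>x.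
    f \<in> Lp \<mu> p \<longrightarrow> Lp_norm \<mu> p f \<le> 1 \<longrightarrow> (\<forall>z. z \<notin> K s \<longrightarrow> exp (lam * t\<^sub>0) * survival t\<^sub>0 z \<le> \<epsilon>) \<longrightarrow>
    norm (exp (lam * (r + (s + s))) *\<^sub>R cont_semigroup \<mu> u (r + (s + s)) f x
        - \<phi> x *\<^sub>R ((1 / \<Lambda>) *\<^sub>R (\<integral>y. \<psi> y *\<^sub>R f y \<partial>\<mu>)))
      \<le> C * (exp (- \<gamma> * s) + \<epsilon>) * (exp (lam * r) * survival r x)"
proof -
  obtain C where C: "0 < C" "\<And>s r \<epsilon> h (f :: 'a \<Rightarrow> complex). 3 * t\<^sub>0 < s \<Longrightarrow> 0 < r \<Longrightarrow> 0 \<le> \<epsilon> \<Longrightarrow>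
      f \<in> borel_measurable \<mu> \<Longrightarrow> h \<in> borel_measurable \<mu> \<Longrightarrow>
      AE z in \<mu>. z \<notin> K s \<longrightarrow> nn_kernel \<mu> (normalized_kernel lam u t\<^sub>0) (\<lambda>_. 1) z \<le> ennreal \<epsilon> \<Longrightarrow>
      AE y in \<mu>. ennreal (norm (f y)) \<le> 1 + h y \<Longrightarrow> (\<integral>\<^sup>+y. h y \<partial>\<mu>) \<le> 1 \<Longrightarrow>
      AE x in \<mu>. ennreal (norm ((\<integral>y. normalized_kernel lam u (r + (s + s)) x y *\<^sub>R f y \<partial>\<mu>)
          - (\<phi> x / \<Lambda>) *\<^sub>R (\<integral>y. \<psi> y *\<^sub>R f y \<partial>\<mu>)))
       \<le> ennreal (C * (exp (- \<gamma> * s) + \<epsilon>)) * nn_kernel \<mu> (normalized_kernel lam u r) (\<lambda>_. 1) x"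
    using kernel_Lp_estimate by blast
  have "norm (exp (lam * (r + (s + s))) *\<^sub>R cont_semigroup \<mu> u (r + (s + s)) f x
        - \<phi> x *\<^sub>R ((1 / \<Lambda>) *\<^sub>R (\<integral>y. \<psi> y *\<^sub>R f y \<partial>\<mu>)))
      \<le> C * (exp (- \<gamma> * s) + \<epsilon>) * (exp (lam * r) * survival r x)"
    if s: "3 * t\<^sub>0 < s" and r: "0 < r" and eps: "0 \<le> \<epsilon>" and p: "1 \<le> p"
      and f: "f \<in> Lp \<mu> p" "Lp_norm \<mu> p f \<le> 1"
      and tail: "\<forall>z. z \<notin> K s \<longrightarrow> exp (lam * t\<^sub>0) * survival t\<^sub>0 z \<le> \<epsilon>"
    for s r \<epsilon> p x and f :: "'a \<Rightarrow> complex"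
  proof -
    define t where "t = r + (s + s)"
    define I where "I = (\<integral>y. \<psi> y *\<^sub>R f y \<partial>\<mu>)"
    define D where "D = C * (exp (- \<gamma> * s) + \<epsilon>)"
    have D: "0 \<le> D" using C(1) eps by (simp add: D_def)
    have t: "2 * t\<^sub>0 < t" using s r t0_pos by (simp add: t_def)
    note F = continuous_version_Lp[OF t f p]
    have fm: "f \<in> borel_measurable \<mu>" using f(1) by (simp add: Lp_def)
    obtain h where h: "h \<in> borel_measurable \<mu>" "AE y in \<mu>. ennreal (norm (f y)) \<le> 1 + h y"
      "(\<integral>\<^sup>+y. h y \<partial>\<mu>) \<le> 1"
      using Lp_unit_ball_split[OF f p] .
    have "AE z in \<mu>. z \<notin> K s \<longrightarrow> nn_kernel \<mu> (normalized_kernel lam u t\<^sub>0) (\<lambda>_. 1) z \<le> ennreal \<epsilon>"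
      using nn_kernel_one[OF t0_pos]
    proof eventually_elim
      case (elim z)
      then show ?case using tail by (auto intro: ennreal_leI)
    qed
    from C(2)[OF s r eps fm h(1) this h(2,3)] F(2) nn_kernel_one[OF r]
    have AE: "AE x in \<mu>. norm (exp (lam * t) *\<^sub>R cont_semigroup \<mu> u t f x - \<phi> x *\<^sub>R ((1 / \<Lambda>) *\<^sub>R I))
        \<le> D * (exp (lam * r) * survival r x)"
      unfolding t_def[symmetric] I_def[symmetric] D_def[symmetric]
    proof eventually_elim
      case (elim x)
      have "(\<integral>y. normalized_kernel lam u t x y *\<^sub>R f y \<partial>\<mu>) = exp (lam * t) *\<^sub>R cont_semigroup \<mu> u t f x"
        unfolding elim(2) by (simp add: normalized_kernel_def flip: scaleR_scaleR)
      moreover have "(\<phi> x / \<Lambda>) *\<^sub>R I = \<phi> x *\<^sub>R ((1 / \<Lambda>) *\<^sub>R I)" by simp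
      ultimately have "ennreal (norm (exp (lam * t) *\<^sub>R cont_semigroup \<mu> u t f x - \<phi> x *\<^sub>R ((1 / \<Lambda>) *\<^sub>R I)))
          \<le> ennreal D * ennreal (exp (lam * r) * survival r x)"
        using elim(1,3) by metis
      also have "\<dots> = ennreal (D * (exp (lam * r) * survival r x))"
        using D elim(3) by (simp add: ennreal_mult)
      finally show ?case using D elim(3) by (simp add: ennreal_le_iff)
    qed
    have cF: "continuous_on UNIV (cont_semigroup \<mu> u t f)" using F(1) by (simp add: bcontfun_def)
    have "norm (exp (lam * t) *\<^sub>R cont_semigroup \<mu> u t f x - \<phi> x *\<^sub>R ((1 / \<Lambda>) *\<^sub>R I))
        \<le> D * (exp (lam * r) * survival r x)"
      by (rule continuous_le[OF _ _ AE])
        (intro continuous_intros cF phi_continuous survival_continuous r)+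
    then show ?thesis unfolding t_def I_def D_def .
  qed
  then show ?thesis using C(1) by (intro exI[of _ C]) blast
qed

end

context feller_ground_state_pair
begin

definition tail_sup :: "real \<Rightarrow> real" where
  "tail_sup s = (SUP x\<in>- K s. survival t\<^sub>0 x)"

lemma survival_le_tail_sup: "z \<notin> K s \<Longrightarrow> survival t\<^sub>0 z \<le> tail_sup s"
proof -
  assume z: "z \<notin> K s"
  have "bounded (range (survival t\<^sub>0))" using survival_bcontfun[OF t0_pos] by (simp add: bcontfun_def)
  then have "bdd_above (survival t\<^sub>0 ` (- K s))"
    by (intro bounded_imp_bdd_above) (rule bounded_subset, auto)
  then show ?thesis unfolding tail_sup_def using z by (intro cSUP_upper) auto
qed

lemma tail_sup_nonneg: "t\<^sub>0 \<le> s \<Longrightarrow> 0 \<le> tail_sup s"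
proof -
  assume "t\<^sub>0 \<le> s"
  then obtain z where "z \<notin> K s" using K_proper by blast
  from survival_nonneg[OF t0_pos, of z] survival_le_tail_sup[OF this] show ?thesis by linarith
qed

lemma psi_integrable: "integrable \<mu> \<psi>" "0 < (\<integral>y. \<psi> y \<partial>\<mu>)" "AE y in \<mu>. 0 < \<psi> y"
proof -
  obtain B where "AE x in \<mu>. 0 < \<psi> x \<and> \<psi> x \<le> B" using psi_bounds by blast
  then show pos: "AE y in \<mu>. 0 < \<psi> y" by eventually_elim simp
  then have nonneg: "AE y in \<mu>. 0 \<le> \<psi> y" by eventually_elim simp
  show int: "integrable \<mu> \<psi>" using psi_integral_finite nonneg by (intro integrableI_nonneg) auto
  have "(\<integral>y. \<psi> y \<partial>\<mu>) \<noteq> 0"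
  proof
    assume "(\<integral>y. \<psi> y \<partial>\<mu>) = 0"
    then have "AE y in \<mu>. \<psi> y = 0" using int nonneg by (simp add: integral_nonneg_eq_0_iff_AE)
    with pos have "AE y in \<mu>. False" by eventually_elim simp
    then show False by (rule AE_const_imp)
  qed
  moreover have "0 \<le> (\<integral>y. \<psi> y \<partial>\<mu>)" using nonneg by (rule integral_nonneg_AE)
  ultimately show "0 < (\<integral>y. \<psi> y \<partial>\<mu>)" by simp
qed

text \<open>The value that the quotients approach, as a quotient of integrals against \<open>\<psi>\<close>.\<close>

lemma integral_normalized_density:
  fixes f :: "'a \<Rightarrow> complex"
  assumes [measurable]: "f \<in> borel_measurable \<mu>"
  shows "(\<integral>x. f x \<partial>normalized_density \<mu> \<psi>) = (\<integral>y. \<psi> y *\<^sub>R f y \<partial>\<mu>) / complex_of_real (\<integral>y. \<psi> y \<partial>\<mu>)"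
proof -
  have "(\<integral>x. f x \<partial>normalized_density \<mu> \<psi>) = (\<integral>x. (\<psi> x / (\<integral>y. \<psi> y \<partial>\<mu>)) *\<^sub>R f x \<partial>\<mu>)"
    unfolding normalized_density_def
  proof (rule integral_density)
    show "AE x in \<mu>. 0 \<le> \<psi> x / (\<integral>y. \<psi> y \<partial>\<mu>)"
      using psi_integrable(3) by eventually_elim (use psi_integrable(2) in simp)
  qed measurable
  also have "\<dots> = (\<integral>x. (1 / (\<integral>y. \<psi> y \<partial>\<mu>)) *\<^sub>R (\<psi> x *\<^sub>R f x) \<partial>\<mu>)" by simp
  also have "\<dots> = (1 / (\<integral>y. \<psi> y \<partial>\<mu>)) *\<^sub>R (\<integral>x. \<psi> x *\<^sub>R f x \<partial>\<mu>)" by (rule integral_scaleR_right)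
  finally show ?thesis by (simp add: scaleR_conv_of_real)
qed

text \<open>The pointwise estimate with \<open>r = a t\<close> and \<open>s = b t\<close>, combined with domination at time \<open>r\<close>, holds
on \<open>K\<^sub>r\<close> both for \<open>f\<close> and for the constant \<open>1\<close>, with the same error \<open>\<delta> \<phi>\<close>. Then the quotient is
compared by \<open>integral_ratio_estimate\<close>. The support condition makes the integral of \<open>\<phi>\<close> against
\<open>\<sigma>\<close> positive.\<close>

theorem quasi_ergodic_bound:
  assumes ab: "0 < a" "0 < b" "a + 2 * b = 1" and p: "1 \<le> p" and Z: "{x. \<phi> x = 0} \<subseteq> Z"
  shows "\<exists>C>0. \<forall>t>4 / min a b * t\<^sub>0.
    quasi_ergodic_error \<mu> u t p (admissible_measures (K (a * t)) Z) (normalized_density \<mu> \<psi>)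
      \<le> ennreal (C * (exp (- \<gamma> * b * t) + tail_sup (b * t)))"
proof -
  obtain C where C: "0 < C" "\<forall>s>3 * t\<^sub>0. \<forall>r>0. \<forall>\<epsilon>\<ge>0. \<forall>p\<ge>1. \<forall>f::'a \<Rightarrow> complex. \<forall>x.
      f \<in> Lp \<mu> p \<longrightarrow> Lp_norm \<mu> p f \<le> 1 \<longrightarrow> (\<forall>z. z \<notin> K s \<longrightarrow> exp (lam * t\<^sub>0) * survival t\<^sub>0 z \<le> \<epsilon>) \<longrightarrow>
      norm (exp (lam * (r + (s + s))) *\<^sub>R cont_semigroup \<mu> u (r + (s + s)) f x
          - \<phi> x *\<^sub>R ((1 / \<Lambda>) *\<^sub>R (\<integral>y. \<psi> y *\<^sub>R f y \<partial>\<mu>)))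
        \<le> C * (exp (- \<gamma> * s) + \<epsilon>) * (exp (lam * r) * survival r x)"
    using pointwise_estimate by (elim exE conjE)
  obtain Cp where Cp: "0 < Cp"
      "\<forall>t\<ge>t\<^sub>0. \<forall>x. indicator (K t) x * survival t x \<le> Cp * exp (- lam * t) * \<phi> x"
    using pgsd unfolding pGSD_def by (elim exE conjE)
  obtain B where B: "0 < B" "\<forall>t>0. \<forall>x. \<phi> x \<le> B * (exp (lam * t) * survival t x)"
    using phi_le_survival by (elim exE conjE)
  obtain B' where psi: "AE x in \<mu>. 0 < \<psi> x \<and> \<psi> x \<le> B'" using psi_bounds by blast
  then have "AE x in \<mu>. 0 < B'" by eventually_elim simp
  then have B': "0 < B'" by (rule AE_const_imp)
  define c where "c = (\<integral>y. \<psi> y \<partial>\<mu>)"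
  have c: "0 < c" using psi_integrable(2) by (simp add: c_def)
  define M where "M = 1 + exp (lam * t\<^sub>0)"
  (* M absorbs the factor exp (lam * t0); R bounds one plus the modulus of the limit value *)
  define R where "R = 1 + (c + B') / c"
  define C' where "C' = B * (C * M * Cp) * R"
  have R: "0 < R" using c B' by (simp add: R_def add_pos_pos)
  have "0 < C'" unfolding C'_def using B(1) C(1) Cp(1) R by (simp add: M_def add_pos_pos)
  moreover have "norm ((\<integral>x. cont_semigroup \<mu> u t f x \<partial>\<sigma>) / (\<integral>x. cont_semigroup \<mu> u t (\<lambda>_. 1) x \<partial>\<sigma>)
        - (\<integral>x. f x \<partial>normalized_density \<mu> \<psi>)) \<le> C' * (exp (- \<gamma> * b * t) + tail_sup (b * t))"
    if t: "4 / min a b * t\<^sub>0 < t" and \<sigma>: "\<sigma> \<in> admissible_measures (K (a * t)) Z"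
      and f: "f \<in> Lp \<mu> p" "Lp_norm \<mu> p f \<le> 1" for t \<sigma> and f :: "'a \<Rightarrow> complex"
  proof -
    define r where "r = a * t"
    define s where "s = b * t"
    have t_min: "4 * t\<^sub>0 < min a b * t"
      using t ab by (simp add: field_simps)
    have "0 < t" using t ab t0_pos by (smt (verit) divide_pos_pos mult_pos_pos min_def)
    have "min a b * t \<le> a * t" "min a b * t \<le> b * t"
      using \<open>0 < t\<close> by (intro mult_right_mono; simp)+
    with t_min have "4 * t\<^sub>0 < a * t" "4 * t\<^sub>0 < b * t" by linarith+
    moreover have "a * t \<le> t" using ab \<open>0 < t\<close> by (simp add: mult_le_cancel_right1)
    ultimately have rs: "3 * t\<^sub>0 < s" "0 < r" "t\<^sub>0 \<le> r" "t\<^sub>0 \<le> s" "2 * t\<^sub>0 < t"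
      using t0_pos ab \<open>0 < t\<close> unfolding r_def s_def by (linarith | simp)+
    have "r + (s + s) = (a + 2 * b) * t" by (simp add: r_def s_def algebra_simps)
    then have t_eq: "r + (s + s) = t" using ab(3) by simp
    (* bounds the normalized mass at time t0 outside K s *)
    define \<epsilon> where "\<epsilon> = exp (lam * t\<^sub>0) * tail_sup s"
    have ts: "0 \<le> tail_sup s" using tail_sup_nonneg rs(4) .
    then have eps: "0 \<le> \<epsilon>" by (simp add: \<epsilon>_def)
    have tail: "\<forall>z. z \<notin> K s \<longrightarrow> exp (lam * t\<^sub>0) * survival t\<^sub>0 z \<le> \<epsilon>"
      using survival_le_tail_sup by (auto simp: \<epsilon>_def)
    define \<kappa> where "\<kappa> = exp (- \<gamma> * s) + tail_sup s"
    define \<delta> where "\<delta> = C * M * Cp * \<kappa>"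
    have \<kappa>: "0 < \<kappa>" using ts by (simp add: \<kappa>_def add_pos_nonneg)
    have \<delta>: "0 \<le> \<delta>" using C(1) Cp(1) \<kappa> by (simp add: \<delta>_def M_def)
    have eps_kappa: "exp (- \<gamma> * s) + \<epsilon> \<le> M * \<kappa>"
      using ts by (simp add: \<epsilon>_def M_def \<kappa>_def algebra_simps)
    have surv: "exp (lam * r) * survival r x \<le> Cp * \<phi> x" if "x \<in> K r" for x
    proof -
      have "exp (lam * r) * survival r x \<le> exp (lam * r) * (Cp * exp (- lam * r) * \<phi> x)"
        using Cp(2)[rule_format, OF rs(3), of x] that by (intro mult_left_mono) auto
      also have "\<dots> = (exp (lam * r) * exp (- lam * r)) * (Cp * \<phi> x)" by (simp only: ac_simps)
      also have "\<dots> = Cp * \<phi> x" by (simp flip: exp_add)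
      finally show ?thesis .
    qed
    have pointwise: "norm (exp (lam * t) *\<^sub>R cont_semigroup \<mu> u t g x
        - \<phi> x *\<^sub>R ((1 / \<Lambda>) *\<^sub>R (\<integral>y. \<psi> y *\<^sub>R g y \<partial>\<mu>))) \<le> \<delta> * \<phi> x"
      if "x \<in> K r" "1 \<le> q" "g \<in> Lp \<mu> q" "Lp_norm \<mu> q g \<le> 1" for x q and g :: "'a \<Rightarrow> complex"
    proof -
      have "norm (exp (lam * t) *\<^sub>R cont_semigroup \<mu> u t g x
          - \<phi> x *\<^sub>R ((1 / \<Lambda>) *\<^sub>R (\<integral>y. \<psi> y *\<^sub>R g y \<partial>\<mu>)))
          \<le> C * (exp (- \<gamma> * s) + \<epsilon>) * (exp (lam * r) * survival r x)"
        using C(2)[rule_format, OF rs(1,2) eps that(2-4) tail[rule_format]] unfolding t_eq .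
      also have "\<dots> \<le> C * (M * \<kappa>) * (Cp * \<phi> x)"
      proof (rule mult_mono)
        show "C * (exp (- \<gamma> * s) + \<epsilon>) \<le> C * (M * \<kappa>)" using C(1) eps_kappa by simp
        show "exp (lam * r) * survival r x \<le> Cp * \<phi> x" by (rule surv[OF that(1)])
        show "0 \<le> C * (M * \<kappa>)" using C(1) \<kappa> by (simp add: M_def add_nonneg_nonneg)
        show "0 \<le> exp (lam * r) * survival r x" using survival_nonneg[OF rs(2)] by simp
      qed
      also have "\<dots> = \<delta> * \<phi> x" by (simp add: \<delta>_def)
      finally show ?thesis .
    qed
    have \<sigma>': "sets \<sigma> = sets borel" "prob_space \<sigma>" "measure_support \<sigma> \<subseteq> K r"
      using \<sigma> by (simp_all add: admissible_measures_def r_def)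
    obtain x\<^sub>0 where x0: "x\<^sub>0 \<in> measure_support \<sigma>" "\<phi> x\<^sub>0 \<noteq> 0"
      using \<sigma> Z by (auto simp: admissible_measures_def)
    have fin: "finite_measure \<sigma>" using \<sigma>'(2) by (rule prob_space.finite_measure)
    have supp: "AE x in \<sigma>. x \<in> K r"
      using AE_in_measure_support[OF \<sigma>'(1)] \<sigma>'(3) by (auto elim!: eventually_mono)
    define V where "V x = exp (lam * t) *\<^sub>R cont_semigroup \<mu> u t f x" for x
    define W where "W x = exp (lam * t) * survival t x" for x
    define \<alpha> where "\<alpha> = (1 / \<Lambda>) *\<^sub>R (\<integral>y. \<psi> y *\<^sub>R f y \<partial>\<mu>)"
    define \<beta> where "\<beta> = c / \<Lambda>"
    have int: "integrable \<sigma> (cont_semigroup \<mu> u t f)" "integrable \<sigma> (survival t)" "integrable \<sigma> \<phi>"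
      by (rule integrable_bcontfun[OF \<sigma>'(1) fin continuous_version_Lp(1)[OF rs(5) f p]]
          integrable_bcontfun[OF \<sigma>'(1) fin survival_bcontfun[OF \<open>0 < t\<close>]]
          integrable_bcontfun[OF \<sigma>'(1) fin phi_bcontfun])+
    have one: "cont_semigroup \<mu> u t (\<lambda>_. 1 :: complex) x = complex_of_real (survival t x)" for x
      by (rule strong_feller_one(3)[OF borel_sets full_support feller \<open>0 < t\<close>])
    have V_est: "AE x in \<sigma>. norm (V x - \<phi> x *\<^sub>R \<alpha>) \<le> \<delta> * \<phi> x"
      using supp by eventually_elim (unfold V_def \<alpha>_def, rule pointwise[OF _ p f])
    have W_est: "AE x in \<sigma>. \<bar>W x - \<phi> x * \<beta>\<bar> \<le> \<delta> * \<phi> x"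
      using supp
    proof eventually_elim
      case (elim x)
      have "(\<integral>y. \<psi> y *\<^sub>R (1 :: complex) \<partial>\<mu>) = complex_of_real c"
        by (simp add: c_def scaleR_conv_of_real)
      then have "exp (lam * t) *\<^sub>R cont_semigroup \<mu> u t (\<lambda>_. 1) x
          - \<phi> x *\<^sub>R ((1 / \<Lambda>) *\<^sub>R (\<integral>y. \<psi> y *\<^sub>R (1 :: complex) \<partial>\<mu>)) = complex_of_real (W x - \<phi> x * \<beta>)"
        by (simp add: one W_def \<beta>_def scaleR_conv_of_real)
      then show ?case
        using pointwise[OF elim top_greatest one_in_unit_ball] by (simp only: norm_of_real)
    qed
    have S: "0 < (\<integral>x. \<phi> x \<partial>\<sigma>)"
      by (rule positive_integral_of_support[OF \<sigma>'(1) int(3) phi_continuous phi_nonneg x0])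
    have low: "AE x in \<sigma>. \<phi> x \<le> B * W x"
      using B(2)[rule_format, OF \<open>0 < t\<close>] by (simp add: W_def)
    have ratio: "norm ((\<integral>x. V x \<partial>\<sigma>) / complex_of_real (\<integral>x. W x \<partial>\<sigma>) - \<alpha> / complex_of_real \<beta>)
        \<le> B * \<delta> * (1 + norm (\<alpha> / complex_of_real \<beta>))"
      using c Lambda_pos int
      by (intro integral_ratio_estimate[OF _ _ _ V_est W_est low S B(1) _ \<delta>])
        (simp_all add: V_def[abs_def] W_def[abs_def] \<beta>_def)
    have scale: "(\<integral>x. V x \<partial>\<sigma>) / complex_of_real (\<integral>x. W x \<partial>\<sigma>)
        = (\<integral>x. cont_semigroup \<mu> u t f x \<partial>\<sigma>) / (\<integral>x. cont_semigroup \<mu> u t (\<lambda>_. 1) x \<partial>\<sigma>)"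
      by (simp add: V_def W_def one scaleR_conv_of_real)
    have fm: "f \<in> borel_measurable \<mu>" using f(1) by (simp add: Lp_def)
    have quot: "\<alpha> / complex_of_real \<beta> = (\<integral>x. f x \<partial>normalized_density \<mu> \<psi>)"
      using Lambda_pos unfolding integral_normalized_density[OF fm]
      by (simp add: \<alpha>_def \<beta>_def c_def scaleR_conv_of_real)
    have mean: "norm (\<alpha> / complex_of_real \<beta>) \<le> (c + B') / c"
    proof -
      obtain h where h: "h \<in> borel_measurable \<mu>" "AE y in \<mu>. ennreal (norm (f y)) \<le> 1 + h y"
        "(\<integral>\<^sup>+y. h y \<partial>\<mu>) \<le> 1"
        using Lp_unit_ball_split[OF f p] .
      have "norm (\<integral>y. \<psi> y *\<^sub>R f y \<partial>\<mu>) \<le> c + B'"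
        using integrable_psi_mult(2)[OF fm h psi] by (simp add: c_def)
      then show ?thesis
        unfolding quot integral_normalized_density[OF fm] c_def[symmetric]
        using c by (simp add: norm_divide divide_right_mono)
    qed
    have "norm ((\<integral>x. cont_semigroup \<mu> u t f x \<partial>\<sigma>) / (\<integral>x. cont_semigroup \<mu> u t (\<lambda>_. 1) x \<partial>\<sigma>)
        - (\<integral>x. f x \<partial>normalized_density \<mu> \<psi>)) \<le> B * \<delta> * (1 + norm (\<alpha> / complex_of_real \<beta>))"
      using ratio unfolding scale quot .
    also have "\<dots> \<le> B * \<delta> * R"
      unfolding R_def using B(1) \<delta> mean by (intro mult_left_mono add_left_mono) simp_all
    also have "\<dots> = C' * \<kappa>" by (simp add: C'_def \<delta>_def)
    also have "\<kappa> = exp (- \<gamma> * b * t) + tail_sup (b * t)" by (simp add: \<kappa>_def s_def mult.assoc)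
    finally show ?thesis .
  qed
  then have "quasi_ergodic_error \<mu> u t p (admissible_measures (K (a * t)) Z) (normalized_density \<mu> \<psi>)
      \<le> ennreal (C' * (exp (- \<gamma> * b * t) + tail_sup (b * t)))" if "4 / min a b * t\<^sub>0 < t" for t
    unfolding quasi_ergodic_error_def using that by (intro SUP_least ennreal_leI) auto
  ultimately show ?thesis by blast
qed

end

section \<open>Positivity, semigroup law and continuity of an L2 kernel\<close>

text \<open>An inequality, unlike an equality, does not extend from a generating family closed under
intersections. Outer regularity on a Polish space replaces that argument: the inequality passes
from finite unions of basic sets to open sets by continuity, and then to all Borel sets.\<close>

lemma emeasure_le_of_basis:
  fixes M N :: "'a::polish_space measure"
  assumes M: "sets M = sets borel" "emeasure M (space M) \<noteq> \<infinity>"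
    and N: "sets N = sets borel" "emeasure N (space N) \<noteq> \<infinity>"
    and basis: "countable \<B>" "topological_basis \<B>"
    and le: "\<And>\<F>. finite \<F> \<Longrightarrow> \<F> \<subseteq> \<B> \<Longrightarrow> emeasure M (\<Union>\<F>) \<le> emeasure N (\<Union>\<F>)"
    and X: "X \<in> sets borel"
  shows "emeasure M X \<le> emeasure N X"
proof -
  have "emeasure M U \<le> emeasure N U" if U: "open U" for U
  proof -
    obtain \<B>' where B': "\<B>' \<subseteq> \<B>" "\<Union>\<B>' = U"
      using basis(2) U unfolding topological_basis_def by blast
    show ?thesis
    proof (cases "\<B>' = {}")
      case False
      define V where "V n = \<Union>(from_nat_into \<B>' ` {..n})" for n
      have count: "countable \<B>'" using basis(1) B'(1) by (rule countable_subset[rotated])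
      have in_B': "from_nat_into \<B>' ` {..n} \<subseteq> \<B>'" for n
        using from_nat_into[OF False] by auto
      have "open (V n)" for n
        unfolding V_def using in_B' B'(1) topological_basis_open[OF basis(2)] by blast
      then have V: "V n \<in> sets borel" for n by simp
      have inc: "incseq V" unfolding V_def incseq_def by force
      have "(\<Union>n. V n) = \<Union>(range (from_nat_into \<B>'))" unfolding V_def by auto
      also have "\<dots> = U" using range_from_nat_into[OF False count] B'(2) by simp
      finally have U_eq: "U = (\<Union>n. V n)" by simp
      have "emeasure M U = (SUP n. emeasure M (V n))"
        unfolding U_eq using V inc M(1) by (intro SUP_emeasure_incseq[symmetric]) auto
      also have "\<dots> \<le> (SUP n. emeasure N (V n))"
        unfolding V_def using in_B' B'(1) by (intro SUP_mono) (meson UNIV_I finite_atMost finite_imageI le subset_trans)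
      also have "\<dots> = emeasure N U"
        unfolding U_eq using V inc N(1) by (intro SUP_emeasure_incseq) auto
      finally show ?thesis .
    qed (use B'(2) in auto)
  qed
  note open_le = this
  have "emeasure M X \<le> emeasure N U" if U: "X \<subseteq> U" "open U" for U
  proof -
    have "emeasure M X \<le> emeasure M U" using U M(1) by (intro emeasure_mono) auto
    also have "\<dots> \<le> emeasure N U" using open_le U(2) .
    finally show ?thesis .
  qed
  then show ?thesis
    unfolding outer_regular[OF N X] by (intro INF_greatest) auto
qed

text \<open>Applied to the densities of the positive and the negative part of \<open>k\<close> on \<open>D\<^sub>i\<close>, the comparison on
the set where \<open>k\<close> is negative shows that the negative part has integral \<open>0\<close>. Only countably
many test sets occur in the hypothesis, so it can be verified for almost every row of a kernel.\<close>

lemma AE_nonneg_of_basis: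
  fixes \<mu> :: "'a::polish_space measure" and k :: "'a \<Rightarrow> real"
  assumes \<mu>: "sets \<mu> = sets borel" and k [measurable]: "k \<in> borel_measurable \<mu>"
    and D: "\<And>i::nat. D i \<in> sets \<mu>" "(\<Union>i. D i) = space \<mu>"
    and int: "\<And>i. integrable \<mu> (\<lambda>y. k y * indicator (D i) y)"
    and basis: "countable \<B>" "topological_basis \<B>"
    and nonneg: "\<And>\<F> i. finite \<F> \<Longrightarrow> \<F> \<subseteq> \<B> \<Longrightarrow> 0 \<le> (\<integral>y. k y * indicator (\<Union>\<F> \<inter> D i) y \<partial>\<mu>)"
  shows "AE y in \<mu>. 0 \<le> k y"
proof -
  have "AE y in \<mu>. y \<in> D i \<longrightarrow> 0 \<le> k y" for i
  proof -
    have [measurable]: "D i \<in> sets \<mu>" by (rule D(1))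
    (* the positive and the negative part of k on D i, as finite measures *)
    define P where "P = density \<mu> (\<lambda>y. ennreal (k y * indicator (D i) y))"
    define Q where "Q = density \<mu> (\<lambda>y. ennreal (- (k y * indicator (D i) y)))"
    have PQ: "sets P = sets borel" "sets Q = sets borel" using \<mu> by (simp_all add: P_def Q_def)
    have fin: "(\<integral>\<^sup>+y. ennreal (k y * indicator (D i) y) \<partial>\<mu>) \<noteq> \<infinity>"
        "(\<integral>\<^sup>+y. ennreal (- (k y * indicator (D i) y)) \<partial>\<mu>) \<noteq> \<infinity>"
      using int[of i] unfolding real_integrable_def by auto
    have finP: "emeasure P (space P) \<noteq> \<infinity>" and finQ: "emeasure Q (space Q) \<noteq> \<infinity>"
      using fin by (simp_all add: P_def Q_def emeasure_density cong: nn_integral_cong)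
    have "emeasure Q (\<Union>\<F>) \<le> emeasure P (\<Union>\<F>)" if F: "finite \<F>" "\<F> \<subseteq> \<B>" for \<F>
    proof -
      have "open (\<Union>\<F>)" using F(2) topological_basis_open[OF basis(2)] by blast
      then have [measurable]: "\<Union>\<F> \<in> sets \<mu>" using \<mu> by simp
      let ?f = "\<lambda>y. k y * indicator (\<Union>\<F> \<inter> D i) y"
      have eq: "emeasure P (\<Union>\<F>) = (\<integral>\<^sup>+y. ennreal (?f y) \<partial>\<mu>)"
          "emeasure Q (\<Union>\<F>) = (\<integral>\<^sup>+y. ennreal (- ?f y) \<partial>\<mu>)"
        unfolding P_def Q_def
        by (simp_all add: emeasure_density)
          (auto intro!: nn_integral_cong simp: indicator_def)
      have If: "integrable \<mu> ?f"
      proof (rule Bochner_Integration.integrable_bound[OF int[of i]])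
        show "AE y in \<mu>. norm (?f y) \<le> norm (k y * indicator (D i) y)"
          by (rule AE_I2) (simp add: indicator_def)
      qed measurable
      have fin': "(\<integral>\<^sup>+y. ennreal (?f y) \<partial>\<mu>) < \<top>" "(\<integral>\<^sup>+y. ennreal (- ?f y) \<partial>\<mu>) < \<top>"
        using If unfolding real_integrable_def by (auto simp: less_top)
      have "enn2real (\<integral>\<^sup>+y. ennreal (- ?f y) \<partial>\<mu>) \<le> enn2real (\<integral>\<^sup>+y. ennreal (?f y) \<partial>\<mu>)"
        using nonneg[OF F, of i] real_lebesgue_integral_def[OF If] by linarith
      from ennreal_leI[OF this] show ?thesis
        unfolding eq by (simp only: ennreal_enn2real[OF fin'(1)] ennreal_enn2real[OF fin'(2)])
    qed
    note le_basis = this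
    have "{y \<in> space \<mu>. k y < 0} \<in> sets \<mu>" by measurable
    then have "{y \<in> space \<mu>. k y < 0} \<in> sets borel" unfolding \<mu> .
    from emeasure_le_of_basis[OF PQ(2) finQ PQ(1) finP basis le_basis this]
    have "emeasure Q {y \<in> space \<mu>. k y < 0} \<le> emeasure P {y \<in> space \<mu>. k y < 0}" .
    also have "\<dots> = (\<integral>\<^sup>+y. ennreal (k y * indicator (D i) y) * indicator {y \<in> space \<mu>. k y < 0} y \<partial>\<mu>)"
      unfolding P_def by (rule emeasure_density) measurable
    also have "\<dots> = (\<integral>\<^sup>+y. 0 \<partial>\<mu>)"
      by (intro nn_integral_cong) (auto simp: indicator_def ennreal_neg)
    finally have "(\<integral>\<^sup>+y. ennreal (- (k y * indicator (D i) y)) * indicator {y \<in> space \<mu>. k y < 0} y \<partial>\<mu>) = 0"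
      unfolding Q_def by (subst (asm) emeasure_density) auto
    then have "AE y in \<mu>. ennreal (- (k y * indicator (D i) y)) * indicator {y \<in> space \<mu>. k y < 0} y = 0"
      by (subst (asm) nn_integral_0_iff_AE) auto
    with AE_space show ?thesis
      by eventually_elim (auto simp: indicator_def ennreal_eq_0_iff split: if_splits)
  qed
  then have "AE y in \<mu>. \<forall>i. y \<in> D i \<longrightarrow> 0 \<le> k y" unfolding AE_all_countable by blast
  with AE_space show ?thesis
    by eventually_elim (use D(2) in auto)
qed

lemma sigma_finite_of_locally_finite:
  fixes \<mu> :: "'a::second_countable_topology measure"
  assumes "sets \<mu> = sets borel" "locally_finite_measure \<mu>"
  shows "sigma_finite_measure \<mu>"
proof
  obtain \<B> :: "'a set set" where B: "countable \<B>" "topological_basis \<B>"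
    using ex_countable_basis by blast
  let ?A = "{V \<in> \<B>. emeasure \<mu> V < \<infinity>}"
  have "UNIV \<subseteq> \<Union>?A"
  proof
    fix x :: 'a
    obtain V where V: "open V" "x \<in> V" "emeasure \<mu> V < \<infinity>"
      using assms(2) unfolding locally_finite_measure_def by blast
    obtain W where W: "W \<in> \<B>" "x \<in> W" "W \<subseteq> V"
      using topological_basisE[OF B(2) V(1,2)] by blast
    have "emeasure \<mu> W \<le> emeasure \<mu> V"
      using W(3) V(1) assms(1) by (intro emeasure_mono) auto
    then have "emeasure \<mu> W < \<infinity>" using V(3) by (rule le_less_trans)
    then show "x \<in> \<Union>?A" using W by blast
  qed
  moreover have "space \<mu> = UNIV" using sets_eq_imp_space_eq[OF assms(1)] by simp
  ultimately have "\<Union>?A = space \<mu>" by blast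
  moreover have "?A \<subseteq> sets \<mu>" using topological_basis_open[OF B(2)] assms(1) by auto
  moreover have "countable ?A" using B(1) by (rule countable_subset[rotated]) blast
  moreover have "\<forall>V\<in>?A. emeasure \<mu> V \<noteq> \<infinity>" by auto
  ultimately show "\<exists>A. countable A \<and> A \<subseteq> sets \<mu> \<and> \<Union>A = space \<mu> \<and> (\<forall>a\<in>A. emeasure \<mu> a \<noteq> \<infinity>)"
    by (intro exI[of _ ?A] conjI)
qed

lemma indicator_in_Lp:
  assumes [measurable]: "D \<in> sets \<mu>" and fin: "emeasure \<mu> D < \<infinity>"
  shows "(indicator D :: 'a \<Rightarrow> real) \<in> Lp \<mu> 2" "(\<lambda>x. complex_of_real (indicator D x)) \<in> Lp \<mu> 2"
proof -
  have "integrable \<mu> (\<lambda>x. indicator D x powr 2 :: real)"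
  proof (subst Bochner_Integration.integrable_cong[OF refl])
    show "integrable \<mu> (indicator D :: 'a \<Rightarrow> real)" using fin by simp
  qed (simp add: indicator_def)
  then show "(indicator D :: 'a \<Rightarrow> real) \<in> Lp \<mu> 2" "(\<lambda>x. complex_of_real (indicator D x)) \<in> Lp \<mu> 2"
    by (simp_all add: Lp_def)
qed

text \<open>A substitute for the Cauchy-Schwarz inequality, up to the constant: the pointwise inequality
\<open>\<bar>h\<bar> \<le> \<delta> + \<bar>h\<bar>\<^sup>2 / \<delta>\<close> is integrated over \<open>A\<close> with \<open>\<delta>\<close> equal to the norm of \<open>h\<close>, if that
is positive.\<close>

lemma integral_le_L2_norm:
  fixes h :: "'a \<Rightarrow> complex"
  assumes h: "h \<in> Lp \<mu> 2" and [measurable]: "A \<in> sets \<mu>" and fin: "emeasure \<mu> A < \<infinity>"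
  shows "integrable \<mu> (\<lambda>x. indicator A x * norm (h x))"
    and "(\<integral>x. indicator A x * norm (h x) \<partial>\<mu>) \<le> (measure \<mu> A + 1) * Lp_norm \<mu> 2 h"
proof -
  have [measurable]: "h \<in> borel_measurable \<mu>" using h by (simp add: Lp_def)
  have sq: "integrable \<mu> (\<lambda>x. norm (h x) powr 2)" using h by (simp add: Lp_def)
  have intA: "integrable \<mu> (indicator A :: 'a \<Rightarrow> real)" using fin by simp
  have young: "indicator A x * norm (h x) \<le> \<delta> * indicator A x + norm (h x) powr 2 / \<delta>" if "0 < \<delta>" for \<delta> x
  proof (cases "x \<in> A")
    case True
    have "norm (h x) \<le> \<delta> + (norm (h x))\<^sup>2 / \<delta>"
    proof (cases "norm (h x) \<le> \<delta>")
      case False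
      then have "norm (h x) * \<delta> \<le> (norm (h x))\<^sup>2" using that by (simp add: power2_eq_square mult_left_mono)
      then have "norm (h x) \<le> (norm (h x))\<^sup>2 / \<delta>" using that by (simp add: field_simps)
      then show ?thesis using that by linarith
    qed (use that in \<open>simp add: add_increasing2\<close>)
    then show ?thesis using True by simp
  qed (use that in simp)
  show int: "integrable \<mu> (\<lambda>x. indicator A x * norm (h x))"
  proof (rule Bochner_Integration.integrable_bound)
    show "integrable \<mu> (\<lambda>x. 1 * indicator A x + norm (h x) powr 2 / 1)"
      using intA sq by simp
    show "AE x in \<mu>. norm (indicator A x * norm (h x)) \<le> norm (1 * indicator A x + norm (h x) powr 2 / 1)"
    proof (rule AE_I2)
      fix x
      have "0 \<le> indicator A x * norm (h x)" by simp
      with young[of 1 x] show "norm (indicator A x * norm (h x)) \<le> norm (1 * indicator A x + norm (h x) powr 2 / 1)"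
        unfolding real_norm_def by linarith
    qed
  qed measurable
  define n where "n = Lp_norm \<mu> 2 h"
  have n: "0 \<le> n" "(\<integral>x. norm (h x) powr 2 \<partial>\<mu>) = n * n"
  proof -
    have "n = (\<integral>x. norm (h x) powr 2 \<partial>\<mu>) powr (1 / 2)" by (simp add: n_def Lp_norm_def)
    moreover have "0 \<le> (\<integral>x. norm (h x) powr 2 \<partial>\<mu>)" by (intro integral_nonneg_AE) simp
    ultimately show "0 \<le> n" "(\<integral>x. norm (h x) powr 2 \<partial>\<mu>) = n * n"
      by (simp_all add: powr_half_sqrt)
  qed
  have bound: "(\<integral>x. indicator A x * norm (h x) \<partial>\<mu>) \<le> \<delta> * measure \<mu> A + n * n / \<delta>" if "0 < \<delta>" for \<delta>
  proof -
    have "(\<integral>x. indicator A x * norm (h x) \<partial>\<mu>) \<le> (\<integral>x. \<delta> * indicator A x + norm (h x) powr 2 / \<delta> \<partial>\<mu>)"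
      using int intA sq young[OF that] by (intro integral_mono) auto
    also have "\<dots> = \<delta> * measure \<mu> A + n * n / \<delta>" using intA sq n(2) by simp
    finally show ?thesis .
  qed
  show "(\<integral>x. indicator A x * norm (h x) \<partial>\<mu>) \<le> (measure \<mu> A + 1) * Lp_norm \<mu> 2 h"
  proof (cases "n = 0")
    case False
    then show ?thesis using bound[of n] n(1) unfolding n_def[symmetric] by (simp add: algebra_simps)
  next
    case True
    have "AE x in \<mu>. norm (h x) powr 2 = 0"
      using n(2) sq True by (simp add: integral_nonneg_eq_0_iff_AE)
    then have "(\<integral>x. indicator A x * norm (h x) \<partial>\<mu>) = (\<integral>x. 0 \<partial>\<mu>)"
      by (intro integral_cong_AE) (auto elim!: eventually_mono)
    then show ?thesis using True unfolding n_def[symmetric] by simp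
  qed
qed

text \<open>A strongly continuous, positivity preserving semigroup on square integrable functions given by
kernels. Properties of the kernels themselves are derived from those of the operators.\<close>

locale L2_kernel_semigroup = sigma_finite_measure \<mu> for \<mu> :: "'a::polish_space measure" +
  fixes u :: "real \<Rightarrow> 'a \<Rightarrow> 'a \<Rightarrow> real"
  assumes borel_sets: "sets \<mu> = sets borel"
    and full_support: "measure_support \<mu> = UNIV"
    and kernel_measurable: "\<And>t. 0 < t \<Longrightarrow> case_prod (u t) \<in> borel_measurable (\<mu> \<Otimes>\<^sub>M \<mu>)"
    and kernel_L2: "\<And>t. 0 < t \<Longrightarrow> kernel_defined_on \<mu> (u t) (Lp \<mu> 2)"
    and semigroup: "strongly_continuous_semigroup \<mu> (kernel_semigroup \<mu> u)"
    and pos_preserving: "\<And>t. 0 \<le> t \<Longrightarrow> positivity_preserving \<mu> (kernel_semigroup \<mu> u t)"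
    and feller: "strong_feller \<mu> u"
begin

sublocale pair: pair_sigma_finite \<mu> \<mu> ..

abbreviation transition :: "real \<Rightarrow> 'a set \<Rightarrow> 'a \<Rightarrow> complex" where
  "transition t D \<equiv> kernel_semigroup \<mu> u t (\<lambda>y. complex_of_real (indicator D y))"

lemma transition_real:
  assumes t: "0 < t" and D: "D \<in> sets \<mu>" "emeasure \<mu> D < \<infinity>"
  shows "AE x in \<mu>. integrable \<mu> (\<lambda>y. u t x y * indicator D y) \<and>
    transition t D x = complex_of_real (\<integral>y. u t x y * indicator D y \<partial>\<mu>)"
proof -
  have "AE x in \<mu>. integrable \<mu> (\<lambda>y. u t x y *\<^sub>R complex_of_real (indicator D y))"
    using kernel_L2[OF t] unfolding kernel_defined_on_def by (rule bspec[OF _ indicator_in_Lp(2)[OF D]])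
  then show ?thesis
  proof eventually_elim
    case (elim x)
    have "integrable \<mu> (\<lambda>y. u t x y * indicator D y)"
      using integrable_Re[OF elim] by (simp add: scaleR_conv_of_real)
    then show ?case
      using t by (simp add: kernel_semigroup_def kernel_operator_def scaleR_conv_of_real
          flip: of_real_mult)
  qed
qed

lemma transition_in_Lp:
  assumes t: "0 < t" and D: "D \<in> sets \<mu>" "emeasure \<mu> D < \<infinity>"
  shows "transition t D \<in> Lp \<mu> 2"
  using semigroup t indicator_in_Lp(2)[OF D]
  unfolding strongly_continuous_semigroup_def bounded_Lp_operator_def by simp

text \<open>Positivity preservation is tested on the countably many sets \<open>V \<inter> D\<^sub>i\<close> with \<open>V\<close> a finite union of
basic open sets, hence holds simultaneously for almost every row.\<close>

lemma kernel_nonneg: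
  assumes t: "0 < t"
  shows "AE x in \<mu>. AE y in \<mu>. 0 \<le> u t x y"
proof -
  have [measurable]: "case_prod (u t) \<in> borel_measurable (\<mu> \<Otimes>\<^sub>M \<mu>)" using kernel_measurable t .
  obtain \<B> :: "'a set set" where B: "countable \<B>" "topological_basis \<B>"
    using ex_countable_basis by blast
  obtain D :: "nat \<Rightarrow> 'a set" where D: "\<forall>i. D i \<in> sets \<mu> \<and> emeasure \<mu> (D i) < \<infinity>"
      "incseq D" "(\<Union>i. D i) = space \<mu>"
    using finite_exhaustion by blast
  define \<V> where "\<V> = (\<lambda>(\<F>, i). \<Union>\<F> \<inter> D i) ` ({\<F>. finite \<F> \<and> \<F> \<subseteq> \<B>} \<times> UNIV)"
  have "countable \<V>"
    unfolding \<V>_def using countable_Collect_finite_subset[OF B(1)] by auto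
  have V: "V \<in> sets \<mu>" "emeasure \<mu> V < \<infinity>" if "V \<in> \<V>" for V
  proof -
    from that obtain \<F> i where F: "finite \<F>" "\<F> \<subseteq> \<B>" "V = \<Union>\<F> \<inter> D i" by (auto simp: \<V>_def)
    have "open (\<Union>\<F>)" using F(2) topological_basis_open[OF B(2)] by blast
    then have "\<Union>\<F> \<in> sets \<mu>" using borel_sets by simp
    then show "V \<in> sets \<mu>" using F(3) D(1) by auto
    have "emeasure \<mu> V \<le> emeasure \<mu> (D i)" using F(3) D(1) by (intro emeasure_mono) auto
    also have "\<dots> < \<infinity>" using D(1) by blast
    finally show "emeasure \<mu> V < \<infinity>" .
  qed
  have "AE x in \<mu>. 0 \<le> (\<integral>y. u t x y * indicator V y \<partial>\<mu>)" if "V \<in> \<V>" for V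
  proof -
    have "AE x in \<mu>. 0 \<le> kernel_semigroup \<mu> u t (indicator V :: 'a \<Rightarrow> real) x"
      using pos_preserving[of t] t indicator_in_Lp(1)[OF V[OF that]]
      unfolding positivity_preserving_def by simp
    then show ?thesis
      by eventually_elim (use t in \<open>simp add: kernel_semigroup_def kernel_operator_def\<close>)
  qed
  then have "AE x in \<mu>. \<forall>V\<in>\<V>. 0 \<le> (\<integral>y. u t x y * indicator V y \<partial>\<mu>)"
    by (subst AE_ball_countable[OF \<open>countable \<V>\<close>]) blast
  moreover have "AE x in \<mu>. integrable \<mu> (\<lambda>y. u t x y * indicator (D i) y)" for i
  proof -
    have "D i \<in> sets \<mu>" "emeasure \<mu> (D i) < \<infinity>" using D(1) by auto
    from transition_real[OF t this] show ?thesis by eventually_elim simp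
  qed
  then have "AE x in \<mu>. \<forall>i. integrable \<mu> (\<lambda>y. u t x y * indicator (D i) y)"
    unfolding AE_all_countable by blast
  ultimately show ?thesis
    using AE_space
  proof eventually_elim
    case (elim x)
    have [measurable]: "x \<in> space \<mu>" by fact
    show ?case
    proof (rule AE_nonneg_of_basis[OF borel_sets _ _ _ _ B])
      show "u t x \<in> borel_measurable \<mu>" by measurable
      show "D i \<in> sets \<mu>" for i using D(1) by blast
      show "(\<Union>i. D i) = space \<mu>" by (fact D(3))
      show "integrable \<mu> (\<lambda>y. u t x y * indicator (D i) y)" for i using elim(2) by blast
      show "0 \<le> (\<integral>y. u t x y * indicator (\<Union>\<F> \<inter> D i) y \<partial>\<mu>)" if "finite \<F>" "\<F> \<subseteq> \<B>" for \<F> i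
      proof -
        have "\<Union>\<F> \<inter> D i \<in> \<V>" unfolding \<V>_def using that by force
        then show ?thesis using elim(1) by blast
      qed
    qed
  qed
qed

lemma nn_kernel_indicator:
  assumes t: "0 < t" and D: "D \<in> sets \<mu>" "emeasure \<mu> D < \<infinity>"
  shows "AE x in \<mu>. 0 \<le> Re (transition t D x) \<and> transition t D x = complex_of_real (Re (transition t D x)) \<and>
    nn_kernel \<mu> (u t) (indicator D) x = ennreal (Re (transition t D x))"
  using transition_real[OF t D] kernel_nonneg[OF t]
proof eventually_elim
  case (elim x)
  have pos: "AE y in \<mu>. 0 \<le> u t x y * indicator D y"
    using elim(2) by eventually_elim simp
  have "nn_kernel \<mu> (u t) (indicator D) x = (\<integral>\<^sup>+y. ennreal (u t x y * indicator D y) \<partial>\<mu>)"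
    unfolding nn_kernel_def by (intro nn_integral_cong) (simp add: indicator_def)
  also have "\<dots> = ennreal (\<integral>y. u t x y * indicator D y \<partial>\<mu>)"
    using elim(1) pos by (intro nn_integral_eq_integral) auto
  finally show ?case using elim(1) pos by (simp add: integral_nonneg_AE)
qed

lemma nn_kernel_semigroup_indicator:
  assumes s: "0 < s" and t: "0 < t" and D [measurable]: "D \<in> sets \<mu>" and fin: "emeasure \<mu> D < \<infinity>"
  shows "AE x in \<mu>. nn_kernel \<mu> (u (s + t)) (indicator D) x
    = nn_kernel \<mu> (u s) (nn_kernel \<mu> (u t) (indicator D)) x"
proof -
  have st: "0 < s + t" using s t by simp
  have law: "AE x in \<mu>. transition (s + t) D x = kernel_semigroup \<mu> u s (transition t D) x"
    using semigroup s t indicator_in_Lp(2)[OF D fin]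
    unfolding strongly_continuous_semigroup_def by simp
  have int: "AE x in \<mu>. integrable \<mu> (\<lambda>z. u s x z *\<^sub>R transition t D z)"
    using kernel_L2[OF s] unfolding kernel_defined_on_def by (rule bspec[OF _ transition_in_Lp[OF t D fin]])
  define R where "R z = Re (transition t D z)" for z
  have R: "AE z in \<mu>. 0 \<le> R z \<and> transition t D z = complex_of_real (R z) \<and>
      nn_kernel \<mu> (u t) (indicator D) z = ennreal (R z)"
    using nn_kernel_indicator[OF t D fin] unfolding R_def .
  from law int nn_kernel_indicator[OF st D fin] kernel_nonneg[OF s]
  show ?thesis
  proof eventually_elim
    case (elim x)
    have int_R: "integrable \<mu> (\<lambda>z. u s x z * R z)"
      using integrable_Re[OF elim(2)] by (simp add: R_def)
    have "Re (transition (s + t) D x) = (\<integral>z. u s x z * R z \<partial>\<mu>)"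
      unfolding elim(1) using s elim(2)
      by (simp add: kernel_semigroup_def[of \<mu> u s] kernel_operator_def R_def flip: integral_Re)
    then have "nn_kernel \<mu> (u (s + t)) (indicator D) x = ennreal (\<integral>z. u s x z * R z \<partial>\<mu>)"
      using elim(3) by simp
    also have "\<dots> = (\<integral>\<^sup>+z. ennreal (u s x z * R z) \<partial>\<mu>)"
    proof (rule nn_integral_eq_integral[symmetric, OF int_R])
      show "AE z in \<mu>. 0 \<le> u s x z * R z" using elim(4) R by eventually_elim simp
    qed
    also have "\<dots> = nn_kernel \<mu> (u s) (nn_kernel \<mu> (u t) (indicator D)) x"
      unfolding nn_kernel_def[of \<mu> "u s"]
    proof (rule nn_integral_cong_AE)
      show "AE z in \<mu>. ennreal (u s x z * R z) = ennreal (u s x z) * nn_kernel \<mu> (u t) (indicator D) z"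
        using elim(4) R by eventually_elim (simp add: ennreal_mult)
    qed
    finally show ?case .
  qed
qed

text \<open>On rectangles with a side of finite measure the operator law identifies the measures with
densities given by both sides. Monotone limits give all rectangles, so the measures agree on
the product sigma-algebra and their densities agree almost everywhere.\<close>

lemma kernel_law:
  assumes s: "0 < s" and t: "0 < t"
  shows "AE (x, y) in \<mu> \<Otimes>\<^sub>M \<mu>.
    ennreal (u (s + t) x y) = (\<integral>\<^sup>+z. ennreal (u s x z) * ennreal (u t z y) \<partial>\<mu>)"
proof -
  have st: "0 < s + t" using s t by simp
  have [measurable]: "case_prod (u s) \<in> borel_measurable (\<mu> \<Otimes>\<^sub>M \<mu>)"
      "case_prod (u t) \<in> borel_measurable (\<mu> \<Otimes>\<^sub>M \<mu>)"
      "case_prod (u (s + t)) \<in> borel_measurable (\<mu> \<Otimes>\<^sub>M \<mu>)"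
    using kernel_measurable s t st by simp_all
  define k\<^sub>1 where "k\<^sub>1 = (\<lambda>(x, y). ennreal (u (s + t) x y))"
  define k\<^sub>2 where "k\<^sub>2 = (\<lambda>(x, y). \<integral>\<^sup>+z. ennreal (u s x z) * ennreal (u t z y) \<partial>\<mu>)"
  have [measurable]: "k\<^sub>1 \<in> borel_measurable (\<mu> \<Otimes>\<^sub>M \<mu>)" "k\<^sub>2 \<in> borel_measurable (\<mu> \<Otimes>\<^sub>M \<mu>)"
    unfolding k\<^sub>1_def k\<^sub>2_def by measurable
  define M\<^sub>1 where "M\<^sub>1 = density (\<mu> \<Otimes>\<^sub>M \<mu>) k\<^sub>1"
  define M\<^sub>2 where "M\<^sub>2 = density (\<mu> \<Otimes>\<^sub>M \<mu>) k\<^sub>2"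
  have M1: "emeasure M\<^sub>1 (A \<times> B) = (\<integral>\<^sup>+x. nn_kernel \<mu> (u (s + t)) (indicator B) x * indicator A x \<partial>\<mu>)"
    if [measurable]: "A \<in> sets \<mu>" "B \<in> sets \<mu>" for A B
  proof -
    have "emeasure M\<^sub>1 (A \<times> B) = (\<integral>\<^sup>+w. k\<^sub>1 w * indicator (A \<times> B) w \<partial>(\<mu> \<Otimes>\<^sub>M \<mu>))"
      unfolding M\<^sub>1_def by (rule emeasure_density) measurable
    also have "\<dots> = (\<integral>\<^sup>+x. \<integral>\<^sup>+y. k\<^sub>1 (x, y) * indicator (A \<times> B) (x, y) \<partial>\<mu> \<partial>\<mu>)"
      by (rule nn_integral_fst[symmetric]) measurable
    also have "\<dots> = (\<integral>\<^sup>+x. (\<integral>\<^sup>+y. (ennreal (u (s + t) x y) * indicator B y) * indicator A x \<partial>\<mu>) \<partial>\<mu>)"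
      by (simp add: k\<^sub>1_def indicator_times ac_simps)
    also have "\<dots> = (\<integral>\<^sup>+x. nn_kernel \<mu> (u (s + t)) (indicator B) x * indicator A x \<partial>\<mu>)"
      unfolding nn_kernel_def by (intro nn_integral_cong nn_integral_multc) measurable
    finally show ?thesis .
  qed
  have M2: "emeasure M\<^sub>2 (A \<times> B)
      = (\<integral>\<^sup>+x. nn_kernel \<mu> (u s) (nn_kernel \<mu> (u t) (indicator B)) x * indicator A x \<partial>\<mu>)"
    if [measurable]: "A \<in> sets \<mu>" "B \<in> sets \<mu>" for A B
  proof -
    have "emeasure M\<^sub>2 (A \<times> B) = (\<integral>\<^sup>+w. k\<^sub>2 w * indicator (A \<times> B) w \<partial>(\<mu> \<Otimes>\<^sub>M \<mu>))"
      unfolding M\<^sub>2_def by (rule emeasure_density) measurable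
    also have "\<dots> = (\<integral>\<^sup>+x. \<integral>\<^sup>+y. k\<^sub>2 (x, y) * indicator (A \<times> B) (x, y) \<partial>\<mu> \<partial>\<mu>)"
      by (rule nn_integral_fst[symmetric]) measurable
    also have "\<dots> = (\<integral>\<^sup>+x. (\<integral>\<^sup>+y. (\<integral>\<^sup>+z. ennreal (u s x z) * ennreal (u t z y) * indicator B y * indicator A x \<partial>\<mu>) \<partial>\<mu>) \<partial>\<mu>)"
    proof (intro nn_integral_cong)
      fix x y assume [measurable]: "x \<in> space \<mu>" "y \<in> space \<mu>"
      have "(\<integral>\<^sup>+z. ennreal (u s x z) * ennreal (u t z y) * indicator B y * indicator A x \<partial>\<mu>)
          = (\<integral>\<^sup>+z. ennreal (u s x z) * ennreal (u t z y) \<partial>\<mu>) * indicator B y * indicator A x"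
        by (simp add: nn_integral_multc)
      then show "k\<^sub>2 (x, y) * indicator (A \<times> B) (x, y)
          = (\<integral>\<^sup>+z. ennreal (u s x z) * ennreal (u t z y) * indicator B y * indicator A x \<partial>\<mu>)"
        by (simp add: k\<^sub>2_def indicator_times mult.assoc mult.commute)
    qed
    also have "\<dots> = (\<integral>\<^sup>+x. (\<integral>\<^sup>+z. (\<integral>\<^sup>+y. ennreal (u s x z) * ennreal (u t z y) * indicator B y * indicator A x \<partial>\<mu>) \<partial>\<mu>) \<partial>\<mu>)"
      by (intro nn_integral_cong pair.Fubini') measurable
    also have "\<dots> = (\<integral>\<^sup>+x. nn_kernel \<mu> (u s) (nn_kernel \<mu> (u t) (indicator B)) x * indicator A x \<partial>\<mu>)"
    proof (intro nn_integral_cong)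
      fix x assume [measurable]: "x \<in> space \<mu>"
      have "(\<integral>\<^sup>+z. (\<integral>\<^sup>+y. ennreal (u s x z) * ennreal (u t z y) * indicator B y * indicator A x \<partial>\<mu>) \<partial>\<mu>)
          = (\<integral>\<^sup>+z. ennreal (u s x z) * nn_kernel \<mu> (u t) (indicator B) z * indicator A x \<partial>\<mu>)"
      proof (intro nn_integral_cong)
        fix z assume [measurable]: "z \<in> space \<mu>"
        have "(\<integral>\<^sup>+y. ennreal (u s x z) * ennreal (u t z y) * indicator B y * indicator A x \<partial>\<mu>)
            = (\<integral>\<^sup>+y. ennreal (u s x z) * (ennreal (u t z y) * indicator B y) * indicator A x \<partial>\<mu>)"
          by (simp add: mult.assoc)
        also have "\<dots> = (\<integral>\<^sup>+y. ennreal (u s x z) * (ennreal (u t z y) * indicator B y) \<partial>\<mu>) * indicator A x"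
          by (rule nn_integral_multc) measurable
        also have "(\<integral>\<^sup>+y. ennreal (u s x z) * (ennreal (u t z y) * indicator B y) \<partial>\<mu>)
            = ennreal (u s x z) * nn_kernel \<mu> (u t) (indicator B) z"
          unfolding nn_kernel_def by (rule nn_integral_cmult) measurable
        finally show "(\<integral>\<^sup>+y. ennreal (u s x z) * ennreal (u t z y) * indicator B y * indicator A x \<partial>\<mu>)
            = ennreal (u s x z) * nn_kernel \<mu> (u t) (indicator B) z * indicator A x" .
      qed
      also have "\<dots> = nn_kernel \<mu> (u s) (nn_kernel \<mu> (u t) (indicator B)) x * indicator A x"
        unfolding nn_kernel_def[of \<mu> "u s"] by (rule nn_integral_multc) measurable
      finally show "(\<integral>\<^sup>+z. (\<integral>\<^sup>+y. ennreal (u s x z) * ennreal (u t z y) * indicator B y * indicator A x \<partial>\<mu>) \<partial>\<mu>)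
          = nn_kernel \<mu> (u s) (nn_kernel \<mu> (u t) (indicator B)) x * indicator A x" .
    qed
    finally show ?thesis .
  qed
  obtain D :: "nat \<Rightarrow> 'a set" where D: "\<forall>i. D i \<in> sets \<mu> \<and> emeasure \<mu> (D i) < \<infinity>"
      "incseq D" "(\<Union>i. D i) = space \<mu>"
    using finite_exhaustion by blast
  have D_sets [measurable]: "D i \<in> sets \<mu>" for i using D(1) by blast
  have finite_case: "emeasure M\<^sub>1 (A \<times> B) = emeasure M\<^sub>2 (A \<times> B)"
    if "A \<in> sets \<mu>" and B: "B \<in> sets \<mu>" "emeasure \<mu> B < \<infinity>" for A B
    unfolding M1[OF that(1,2)] M2[OF that(1,2)]
  proof (rule nn_integral_cong_AE)
    show "AE x in \<mu>. nn_kernel \<mu> (u (s + t)) (indicator B) x * indicator A x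
        = nn_kernel \<mu> (u s) (nn_kernel \<mu> (u t) (indicator B)) x * indicator A x"
      using nn_kernel_semigroup_indicator[OF s t B] by eventually_elim simp
  qed
  let ?E = "{A \<times> B | A B. A \<in> sets \<mu> \<and> B \<in> sets \<mu>}"
  have "M\<^sub>1 = M\<^sub>2"
  proof (rule measure_eqI_generator_eq[OF Int_stable_pair_measure_generator[of \<mu> \<mu>]])
    show "?E \<subseteq> Pow (space \<mu> \<times> space \<mu>)"
      using sets.space_closed[of \<mu>] by auto
    show "sets M\<^sub>1 = sigma_sets (space \<mu> \<times> space \<mu>) ?E" "sets M\<^sub>2 = sigma_sets (space \<mu> \<times> space \<mu>) ?E"
      by (simp_all add: M\<^sub>1_def M\<^sub>2_def sets_pair_measure)
    show "range (\<lambda>i. D i \<times> D i) \<subseteq> ?E" using D(1) by blast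
    show "(\<Union>i. D i \<times> D i) = space \<mu> \<times> space \<mu>"
    proof (intro equalityI subsetI)
      fix w assume "w \<in> space \<mu> \<times> space \<mu>"
      then have "fst w \<in> (\<Union>i. D i)" "snd w \<in> (\<Union>i. D i)" unfolding D(3) by (simp_all add: mem_Times_iff)
      then obtain i j where "fst w \<in> D i" "snd w \<in> D j" by blast
      moreover have "D i \<subseteq> D (max i j)" "D j \<subseteq> D (max i j)"
        using D(2) by (simp_all add: incseqD)
      ultimately have "w \<in> D (max i j) \<times> D (max i j)" by (auto simp: mem_Times_iff)
      then show "w \<in> (\<Union>i. D i \<times> D i)" by blast
    qed (use D(3) in auto)
    show "emeasure M\<^sub>1 (D i \<times> D i) \<noteq> \<infinity>" for i
    proof -
      obtain N :: real where N: "AE x in \<mu>. nn_kernel \<mu> (u (s + t)) (\<lambda>_. 1) x \<le> ennreal N"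
        using strong_feller_bounded[OF borel_sets full_support feller st kernel_nonneg[OF st], of 0]
        by (auto simp: normalized_kernel_def)
      have "emeasure M\<^sub>1 (D i \<times> D i) \<le> (\<integral>\<^sup>+x. ennreal N * indicator (D i) x \<partial>\<mu>)"
        unfolding M1[OF D_sets D_sets]
      proof (rule nn_integral_mono_AE)
        show "AE x in \<mu>. nn_kernel \<mu> (u (s + t)) (indicator (D i)) x * indicator (D i) x
            \<le> ennreal N * indicator (D i) x"
          using N
        proof eventually_elim
          case (elim x)
          have "nn_kernel \<mu> (u (s + t)) (indicator (D i)) x \<le> nn_kernel \<mu> (u (s + t)) (\<lambda>_. 1) x"
            by (rule nn_kernel_mono) (simp add: indicator_def)
          then show ?case using elim by (intro mult_right_mono) auto
        qed
      qed
      also have "\<dots> = ennreal N * emeasure \<mu> (D i)" by (simp add: nn_integral_cmult_indicator)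
      also have "\<dots> < \<infinity>" using D(1) by (simp add: ennreal_mult_less_top)
      finally show ?thesis by simp
    qed
    show "emeasure M\<^sub>1 X = emeasure M\<^sub>2 X" if "X \<in> ?E" for X
    proof -
      from that obtain A B where X: "X = A \<times> B" and AB [measurable]: "A \<in> sets \<mu>" "B \<in> sets \<mu>" by blast
      have X_eq: "X = (\<Union>i. A \<times> (B \<inter> D i))"
        using X D(3) sets.sets_into_space[OF AB(2)] by auto
      have inc: "incseq (\<lambda>i. A \<times> (B \<inter> D i))" using D(2) by (force simp: incseq_def)
      have "range (\<lambda>i. A \<times> (B \<inter> D i)) \<subseteq> sets (\<mu> \<Otimes>\<^sub>M \<mu>)" by auto
      then have "emeasure M\<^sub>1 X = (SUP i. emeasure M\<^sub>1 (A \<times> (B \<inter> D i)))"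
          "emeasure M\<^sub>2 X = (SUP i. emeasure M\<^sub>2 (A \<times> (B \<inter> D i)))"
        unfolding X_eq by (auto intro!: SUP_emeasure_incseq[symmetric] inc simp: M\<^sub>1_def M\<^sub>2_def)
      moreover have "emeasure M\<^sub>1 (A \<times> (B \<inter> D i)) = emeasure M\<^sub>2 (A \<times> (B \<inter> D i))" for i
      proof (rule finite_case[OF AB(1)])
        have "emeasure \<mu> (B \<inter> D i) \<le> emeasure \<mu> (D i)" by (intro emeasure_mono) auto
        also have "\<dots> < \<infinity>" using D(1) by blast
        finally show "emeasure \<mu> (B \<inter> D i) < \<infinity>" .
      qed measurable
      ultimately show ?thesis by simp
    qed
  qed
  then have "AE w in \<mu> \<Otimes>\<^sub>M \<mu>. k\<^sub>1 w = k\<^sub>2 w"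
    unfolding M\<^sub>1_def M\<^sub>2_def by (intro pair.P.density_unique) auto
  then show ?thesis by (simp add: k\<^sub>1_def k\<^sub>2_def case_prod_beta')
qed

text \<open>Strong continuity controls the norm of the difference of two transitions, and by
\<open>integral_le_L2_norm\<close> this controls its integral over a set of finite measure.\<close>

lemma rectangle_continuous:
  assumes A [measurable]: "A \<in> sets \<mu>" and B [measurable]: "B \<in> sets \<mu>"
    and fin: "emeasure \<mu> A < \<infinity>" "emeasure \<mu> B < \<infinity>"
  shows "continuous_on {0<..} (\<lambda>t. \<integral>\<^sup>+x. \<integral>\<^sup>+y.
    ennreal (normalized_kernel lam u t x y) * indicator A x * indicator B y \<partial>\<mu> \<partial>\<mu>)"
proof -
  define R where "R t = (\<integral>x. indicator A x *\<^sub>R transition t B x \<partial>\<mu>)" for t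
  have meas: "transition t B \<in> borel_measurable \<mu>" if "0 < t" for t
    using transition_in_Lp[OF that B fin(2)] by (simp add: Lp_def)
  have int: "integrable \<mu> (\<lambda>x. indicator A x *\<^sub>R transition t B x)" if t: "0 < t" for t
  proof (rule Bochner_Integration.integrable_bound)
    show "integrable \<mu> (\<lambda>x. indicator A x * norm (transition t B x))"
      by (rule integral_le_L2_norm(1)[OF transition_in_Lp[OF t B fin(2)] A fin(1)])
    show "(\<lambda>x. indicator A x *\<^sub>R transition t B x) \<in> borel_measurable \<mu>"
      using meas[OF t] by measurable
  qed simp
  have eq: "(\<integral>\<^sup>+x. \<integral>\<^sup>+y. ennreal (normalized_kernel lam u t x y) * indicator A x * indicator B y \<partial>\<mu> \<partial>\<mu>)
      = ennreal (exp (lam * t) * Re (R t))" if t: "0 < t" for t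
  proof -
    have [measurable]: "case_prod (u t) \<in> borel_measurable (\<mu> \<Otimes>\<^sub>M \<mu>)" using kernel_measurable t .
    let ?r = "\<lambda>x. indicator A x * Re (transition t B x)"
    have int_r: "integrable \<mu> ?r" using integrable_Re[OF int[OF t]] by simp
    have "(\<integral>\<^sup>+x. \<integral>\<^sup>+y. ennreal (normalized_kernel lam u t x y) * indicator A x * indicator B y \<partial>\<mu> \<partial>\<mu>)
        = (\<integral>\<^sup>+x. ennreal (exp (lam * t)) * indicator A x * nn_kernel \<mu> (u t) (indicator B) x \<partial>\<mu>)"
      unfolding nn_kernel_def normalized_kernel_def
      by (intro nn_integral_cong)
        (simp add: nn_integral_cmult[symmetric] ennreal_mult' ac_simps)
    also have "\<dots> = (\<integral>\<^sup>+x. ennreal (exp (lam * t) * ?r x) \<partial>\<mu>)"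
    proof (rule nn_integral_cong_AE)
      show "AE x in \<mu>. ennreal (exp (lam * t)) * indicator A x * nn_kernel \<mu> (u t) (indicator B) x
          = ennreal (exp (lam * t) * ?r x)"
        using nn_kernel_indicator[OF t B fin(2)]
        by eventually_elim (simp add: ennreal_mult' indicator_def)
    qed
    also have "\<dots> = ennreal (\<integral>x. exp (lam * t) * ?r x \<partial>\<mu>)"
    proof (rule nn_integral_eq_integral)
      show "integrable \<mu> (\<lambda>x. exp (lam * t) * ?r x)" using int_r by simp
      show "AE x in \<mu>. 0 \<le> exp (lam * t) * ?r x"
        using nn_kernel_indicator[OF t B fin(2)] by eventually_elim simp
    qed
    also have "(\<integral>x. exp (lam * t) * ?r x \<partial>\<mu>) = exp (lam * t) * Re (R t)"
      using int[OF t] by (simp add: R_def flip: integral_Re)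
    finally show ?thesis .
  qed
  have "(R \<longlongrightarrow> R s) (at s within {0<..})" if s: "0 < s" for s
  proof -
    let ?d = "\<lambda>t. Lp_norm \<mu> 2 (\<lambda>x. transition t B x - transition s B x)"
    have "(?d \<longlongrightarrow> 0) (at s within {0..})"
      using semigroup s indicator_in_Lp(2)[OF B fin(2)]
      unfolding strongly_continuous_semigroup_def by simp
    then have d: "(?d \<longlongrightarrow> 0) (at s within {0<..})"
      by (rule tendsto_within_subset) auto
    have "norm (R t - R s) \<le> (measure \<mu> A + 1) * ?d t" if t: "0 < t" for t
    proof -
      let ?h = "\<lambda>x. transition t B x - transition s B x"
      have h: "?h \<in> Lp \<mu> 2"
      proof -
        have T: "transition t B \<in> Lp \<mu> 2" "transition s B \<in> Lp \<mu> 2"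
          using transition_in_Lp[OF t B fin(2)] transition_in_Lp[OF s B fin(2)] .
        then have [measurable]: "transition t B \<in> borel_measurable \<mu>" "transition s B \<in> borel_measurable \<mu>"
          by (simp_all add: Lp_def)
        have "integrable \<mu> (\<lambda>x. norm (?h x) powr 2)"
        proof (rule Bochner_Integration.integrable_bound)
          show "integrable \<mu> (\<lambda>x. 2 * norm (transition t B x) powr 2 + 2 * norm (transition s B x) powr 2)"
            using T by (simp add: Lp_def)
          show "AE x in \<mu>. norm (norm (?h x) powr 2)
              \<le> norm (2 * norm (transition t B x) powr 2 + 2 * norm (transition s B x) powr 2)"
          proof (rule AE_I2)
            fix x
            have "(norm (?h x))\<^sup>2 \<le> (norm (transition t B x) + norm (transition s B x))\<^sup>2"
              by (intro power_mono norm_triangle_ineq4) simp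
            also have "\<dots> \<le> 2 * (norm (transition t B x))\<^sup>2 + 2 * (norm (transition s B x))\<^sup>2"
              using sum_squares_bound[of "norm (transition t B x)" "norm (transition s B x)"]
              by (simp add: power2_sum)
            finally show "norm (norm (?h x) powr 2)
                \<le> norm (2 * norm (transition t B x) powr 2 + 2 * norm (transition s B x) powr 2)"
              by simp
          qed
        qed measurable
        then show ?thesis by (simp add: Lp_def)
      qed
      have "R t - R s = (\<integral>x. indicator A x *\<^sub>R ?h x \<partial>\<mu>)"
        unfolding R_def using int[OF t] int[OF s] by (simp add: scaleR_diff_right)
      also have "norm \<dots> \<le> (\<integral>x. norm (indicator A x *\<^sub>R ?h x) \<partial>\<mu>)" by (rule integral_norm_bound)
      also have "\<dots> = (\<integral>x. indicator A x * norm (?h x) \<partial>\<mu>)" by simp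
      also have "\<dots> \<le> (measure \<mu> A + 1) * ?d t"
        by (rule integral_le_L2_norm(2)[OF h A fin(1)])
      finally show ?thesis .
    qed
    then have "\<forall>\<^sub>F t in at s within {0<..}. norm (R t - R s) \<le> (measure \<mu> A + 1) * ?d t"
      by (auto simp: eventually_at_filter)
    moreover have "((\<lambda>t. (measure \<mu> A + 1) * ?d t) \<longlongrightarrow> 0) (at s within {0<..})"
      by (rule tendsto_mult_right_zero[OF d])
    ultimately have "((\<lambda>t. R t - R s) \<longlongrightarrow> 0) (at s within {0<..})"
      by (rule Lim_null_comparison)
    then show ?thesis by (simp add: LIM_zero_iff)
  qed
  then have "continuous_on {0<..} R" by (simp add: continuous_on_def)
  then have "continuous_on {0<..} (\<lambda>t. exp (lam * t) * Re (R t))" by (intro continuous_intros)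
  then have "continuous_on {0<..} (\<lambda>t. ennreal (exp (lam * t) * Re (R t)))"
    by (auto simp: continuous_on_def intro!: tendsto_ennrealI)
  then show ?thesis
    by (rule continuous_on_cong[THEN iffD1, rotated 2]) (simp_all add: eq)
qed

end

section \<open>Ground states of the given semigroups\<close>

text \<open>The domination is rescaled by \<open>exp (lam t)\<close>. For the contraction at time \<open>t\<^sub>0\<close> the tail is required
to be at most \<open>exp (- lam t\<^sub>0)\<close>, which normalization turns into \<open>1\<close>; the compact set obtained
lies in some \<open>K\<^sub>T\<close>.\<close>

lemma dominated_kernel_semigroupI:
  fixes \<mu> :: "'a::topological_space measure"
  assumes lim: "kernel_semigroup_limit \<mu> (normalized_kernel lam u) \<phi> \<psi> \<Lambda> \<gamma> t\<^sub>0 K"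
    and \<mu>: "sets \<mu> = sets borel" "measure_support \<mu> = UNIV" and feller: "strong_feller \<mu> u"
    and pgsd: "pGSD \<mu> u lam \<phi> t\<^sub>0 K" and exhausting: "exhausting_family t\<^sub>0 K"
    and tight: "\<And>\<epsilon>::real. 0 < \<epsilon> \<Longrightarrow> \<exists>L. compact L \<and> (\<forall>x\<in>- L. cont_semigroup \<mu> u t\<^sub>0 (\<lambda>_. 1) x \<le> \<epsilon>)"
  shows "dominated_kernel_semigroup \<mu> (normalized_kernel lam u) \<phi> \<psi> \<Lambda> \<gamma> t\<^sub>0 K"
proof -
  interpret kernel_semigroup_limit \<mu> "normalized_kernel lam u" \<phi> \<psi> \<Lambda> \<gamma> t\<^sub>0 K by (fact lim)
  let ?G = "\<lambda>t. cont_semigroup \<mu> u t (\<lambda>_. 1) :: 'a \<Rightarrow> real"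
  have u_nonneg: "AE x in \<mu>. AE y in \<mu>. 0 \<le> u t x y" if t: "0 < t" for t
    using kernel_AE[OF t] by (simp add: normalized_kernel_def zero_le_mult_iff)
  note one = nn_kernel_one_version[OF \<mu> feller _ u_nonneg, where lam = lam]
  show ?thesis
  proof unfold_locales
    show "\<exists>N::real. AE x in \<mu>. nn_kernel \<mu> (normalized_kernel lam u t) (\<lambda>_. 1) x \<le> ennreal N" if t: "0 < t" for t
      by (rule strong_feller_bounded[OF \<mu> feller t u_nonneg[OF t]])
    show "\<exists>C>0. \<forall>t\<ge>t\<^sub>0. AE x in \<mu>. x \<in> K t \<longrightarrow>
        nn_kernel \<mu> (normalized_kernel lam u t) (\<lambda>_. 1) x \<le> ennreal (C * \<phi> x)"
    proof -
      obtain C where C: "0 < C" "\<forall>t\<ge>t\<^sub>0. \<forall>x. indicator (K t) x * ?G t x \<le> C * exp (- lam * t) * \<phi> x"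
        using pgsd unfolding pGSD_def by (elim exE conjE)
      have "AE x in \<mu>. x \<in> K t \<longrightarrow> nn_kernel \<mu> (normalized_kernel lam u t) (\<lambda>_. 1) x \<le> ennreal (C * \<phi> x)"
        if t: "t\<^sub>0 \<le> t" for t
      proof -
        have "0 < t" using t t0_pos by simp
        from one[OF this this] show ?thesis
        proof (eventually_elim, intro impI)
          fix x assume x: "x \<in> K t" and *: "0 \<le> ?G t x \<and>
            nn_kernel \<mu> (normalized_kernel lam u t) (\<lambda>_. 1) x = ennreal (exp (lam * t) * ?G t x)"
          have "exp (lam * t) * ?G t x \<le> exp (lam * t) * (C * exp (- lam * t) * \<phi> x)"
            using C(2)[rule_format, OF t, of x] x by (intro mult_left_mono) auto
          also have "\<dots> = (exp (lam * t) * exp (- lam * t)) * (C * \<phi> x)" by (simp only: ac_simps)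
          also have "\<dots> = C * \<phi> x" by (simp flip: exp_add)
          finally show "nn_kernel \<mu> (normalized_kernel lam u t) (\<lambda>_. 1) x \<le> ennreal (C * \<phi> x)"
            using * by (simp add: ennreal_leI)
        qed
      qed
      then show ?thesis using C(1) by blast
    qed
    show "\<exists>T\<ge>t\<^sub>0. AE x in \<mu>. x \<notin> K T \<longrightarrow> nn_kernel \<mu> (normalized_kernel lam u t\<^sub>0) (\<lambda>_. 1) x \<le> 1"
    proof -
      obtain L where L: "compact L" "\<forall>x\<in>- L. ?G t\<^sub>0 x \<le> exp (- (lam * t\<^sub>0))"
        using tight[of "exp (- (lam * t\<^sub>0))"] by auto
      have "\<exists>T\<ge>t\<^sub>0. L \<subseteq> K T" using exhausting L(1) by (simp add: exhausting_family_def)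
      then obtain T where T: "t\<^sub>0 \<le> T" "L \<subseteq> K T" by blast
      have "AE x in \<mu>. x \<notin> K T \<longrightarrow> nn_kernel \<mu> (normalized_kernel lam u t\<^sub>0) (\<lambda>_. 1) x \<le> 1"
        using one[OF t0_pos t0_pos]
      proof (eventually_elim, intro impI)
        fix x assume x: "x \<notin> K T" and *: "0 \<le> ?G t\<^sub>0 x \<and>
          nn_kernel \<mu> (normalized_kernel lam u t\<^sub>0) (\<lambda>_. 1) x = ennreal (exp (lam * t\<^sub>0) * ?G t\<^sub>0 x)"
        have "exp (lam * t\<^sub>0) * ?G t\<^sub>0 x \<le> exp (lam * t\<^sub>0) * exp (- (lam * t\<^sub>0))"
          using L(2) T(2) x by (intro mult_left_mono) auto
        also have "\<dots> = 1" by (simp flip: exp_add)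
        finally show "nn_kernel \<mu> (normalized_kernel lam u t\<^sub>0) (\<lambda>_. 1) x \<le> 1"
          using * by simp
      qed
      then show ?thesis using T(1) by blast
    qed
  qed
qed

text \<open>Square integrability comes from the domain of the generator, the upper bound from continuity
and boundedness.\<close>

lemma ground_state_properties:
  assumes "ground_state \<mu> T lam \<phi>"
  shows "\<phi> \<in> bcontfun" "AE x in \<mu>. 0 < \<phi> x" "\<phi> \<in> borel_measurable \<mu>" "integrable \<mu> (\<lambda>x. \<phi> x ^ 2)"
    "\<exists>B. AE x in \<mu>. 0 < \<phi> x \<and> \<phi> x \<le> B"
proof -
  show bc: "\<phi> \<in> bcontfun" and pos: "AE x in \<mu>. 0 < \<phi> x" using assms by (simp_all add: ground_state_def)
  have L2: "(\<lambda>x. complex_of_real (\<phi> x)) \<in> Lp \<mu> 2"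
    using assms by (auto simp: ground_state_def eigenfunction_def neg_operator_def generator_def)
  then have [measurable]: "(\<lambda>x. complex_of_real (\<phi> x)) \<in> borel_measurable \<mu>" by (simp add: Lp_def)
  have "(\<lambda>x. Re (complex_of_real (\<phi> x))) \<in> borel_measurable \<mu>" by measurable
  then show "\<phi> \<in> borel_measurable \<mu>" by simp
  have "integrable \<mu> (\<lambda>x. norm (complex_of_real (\<phi> x)) powr 2)" using L2 by (simp add: Lp_def)
  then show "integrable \<mu> (\<lambda>x. \<phi> x ^ 2)" by simp
  obtain B where B: "\<And>x. norm (\<phi> x) \<le> B" using bc by (auto simp: bcontfun_def bounded_iff)
  from pos have "AE x in \<mu>. 0 < \<phi> x \<and> \<phi> x \<le> B"
  proof eventually_elim
    case (elim x)
    then show ?case using B[of x] by simp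
  qed
  then show "\<exists>B. AE x in \<mu>. 0 < \<phi> x \<and> \<phi> x \<le> B" by blast
qed

text \<open>The two estimates are \<open>quasi_ergodic_bound\<close> for the kernel and for its transpose. Each of them
involves one of the two suprema in the rate; since both suprema are nonnegative, the full rate
dominates either.\<close>

theorem theorem5p2:
  fixes \<mu> :: "'a::polish_space measure"
    and u :: "real \<Rightarrow> 'a \<Rightarrow> 'a \<Rightarrow> real"
    and t\<^sub>0 lam\<^sub>0 \<gamma> :: real
    and \<phi>\<^sub>0 \<psi>\<^sub>0 :: "'a \<Rightarrow> real"
    and K :: "real \<Rightarrow> 'a set"
  assumes loc_compact: "locally compact (UNIV :: 'a set)"
    and noncompact: "\<not> compact (UNIV :: 'a set)"
    and borel_sets: "sets \<mu> = sets borel"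
    and loc_finite: "locally_finite_measure \<mu>"
    and full_support: "measure_support \<mu> = UNIV"
    and kernel_measurable: "\<And>t. t > 0 \<Longrightarrow> case_prod (u t) \<in> borel_measurable (\<mu> \<Otimes>\<^sub>M \<mu>)"
    and kernel_L2: "\<And>t. t > 0 \<Longrightarrow> kernel_defined_on \<mu> (u t) (Lp \<mu> 2)"
    and kernel_L2_adj: "\<And>t. t > 0 \<Longrightarrow> kernel_defined_on \<mu> (transpose_kernel u t) (Lp \<mu> 2)"
    and semigroup: "strongly_continuous_semigroup \<mu> (kernel_semigroup \<mu> u)"
    and adjoint: "adjoint_operators_family \<mu> (kernel_semigroup \<mu> u) (kernel_semigroup \<mu> (transpose_kernel u))"
    and pos_preserving: "\<And>t. t \<ge> 0 \<Longrightarrow> positivity_preserving \<mu> (kernel_semigroup \<mu> u t)"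
    and t0_pos: "t\<^sub>0 > 0"
    and compact_ops: "\<And>t. t > 0 \<Longrightarrow> compact_L2_operator \<mu> (kernel_semigroup \<mu> u t)"
    and pos_improving: "positivity_improving \<mu> (kernel_semigroup \<mu> u t\<^sub>0)"
    and feller: "strong_feller \<mu> u"
    and feller_adj: "strong_feller \<mu> (transpose_kernel u)"
    and L2_Linf: "bounded_Lp_operator \<mu> 2 \<top> (kernel_semigroup \<mu> u t\<^sub>0)"
    and L2_Linf_adj: "bounded_Lp_operator \<mu> 2 \<top> (kernel_semigroup \<mu> (transpose_kernel u) t\<^sub>0)"
    and tightness: "\<And>t (\<epsilon>::real). t \<ge> t\<^sub>0 \<Longrightarrow> \<epsilon> > 0 \<Longrightarrow>
           \<exists>L. compact L \<and> (\<forall>x \<in> - L. cont_semigroup \<mu> u t (\<lambda>_. 1) x \<le> \<epsilon> \<and>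
                                      cont_semigroup \<mu> (transpose_kernel u) t (\<lambda>_. 1) x \<le> \<epsilon>)"
    and lam0: "lam\<^sub>0 = spectral_bottom \<mu> (kernel_semigroup \<mu> u)"
    and phi0: "ground_state \<mu> (kernel_semigroup \<mu> u) lam\<^sub>0 \<phi>\<^sub>0"
    and psi0: "ground_state \<mu> (kernel_semigroup \<mu> (transpose_kernel u)) lam\<^sub>0 \<psi>\<^sub>0"
    and gamma_pos: "\<gamma> > 0"
    and gamma: "\<exists>C\<^sub>0>0. \<forall>t > 2 * t\<^sub>0. AE (x, y) in \<mu> \<Otimes>\<^sub>M \<mu>.
           \<bar>exp (lam\<^sub>0 * t) * u t x y - \<phi>\<^sub>0 x * \<psi>\<^sub>0 y / (\<integral>z. \<phi>\<^sub>0 z * \<psi>\<^sub>0 z \<partial>\<mu>)\<bar> \<le> C\<^sub>0 * exp (- \<gamma> * t)"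
    and exhausting: "exhausting_family t\<^sub>0 K"
    and pgsd: "pGSD \<mu> u lam\<^sub>0 \<phi>\<^sub>0 t\<^sub>0 K"
    and pgsd_adj: "pGSD \<mu> (transpose_kernel u) lam\<^sub>0 \<psi>\<^sub>0 t\<^sub>0 K"
  shows "\<phi>\<^sub>0 \<in> Lp \<mu> 1 \<and> \<psi>\<^sub>0 \<in> Lp \<mu> 1 \<and>
    (\<forall>a \<in> {0<..<1}. \<forall>b \<in> {0<..<1}. \<forall>p::ennreal. a + 2 * b = 1 \<and> 1 \<le> p \<longrightarrow>
      (\<exists>C>0. \<forall>t > 4 / min a b * t\<^sub>0.
         quasi_ergodic_error \<mu> u t p
           (admissible_measures (K (a * t)) ({x. \<phi>\<^sub>0 x = 0} \<union> {x. \<psi>\<^sub>0 x = 0}))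
           (normalized_density \<mu> \<psi>\<^sub>0) \<le> ennreal (C * kappa \<mu> u t\<^sub>0 \<gamma> K b t) \<and>
         quasi_ergodic_error \<mu> (transpose_kernel u) t p
           (admissible_measures (K (a * t)) ({x. \<phi>\<^sub>0 x = 0} \<union> {x. \<psi>\<^sub>0 x = 0}))
           (normalized_density \<mu> \<phi>\<^sub>0) \<le> ennreal (C * kappa \<mu> u t\<^sub>0 \<gamma> K b t)))"
proof -
  interpret sigma_finite_measure \<mu>
    by (rule sigma_finite_of_locally_finite[OF borel_sets loc_finite])
  interpret S: L2_kernel_semigroup \<mu> u
    by unfold_locales
      (use borel_sets full_support kernel_measurable kernel_L2 semigroup pos_preserving feller in auto)
  note phi = ground_state_properties[OF phi0] and psi = ground_state_properties[OF psi0]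
  have [measurable]: "\<phi>\<^sub>0 \<in> borel_measurable \<mu>" "\<psi>\<^sub>0 \<in> borel_measurable \<mu>" by (fact phi(3) psi(3))+
  define \<Lambda> where "\<Lambda> = (\<integral>z. \<phi>\<^sub>0 z * \<psi>\<^sub>0 z \<partial>\<mu>)"
  have pos: "AE x in \<mu>. 0 < \<phi>\<^sub>0 x * \<psi>\<^sub>0 x" using phi(2) psi(2) by eventually_elim simp
  then have nonneg: "AE x in \<mu>. 0 \<le> \<phi>\<^sub>0 x * \<psi>\<^sub>0 x" by eventually_elim simp
  have int: "integrable \<mu> (\<lambda>x. \<phi>\<^sub>0 x * \<psi>\<^sub>0 x)"
  proof (rule Bochner_Integration.integrable_bound)
    show "integrable \<mu> (\<lambda>x. \<phi>\<^sub>0 x ^ 2 + \<psi>\<^sub>0 x ^ 2)" using phi(4) psi(4) by simp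
    show "AE x in \<mu>. norm (\<phi>\<^sub>0 x * \<psi>\<^sub>0 x) \<le> norm (\<phi>\<^sub>0 x ^ 2 + \<psi>\<^sub>0 x ^ 2)"
      using nonneg
    proof eventually_elim
      case (elim x)
      then show ?case using sum_squares_bound[of "\<phi>\<^sub>0 x" "\<psi>\<^sub>0 x"] by simp
    qed
  qed measurable
  have "\<Lambda> \<noteq> 0"
  proof
    assume "\<Lambda> = 0"
    then have "AE x in \<mu>. \<phi>\<^sub>0 x * \<psi>\<^sub>0 x = 0"
      using int nonneg by (simp add: \<Lambda>_def integral_nonneg_eq_0_iff_AE)
    with pos have "AE x in \<mu>. False" by eventually_elim simp
    then have "emeasure \<mu> (space \<mu>) = 0" by (simp add: eventually_False ae_filter_eq_bot_iff)
    moreover have "space \<mu> = UNIV" using sets_eq_imp_space_eq[OF borel_sets] by simp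
    moreover have "undefined \<in> measure_support \<mu>" using full_support by simp
    then have "0 < emeasure \<mu> UNIV" unfolding measure_support_def using open_UNIV by blast
    ultimately show False by simp
  qed
  moreover have "0 \<le> \<Lambda>" unfolding \<Lambda>_def using nonneg by (rule integral_nonneg_AE)
  ultimately have Lambda_pos: "0 < \<Lambda>" by simp
  have K: "compact (K t)" if "t\<^sub>0 \<le> t" for t using exhausting that by (simp add: exhausting_family_def)
  have tr: "normalized_kernel lam\<^sub>0 (transpose_kernel u) = transpose_kernel (normalized_kernel lam\<^sub>0 u)"
    by (simp add: normalized_kernel_def transpose_kernel_def)
  have limit: "kernel_semigroup_limit \<mu> (normalized_kernel lam\<^sub>0 u) \<phi>\<^sub>0 \<psi>\<^sub>0 \<Lambda> \<gamma> t\<^sub>0 K"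
  proof unfold_locales
    show "0 < t\<^sub>0" "0 < \<gamma>" "0 < \<Lambda>" by (fact t0_pos gamma_pos Lambda_pos)+
    show "\<phi>\<^sub>0 \<in> borel_measurable \<mu>" "\<psi>\<^sub>0 \<in> borel_measurable \<mu>" by (fact phi(3) psi(3))+
    show "\<exists>B. AE x in \<mu>. 0 < \<phi>\<^sub>0 x \<and> \<phi>\<^sub>0 x \<le> B" "\<exists>B. AE x in \<mu>. 0 < \<psi>\<^sub>0 x \<and> \<psi>\<^sub>0 x \<le> B"
      by (fact phi(5) psi(5))+
    show "(\<integral>\<^sup>+x. ennreal (\<phi>\<^sub>0 x * \<psi>\<^sub>0 x) \<partial>\<mu>) = ennreal \<Lambda>"
      unfolding \<Lambda>_def using int nonneg by (rule nn_integral_eq_integral)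
    show "case_prod (normalized_kernel lam\<^sub>0 u t) \<in> borel_measurable (\<mu> \<Otimes>\<^sub>M \<mu>)" if "0 < t" for t
    proof -
      have [measurable]: "case_prod (u t) \<in> borel_measurable (\<mu> \<Otimes>\<^sub>M \<mu>)" using kernel_measurable that .
      show ?thesis unfolding normalized_kernel_def by measurable
    qed
    show "AE (x, y) in \<mu> \<Otimes>\<^sub>M \<mu>. 0 \<le> normalized_kernel lam\<^sub>0 u t x y" if t: "0 < t" for t
    proof -
      have [measurable]: "case_prod (u t) \<in> borel_measurable (\<mu> \<Otimes>\<^sub>M \<mu>)" using kernel_measurable t .
      have "AE w in \<mu> \<Otimes>\<^sub>M \<mu>. 0 \<le> u t (fst w) (snd w)"
        by (rule S.pair.AE_pair_measure) (use S.kernel_nonneg[OF t] in simp_all)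
      then show ?thesis by (simp add: normalized_kernel_def case_prod_beta' zero_le_mult_iff)
    qed
    show "AE (x, y) in \<mu> \<Otimes>\<^sub>M \<mu>. ennreal (normalized_kernel lam\<^sub>0 u (s + t) x y)
        = (\<integral>\<^sup>+z. ennreal (normalized_kernel lam\<^sub>0 u s x z) * ennreal (normalized_kernel lam\<^sub>0 u t z y) \<partial>\<mu>)"
      if st: "0 < s" "0 < t" for s t
    proof -
      have [measurable]: "case_prod (u s) \<in> borel_measurable (\<mu> \<Otimes>\<^sub>M \<mu>)"
        "case_prod (u t) \<in> borel_measurable (\<mu> \<Otimes>\<^sub>M \<mu>)"
        using kernel_measurable st by simp_all
      from S.kernel_law[OF st] AE_space show ?thesis
      proof eventually_elim
        case (elim w)
        obtain x y where w: "w = (x, y)" by force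
        with elim have [measurable]: "x \<in> space \<mu>" "y \<in> space \<mu>" by (auto simp: space_pair_measure)
        have "(\<integral>\<^sup>+z. ennreal (normalized_kernel lam\<^sub>0 u s x z) * ennreal (normalized_kernel lam\<^sub>0 u t z y) \<partial>\<mu>)
            = (\<integral>\<^sup>+z. ennreal (exp (lam\<^sub>0 * (s + t))) * (ennreal (u s x z) * ennreal (u t z y)) \<partial>\<mu>)"
          by (intro nn_integral_cong)
            (simp add: normalized_kernel_def distrib_left exp_add ennreal_mult' ac_simps)
        also have "\<dots> = ennreal (exp (lam\<^sub>0 * (s + t))) * (\<integral>\<^sup>+z. ennreal (u s x z) * ennreal (u t z y) \<partial>\<mu>)"
          by (rule nn_integral_cmult) measurable
        also have "\<dots> = ennreal (normalized_kernel lam\<^sub>0 u (s + t) x y)"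
          using elim(1) w by (simp add: normalized_kernel_def ennreal_mult')
        finally show ?case using w by simp
      qed
    qed
    show "\<exists>C>0. \<forall>t>2 * t\<^sub>0. AE (x, y) in \<mu> \<Otimes>\<^sub>M \<mu>.
        \<bar>normalized_kernel lam\<^sub>0 u t x y - \<phi>\<^sub>0 x * \<psi>\<^sub>0 y / \<Lambda>\<bar> \<le> C * exp (- \<gamma> * t)"
      using gamma unfolding normalized_kernel_def \<Lambda>_def .
    show "continuous_on {0<..} (\<lambda>t. \<integral>\<^sup>+x. \<integral>\<^sup>+y.
        ennreal (normalized_kernel lam\<^sub>0 u t x y) * indicator A x * indicator B y \<partial>\<mu> \<partial>\<mu>)"
      if "A \<in> sets \<mu>" "B \<in> sets \<mu>" "emeasure \<mu> A < \<infinity>" "emeasure \<mu> B < \<infinity>" for A B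
      using S.rectangle_continuous that .
    show "K t \<in> sets \<mu>" if "t\<^sub>0 \<le> t" for t
      using compact_imp_closed[OF K[OF that]] borel_sets by simp
    show "K s \<subseteq> K t" if "t\<^sub>0 \<le> s" "s \<le> t" for s t
      using exhausting that by (cases "s = t") (auto simp: exhausting_family_def)
    show "space \<mu> \<subseteq> (\<Union>t\<in>{t\<^sub>0..}. K t)" using exhausting by (simp add: exhausting_family_def)
  qed
  have limit_tr: "kernel_semigroup_limit \<mu> (normalized_kernel lam\<^sub>0 (transpose_kernel u)) \<psi>\<^sub>0 \<phi>\<^sub>0 \<Lambda> \<gamma> t\<^sub>0 K"
    unfolding tr by (rule kernel_semigroup_limit.transposed[OF limit])
  have tight: "\<exists>L. compact L \<and> (\<forall>x\<in>- L. cont_semigroup \<mu> u t\<^sub>0 (\<lambda>_. 1) x \<le> \<epsilon>)"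
    and tight_tr: "\<exists>L. compact L \<and> (\<forall>x\<in>- L. cont_semigroup \<mu> (transpose_kernel u) t\<^sub>0 (\<lambda>_. 1) x \<le> \<epsilon>)"
    if eps: "0 < \<epsilon>" for \<epsilon> :: real
  proof -
    obtain L where L: "compact L" "\<forall>x\<in>- L. cont_semigroup \<mu> u t\<^sub>0 (\<lambda>_. 1) x \<le> \<epsilon> \<and>
        cont_semigroup \<mu> (transpose_kernel u) t\<^sub>0 (\<lambda>_. 1) x \<le> \<epsilon>"
      using tightness[OF order_refl eps] by (elim exE conjE)
    show "\<exists>L. compact L \<and> (\<forall>x\<in>- L. cont_semigroup \<mu> u t\<^sub>0 (\<lambda>_. 1) x \<le> \<epsilon>)"
      using L by (intro exI[of _ L]) simp
    show "\<exists>L. compact L \<and> (\<forall>x\<in>- L. cont_semigroup \<mu> (transpose_kernel u) t\<^sub>0 (\<lambda>_. 1) x \<le> \<epsilon>)"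
      using L by (intro exI[of _ L]) simp
  qed
  have half: "dominated_kernel_semigroup \<mu> (normalized_kernel lam\<^sub>0 u) \<phi>\<^sub>0 \<psi>\<^sub>0 \<Lambda> \<gamma> t\<^sub>0 K"
    by (rule dominated_kernel_semigroupI[OF limit borel_sets full_support feller pgsd exhausting tight])
  have half_tr: "dominated_kernel_semigroup \<mu> (transpose_kernel (normalized_kernel lam\<^sub>0 u)) \<psi>\<^sub>0 \<phi>\<^sub>0 \<Lambda> \<gamma> t\<^sub>0 K"
    unfolding tr[symmetric]
    by (rule dominated_kernel_semigroupI[OF limit_tr borel_sets full_support feller_adj pgsd_adj exhausting tight_tr])
  have pair: "dominated_kernel_pair \<mu> (normalized_kernel lam\<^sub>0 u) \<phi>\<^sub>0 \<psi>\<^sub>0 \<Lambda> \<gamma> t\<^sub>0 K"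
    using half half_tr by (rule dominated_kernel_pair.intro)
  have pair_tr: "dominated_kernel_pair \<mu> (normalized_kernel lam\<^sub>0 (transpose_kernel u)) \<psi>\<^sub>0 \<phi>\<^sub>0 \<Lambda> \<gamma> t\<^sub>0 K"
    unfolding tr by (rule dominated_kernel_pair.swapped[OF pair])
  have proper: "K t \<noteq> UNIV" if "t\<^sub>0 \<le> t" for t using K[OF that] noncompact by auto
  interpret F: feller_ground_state_pair \<mu> lam\<^sub>0 u \<phi>\<^sub>0 \<psi>\<^sub>0 \<Lambda> \<gamma> t\<^sub>0 K
    by (intro feller_ground_state_pair.intro pair feller_ground_state_pair_axioms.intro
        borel_sets full_support feller phi(1) psi(1) pgsd proper)
  interpret G: feller_ground_state_pair \<mu> lam\<^sub>0 "transpose_kernel u" \<psi>\<^sub>0 \<phi>\<^sub>0 \<Lambda> \<gamma> t\<^sub>0 K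
    by (intro feller_ground_state_pair.intro pair_tr feller_ground_state_pair_axioms.intro
        borel_sets full_support feller_adj phi(1) psi(1) pgsd_adj proper)
  have L1: "\<phi>\<^sub>0 \<in> Lp \<mu> 1" "\<psi>\<^sub>0 \<in> Lp \<mu> 1"
    using F.psi_integrable(1) G.psi_integrable(1) by (simp_all add: Lp_def)
  have main: "\<exists>C>0. \<forall>t > 4 / min a b * t\<^sub>0.
         quasi_ergodic_error \<mu> u t p
           (admissible_measures (K (a * t)) ({x. \<phi>\<^sub>0 x = 0} \<union> {x. \<psi>\<^sub>0 x = 0}))
           (normalized_density \<mu> \<psi>\<^sub>0) \<le> ennreal (C * kappa \<mu> u t\<^sub>0 \<gamma> K b t) \<and>
         quasi_ergodic_error \<mu> (transpose_kernel u) t p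
           (admissible_measures (K (a * t)) ({x. \<phi>\<^sub>0 x = 0} \<union> {x. \<psi>\<^sub>0 x = 0}))
           (normalized_density \<mu> \<phi>\<^sub>0) \<le> ennreal (C * kappa \<mu> u t\<^sub>0 \<gamma> K b t)"
    if ab: "0 < a" "0 < b" "a + 2 * b = 1" and p: "1 \<le> p" for a b p
  proof -
    let ?Z = "{x. \<phi>\<^sub>0 x = 0} \<union> {x. \<psi>\<^sub>0 x = 0}"
    obtain C where C: "0 < C" "\<forall>t>4 / min a b * t\<^sub>0.
        quasi_ergodic_error \<mu> u t p (admissible_measures (K (a * t)) ?Z) (normalized_density \<mu> \<psi>\<^sub>0)
          \<le> ennreal (C * (exp (- \<gamma> * b * t) + F.tail_sup (b * t)))"
      using F.quasi_ergodic_bound[OF ab p Un_upper1[where A = "{x. \<phi>\<^sub>0 x = 0}" and B = "{x. \<psi>\<^sub>0 x = 0}"]]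
      by (elim exE conjE)
    obtain C' where C': "0 < C'" "\<forall>t>4 / min a b * t\<^sub>0.
        quasi_ergodic_error \<mu> (transpose_kernel u) t p (admissible_measures (K (a * t)) ?Z) (normalized_density \<mu> \<phi>\<^sub>0)
          \<le> ennreal (C' * (exp (- \<gamma> * b * t) + G.tail_sup (b * t)))"
      using G.quasi_ergodic_bound[OF ab p Un_upper2[where A = "{x. \<phi>\<^sub>0 x = 0}" and B = "{x. \<psi>\<^sub>0 x = 0}"]]
      by (elim exE conjE)
    have "C * (exp (- \<gamma> * b * t) + F.tail_sup (b * t)) \<le> max C C' * kappa \<mu> u t\<^sub>0 \<gamma> K b t \<and>
        C' * (exp (- \<gamma> * b * t) + G.tail_sup (b * t)) \<le> max C C' * kappa \<mu> u t\<^sub>0 \<gamma> K b t"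
      if t: "4 / min a b * t\<^sub>0 < t" for t
    proof -
      have t_min: "4 * t\<^sub>0 < min a b * t" using t ab by (simp add: field_simps)
      have "0 < 4 / min a b * t\<^sub>0" using ab t0_pos by simp
      then have "min a b * t \<le> b * t" using t by (intro mult_right_mono) auto
      with t_min have "t\<^sub>0 \<le> b * t" using t0_pos by linarith
      then have nonneg: "0 \<le> F.tail_sup (b * t)" "0 \<le> G.tail_sup (b * t)"
        using F.tail_sup_nonneg G.tail_sup_nonneg by blast+
      have "kappa \<mu> u t\<^sub>0 \<gamma> K b t = exp (- \<gamma> * b * t) + F.tail_sup (b * t) + G.tail_sup (b * t)"
        by (simp add: kappa_def F.tail_sup_def G.tail_sup_def)
      then show ?thesis
        using nonneg C(1) C'(1) by (intro conjI mult_mono) auto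
    qed
    note bound = this
    show ?thesis
    proof (intro exI[of _ "max C C'"] conjI allI impI)
      fix t assume t: "4 / min a b * t\<^sub>0 < t"
      show "quasi_ergodic_error \<mu> u t p (admissible_measures (K (a * t)) ?Z) (normalized_density \<mu> \<psi>\<^sub>0)
          \<le> ennreal (max C C' * kappa \<mu> u t\<^sub>0 \<gamma> K b t)"
        by (rule order_trans[OF C(2)[rule_format, OF t] ennreal_leI[OF conjunct1[OF bound[OF t]]]])
      show "quasi_ergodic_error \<mu> (transpose_kernel u) t p (admissible_measures (K (a * t)) ?Z) (normalized_density \<mu> \<phi>\<^sub>0)
          \<le> ennreal (max C C' * kappa \<mu> u t\<^sub>0 \<gamma> K b t)"
        by (rule order_trans[OF C'(2)[rule_format, OF t] ennreal_leI[OF conjunct2[OF bound[OF t]]]])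
    qed (use C(1) in simp)
  qed
  show ?thesis
  proof (intro conjI ballI allI impI L1)
    fix a b :: real and p :: ennreal
    assume "a \<in> {0<..<1}" "b \<in> {0<..<1}" "a + 2 * b = 1 \<and> 1 \<le> p"
    then have "0 < a" "0 < b" "a + 2 * b = 1" "1 \<le> p" by simp_all
    then show "\<exists>C>0. \<forall>t > 4 / min a b * t\<^sub>0.
         quasi_ergodic_error \<mu> u t p
           (admissible_measures (K (a * t)) ({x. \<phi>\<^sub>0 x = 0} \<union> {x. \<psi>\<^sub>0 x = 0}))
           (normalized_density \<mu> \<psi>\<^sub>0) \<le> ennreal (C * kappa \<mu> u t\<^sub>0 \<gamma> K b t) \<and>
         quasi_ergodic_error \<mu> (transpose_kernel u) t p
           (admissible_measures (K (a * t)) ({x. \<phi>\<^sub>0 x = 0} \<union> {x. \<psi>\<^sub>0 x = 0}))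
           (normalized_density \<mu> \<phi>\<^sub>0) \<le> ennreal (C * kappa \<mu> u t\<^sub>0 \<gamma> K b t)"
      by (rule main)
  qed
qed

end
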